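(* Let $\delta>0$, $p\in[2,\infty)$, and let $\mu$ be a $\Lambda(p)$ Cantor measure supported on the $\Lambda(p)$ Cantor set $E_\infty$, with $N$ large enough depending on $p$ and $\delta$. Let $X,Y\subset\mathbb{R}$ be sets such that, for some choice of positive numbers $\{t(x)\}_{x\in Y}$, $$\bigcup_{x\in Y}\big(x+t(x)E_\infty\big)\subset X.$$ Let $X_j$ and $Y_j$ denote the $N^{-j}$-neighbourhoods of $X$ and $Y$. Then $|X_j|\gtrsim_N N^{-j\delta p}|Y_j|$, uniformly in $j$. In particular, $$\overline{\dim_M}(X)\ge\overline{\dim_M}(Y)-\delta,$$ where $\overline{\dim_M}$ denotes the upper Minkowski dimension of a set, and the same is true for the lower Minkowski dimension.
   Context: $|\cdot|$ denotes Lebesgue measure of subsets of $\mathbb{R}$; $X\gtrsim_N Y$ means $X\ge cY$ with $c>0$ possibly depending on $N$ (and on $p,\delta$), but not on $j$. **$\Lambda(p)$ Cantor sets and measures.** For the given $p$, constants $c_0,c_1,C(p)>0$ independent of $N$ are fixed throughout, such that for every sufficiently large $N$ there are sets $S$ with the properties (a), (b) below (their existence is a theorem of Bourgain). Write $[N]=\{0,1,\dots,N-1\}$. Let $N$ be a large positive integer, $0<N_0<N$ an integer, and let $\Sigma$ be a non-empty collection of subsets $S\subset[N-1]=\{0,\dots,N-2\}$ with $|S|=N_0$ for all $S\in\Sigma$, each satisfying (a) $\big\|\sum_{a\in S}c_ae^{2\pi i ax}\big\|_{L^p([0,1])}\le C(p)\big(\sum_{a\in S}|c_a|^2\big)^{1/2}$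 for all coefficients $\{c_a\}_{a\in S}$; (b) $c_0N^{2/p}\le|S|\le c_1N^{2/p}$. Choose $S_1\in\Sigma$ and let $A_1=1+N^{-1}S_1$, $E_1=A_1+[0,N^{-1}]$. Inductively, for $k\ge1$ and every $a\in A_k$ choose $S_{k+1,a}\in\Sigma$ and let $A_{k+1,a}=a+N^{-k-1}S_{k+1,a}$, $A_{k+1}=\bigcup_{a\in A_k}A_{k+1,a}$, $E_{k+1}=A_{k+1}+[0,N^{-k-1}]$. Then $E_\infty=\bigcap_{j\ge1}E_j\subset[1,2]$ is called a $\Lambda(p)$ Cantor set, and the weak limit $\mu$ of the probability measures $\frac1{|E_j|}\mathbf{1}_{E_j}\,dx$ is called a $\Lambda(p)$ Cantor measure (with parameter $N$). "$N$ large enough depending on given quantities" means $N\ge N_*$, where $N_*$ depends only on these quantities and on the fixed constants $c_0,c_1,C(p)$. *)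

theory Defs
  imports "HOL-Probability.Probability"
begin

definition Lp_norm_unit :: "real \<Rightarrow> (real \<Rightarrow> complex) \<Rightarrow> real" where
  "Lp_norm_unit p f = (LINT x:{0..1}|lborel. norm (f x) powr p) powr (1 / p)"

definition Lambda_p_set ::
  "real \<Rightarrow> real \<Rightarrow> real \<Rightarrow> real \<Rightarrow> nat \<Rightarrow> nat set \<Rightarrow> bool" where
  "Lambda_p_set p c0 c1 C N S \<longleftrightarrow>
     S \<subseteq> {..<N - 1} \<and>
     (\<forall>c :: nat \<Rightarrow> complex.
        Lp_norm_unit p (\<lambda>x. \<Sum>a\<in>S. c a * cis (2 * pi * real a * x))
          \<le> C * sqrt (\<Sum>a\<in>S. (norm (c a))\<^sup>2)) \<and>
     c0 * real N powr (2 / p) \<le> real (card S) \<and>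
     real (card S) \<le> c1 * real N powr (2 / p)"

text \<open>
  The left endpoints of the intervals of the construction. The digit set used below the point \<open>a\<close>
  of generation \<open>k\<close> is \<open>S k a\<close>. Generation \<open>0\<close> is the single point \<open>1\<close>, so that the digit set
  producing the first generation is \<open>S 0 1\<close>.
\<close>

primrec cantor_points :: "nat \<Rightarrow> (nat \<Rightarrow> real \<Rightarrow> nat set) \<Rightarrow> nat \<Rightarrow> real set" where
  "cantor_points N S 0 = {1}"
| "cantor_points N S (Suc k) =
     (\<Union>a\<in>cantor_points N S k. (\<lambda>s. a + real s / real N ^ Suc k) ` S k a)"

definition cantor_stage :: "nat \<Rightarrow> (nat \<Rightarrow> real \<Rightarrow> nat set) \<Rightarrow> nat \<Rightarrow> real set" where
  "cantor_stage N S k = (\<Union>a\<in>cantor_points N S k. {a .. a + 1 / real N ^ k})"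

text \<open>
  \<open>Lambda_p_Cantor p c0 c1 C N E \<mu>\<close>: \<open>E\<close> is a \<open>\<Lambda>(p)\<close> Cantor set with parameter \<open>N\<close>, and \<open>\<mu>\<close> is the
  \<open>\<Lambda>(p)\<close> Cantor measure belonging to it. The index shift \<open>Suc j\<close> lets the stages start at \<open>1\<close>.
\<close>

definition Lambda_p_Cantor ::
  "real \<Rightarrow> real \<Rightarrow> real \<Rightarrow> real \<Rightarrow> nat \<Rightarrow> real set \<Rightarrow> real measure \<Rightarrow> bool" where
  "Lambda_p_Cantor p c0 c1 C N E \<mu> \<longleftrightarrow>
     (\<exists>N0 \<Sigma> S. 0 < N0 \<and> N0 < N \<and> \<Sigma> \<noteq> {} \<and>
        (\<forall>T\<in>\<Sigma>. card T = N0 \<and> Lambda_p_set p c0 c1 C N T) \<and>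
        (\<forall>k. \<forall>a\<in>cantor_points N S k. S k a \<in> \<Sigma>) \<and>
        E = (\<Inter>j\<in>{1..}. cantor_stage N S j) \<and>
        real_distribution \<mu> \<and>
        weak_conv_m (\<lambda>j. uniform_measure lborel (cantor_stage N S (Suc j))) \<mu>)"

definition contains_dilates ::
  "real set \<Rightarrow> real set \<Rightarrow> real set \<Rightarrow> (real \<Rightarrow> real) \<Rightarrow> bool" where
  "contains_dilates E X Y t \<longleftrightarrow>
     (\<forall>x\<in>Y. 0 < t x) \<and> (\<Union>x\<in>Y. (\<lambda>e. x + t x * e) ` E) \<subseteq> X"

definition nbhd :: "real \<Rightarrow> real set \<Rightarrow> real set" where
  "nbhd r X = (\<Union>x\<in>X. ball x r)"

text \<open>
  The quotient \<open>1 - ln |X\<^sub>r| / ln r\<close> for \<open>0 < r < 1\<close>, where \<open>|X\<^sub>r|\<close> is the measure of the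
  \<open>r\<close>-neighbourhood, with the conventions \<open>ln 0 = -\<infinity>\<close> and \<open>ln \<infinity> = \<infinity>\<close>. For \<open>r > 0\<close> the measure is
  \<open>0\<close> only if \<open>X\<close> is empty, and infinite exactly if \<open>X\<close> is unbounded.
\<close>

definition minkowski_quotient :: "real set \<Rightarrow> real \<Rightarrow> ereal" where
  "minkowski_quotient X r =
     (if emeasure lborel (nbhd r X) = \<infinity> then \<infinity>
      else if emeasure lborel (nbhd r X) = 0 then -\<infinity>
      else ereal (1 - ln (measure lborel (nbhd r X)) / ln r))"

definition upper_minkowski_dim :: "real set \<Rightarrow> ereal" where
  "upper_minkowski_dim X = Limsup (at_right 0) (minkowski_quotient X)"

definition lower_minkowski_dim :: "real set \<Rightarrow> ereal" where
  "lower_minkowski_dim X = Liminf (at_right 0) (minkowski_quotient X)"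

end

theory Submission
  imports Defs
begin

text \<open>
  Write \<open>R = N ^ j\<close> and let \<open>g\<close> be a nonnegative trigonometric polynomial of degree less than \<open>R\<close>,
  essentially the indicator function of the \<open>1 / R\<close>-neighbourhood of \<open>X\<close> modulo \<open>1\<close>. If \<open>x\<close> is close to
  \<open>Y\<close>, then the average of \<open>g (x + t * a)\<close> over the left endpoints \<open>a\<close> of generation \<open>j\<close> is bounded
  below for a suitable \<open>t = t(x)\<close>. Split \<open>g\<close> into pieces with frequencies within \<open>r\<close> of some \<open>\<xi>\<close>, where
  \<open>\<bar>\<xi>\<bar>\<close> is comparable to \<open>N ^ k\<close> up to powers of \<open>N\<close> and \<open>N * r \<le> \<bar>\<xi>\<bar>\<close>. As a function of \<open>t\<close>, the contribution of the
  digit \<open>s\<close> at level \<open>m\<close> to a piece is then \<open>exp (2 * pi * \<i> * \<xi> * s * t / N ^ m)\<close> times a function that varies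
  slowly at the scale \<open>N ^ m / \<bar>\<xi>\<bar>\<close>, so that the \<open>\<Lambda>(p)\<close> inequality decouples the digits of the first
  \<open>k\<close> levels, each time with a loss independent of \<open>N\<close>. This yields an \<open>L\<^sup>p\<close> bound in \<open>(x, t)\<close> with the gain
  \<open>N ^ (- k)\<close>, which pays for the Sobolev embedding in \<open>t\<close> at the scale \<open>N ^ (- k)\<close>. The accumulated loss
  \<open>K ^ j\<close>, with \<open>K\<close> depending only on \<open>p\<close>, \<open>c0\<close> and \<open>C\<close>, is at most \<open>N powr (j * \<delta>)\<close> for large \<open>N\<close>.
\<close>

text \<open>Why the size \<open>N powr (2 / p)\<close> is the right one: for the p-th power of the
  norm, decoupling a level costs about \<open>N0 powr (p / 2 - 1)\<close>, averaging over its digits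
  gives \<open>N0 powr (- p)\<close>, and there are \<open>N0\<close> terms; the product
  \<open>N0 powr (- p / 2)\<close> is at most a constant times \<open>1 / N\<close>. A level that is
  only estimated by Hoelder contributes \<open>N0 powr (- p) * N0 powr (p - 1) * N0 = 1\<close>, so
  stopping the decoupling at level \<open>k\<close> is free. The dilation factors form an arbitrary
  function, possibly not measurable. They are made constant on the cells of a grid of spacing
  \<open>1 / (2 * R)\<close>. Frequencies are cut by triangles because their kernels are Fejer
  kernels, averages of mass one, so that multiplier norms do not depend on the number of
  frequencies. Working modulo 1 forces the line to be cut into unit blocks, and the number of blocks
  that a point of \<open>X\<close> can serve is controlled only for factors bounded by some
  \<open>T\<close>. If \<open>X\<close> is bounded, two points of the Cantor set provide such a
  \<open>T\<close>; if not, all neighbourhoods of \<open>X\<close> have infinite measure.\<close>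

subsection \<open>Convexity of powers and integration on the line\<close>

text \<open>Taken at the mean of \<open>y\<close> and averaged, the linear term drops out; this
  yields both the discrete and the continuous Jensen inequality below. The value
  \<open>y = 0\<close> is separate since convexity is used on the open half-line.\<close>

lemma powr_above_tangent:
  fixes p y z :: real
  assumes "1 \<le> p" "0 < z" "0 \<le> y"
  shows "z powr p + p * z powr (p - 1) * (y - z) \<le> y powr p"
proof (cases "y = 0")
  case True
  have "z powr p = z powr (p - 1) * z"
    using assms by (simp add: powr_mult_base powr_diff)
  then have "z powr p + p * z powr (p - 1) * (y - z) = (1 - p) * z powr p"
    using True by (simp add: algebra_simps)
  also have "\<dots> \<le> 0"
    using assms by (simp add: mult_nonpos_nonneg)
  finally show ?thesis using True by simp
next
  case False
  have "y powr p - z powr p \<ge> (p * z powr (p - 1)) * (y - z)"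
  proof (rule convex_on_imp_above_tangent[where A = "{0<..}"])
    show "convex_on {0<..} (\<lambda>x::real. x powr p)" using assms by (simp add: powr_convex)
    show "((\<lambda>x. x powr p) has_field_derivative p * z powr (p - 1)) (at z within {0<..})"
      using assms by (auto intro!: derivative_eq_intros)
  qed (use assms False in \<open>auto simp: interior_open\<close>)
  then show ?thesis by simp
qed

lemma powr_weighted_sum_le:
  fixes w y :: "'a \<Rightarrow> real"
  assumes "1 \<le> p" "finite I" and w: "\<And>i. i \<in> I \<Longrightarrow> 0 \<le> w i" "sum w I = 1"
    and y: "\<And>i. i \<in> I \<Longrightarrow> 0 \<le> y i"
  shows "(\<Sum>i\<in>I. w i * y i) powr p \<le> (\<Sum>i\<in>I. w i * y i powr p)"
proof -
  let ?z = "\<Sum>i\<in>I. w i * y i"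
  show ?thesis
  proof (cases "?z = 0")
    case True
    then show ?thesis using w y by (simp add: sum_nonneg)
  next
    case False
    have "0 \<le> ?z" using w y by (simp add: sum_nonneg)
    then have z: "0 < ?z" using False by simp
    have "?z powr p = (\<Sum>i\<in>I. w i * (?z powr p + p * ?z powr (p - 1) * (y i - ?z)))"
    proof -
      have "(\<Sum>i\<in>I. w i * (Z powr p + K * (y i - Z)))
        = (\<Sum>i\<in>I. w i) * Z powr p + K * ((\<Sum>i\<in>I. w i * y i) - (\<Sum>i\<in>I. w i) * Z)" for Z K
        by (simp add: algebra_simps sum.distrib sum_subtractf sum_distrib_left sum_distrib_right)
      then show ?thesis using w by simp
    qed
    also have "\<dots> \<le> (\<Sum>i\<in>I. w i * y i powr p)"
      using w y z assms(1) by (intro sum_mono mult_left_mono powr_above_tangent) auto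
    finally show ?thesis .
  qed
qed

lemma powr_sum_le_card:
  fixes y :: "'a \<Rightarrow> real"
  assumes "1 \<le> p" "finite I" and y: "\<And>i. i \<in> I \<Longrightarrow> 0 \<le> y i"
  shows "(\<Sum>i\<in>I. y i) powr p \<le> real (card I) powr (p - 1) * (\<Sum>i\<in>I. y i powr p)"
proof (cases "I = {}")
  case False
  define n where "n = real (card I)"
  have n: "0 < n" using False assms by (simp add: n_def card_gt_0_iff)
  have "((\<Sum>i\<in>I. y i) / n) powr p \<le> (\<Sum>i\<in>I. y i powr p) / n"
    using powr_weighted_sum_le[OF assms(1,2), of "\<lambda>_. 1 / n" y] n y
    by (simp add: n_def sum_divide_distrib[symmetric])
  moreover have "((\<Sum>i\<in>I. y i) / n) powr p = (\<Sum>i\<in>I. y i) powr p / n powr p"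
    by (rule powr_divide)
  ultimately have "(\<Sum>i\<in>I. y i) powr p \<le> n powr p / n * (\<Sum>i\<in>I. y i powr p)"
    using n by (simp add: field_simps)
  then show ?thesis using n by (simp add: n_def[symmetric] powr_diff)
qed simp

lemma powr_norm_sum_le_card:
  fixes f :: "'a \<Rightarrow> complex"
  assumes "1 \<le> p" "finite I"
  shows "norm (\<Sum>i\<in>I. f i) powr p \<le> real (card I) powr (p - 1) * (\<Sum>i\<in>I. norm (f i) powr p)"
  by (rule order_trans[OF powr_mono2 powr_sum_le_card]) (use assms in \<open>auto intro: norm_sum\<close>)

lemma powr_add_le:
  fixes x y :: real
  assumes "1 \<le> p" "0 \<le> x" "0 \<le> y"
  shows "(x + y) powr p \<le> 2 powr (p - 1) * (x powr p + y powr p)"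
  using powr_sum_le_card[OF assms(1), of "{False, True}" "\<lambda>b. if b then x else y"] assms
  by (simp add: add.commute)

lemma powr_norm_add_le:
  fixes x y :: complex
  assumes "1 \<le> p"
  shows "norm (x + y) powr p \<le> 2 powr (p - 1) * (norm x powr p + norm y powr p)"
  by (rule order_trans[OF powr_mono2 powr_add_le]) (use assms in \<open>auto intro: norm_triangle_ineq\<close>)

lemma powr_integral_le:
  fixes g :: "real \<Rightarrow> real"
  assumes p: "1 \<le> p" and l: "0 < l" and g: "continuous_on {0..l} g" "\<And>x. 0 \<le> g x"
  shows "(integral {0..l} g) powr p \<le> l powr (p - 1) * integral {0..l} (\<lambda>x. g x powr p)"
proof -
  define z where "z = integral {0..l} g / l"
  have z0: "0 \<le> z" unfolding z_def using g l by (simp add: Henstock_Kurzweil_Integration.integral_nonneg integrable_continuous_interval)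
  have gp: "continuous_on {0..l} (\<lambda>x. g x powr p)"
    using g p by (intro continuous_on_powr') (auto)
  have *: "l * z powr p \<le> integral {0..l} (\<lambda>x. g x powr p)"
  proof (cases "z = 0")
    case True
    then show ?thesis using gp p
      by (simp add: Henstock_Kurzweil_Integration.integral_nonneg integrable_continuous_interval)
  next
    case False
    with z0 have z: "0 < z" by simp
    have gi: "g integrable_on {0..l}" using g by (intro integrable_continuous_interval)
    have "integral {0..l} (\<lambda>x. z powr p + p * z powr (p - 1) * (g x - z)) \<le> integral {0..l} (\<lambda>x. g x powr p)"
      using g z p
      by (intro integral_le integrable_continuous_interval gp powr_above_tangent)
        (auto intro!: continuous_intros)
    moreover have "integral {0..l} (\<lambda>x. z powr p + p * z powr (p - 1) * (g x - z))
        = l * z powr p + p * z powr (p - 1) * (integral {0..l} g - l * z)"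
    proof (rule integral_unique)
      have c: "((\<lambda>x. c) has_integral l * c) {0..l}" for c :: real
        using has_integral_const_real[of c 0 l] l by simp
      show "((\<lambda>x. z powr p + p * z powr (p - 1) * (g x - z)) has_integral
          l * z powr p + p * z powr (p - 1) * (integral {0..l} g - l * z)) {0..l}"
        using gi by (intro has_integral_add has_integral_mult_right has_integral_diff integrable_integral c)
    qed
    ultimately show ?thesis using l by (simp add: z_def)
  qed
  have "(integral {0..l} g) powr p = (l * z) powr p" using l by (simp add: z_def)
  also have "\<dots> = l powr (p - 1) * (l * z powr p)"
    using l z0 by (simp add: powr_mult powr_diff)
  also have "\<dots> \<le> l powr (p - 1) * integral {0..l} (\<lambda>x. g x powr p)"
    using * by (intro mult_left_mono) auto
  finally show ?thesis .
qed

lemma set_nn_integral_eq_integral: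
  fixes g :: "real \<Rightarrow> real"
  assumes "continuous_on {a..b} g" "\<And>x. 0 \<le> g x"
  shows "(\<integral>\<^sup>+x\<in>{a..b}. ennreal (g x) \<partial>lborel) = ennreal (integral {a..b} g)"
proof -
  have "(g has_integral integral {a..b} g) {a..b}"
    using assms by (intro integrable_integral integrable_continuous_interval)
  from nn_integral_has_integral_lebesgue[OF _ this] assms
  have "(\<integral>\<^sup>+x. ennreal (indicator {a..b} x * g x) \<partial>lborel) = ennreal (integral {a..b} g)" by auto
  then show ?thesis
    using assms by (simp add: ennreal_mult' ennreal_mult'' ennreal_indicator mult.commute)
qed

text \<open>A one-dimensional Sobolev inequality: the fundamental theorem of calculus from
  \<open>0\<close> to \<open>v\<close>, then Jensen on an interval of length \<open>l\<close>, the
  source of \<open>l powr (p - 1)\<close>. The right-hand side is independent of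
  \<open>v\<close>.\<close>

lemma powr_norm_le_base_plus_deriv:
  fixes F F' :: "real \<Rightarrow> complex"
  assumes p: "1 \<le> p" and l: "0 < l" and v: "0 \<le> v" "v \<le> l"
    and F: "\<And>w. (F has_vector_derivative F' w) (at w)" and F': "continuous_on UNIV F'"
  shows "ennreal (norm (F v) powr p) \<le> ennreal (2 powr (p - 1)) *
     (ennreal (norm (F 0) powr p) + ennreal (l powr (p - 1)) * (\<integral>\<^sup>+w\<in>{0..l}. ennreal (norm (F' w) powr p) \<partial>lborel))"
proof -
  have c: "continuous_on A F'" for A using F' continuous_on_subset by blast
  have "(F' has_integral (F v - F 0)) {0..v}"
    using v F by (intro fundamental_theorem_of_calculus) (auto intro: has_vector_derivative_at_within)
  then have eq: "F v = F 0 + integral {0..v} F'" by (simp add: integral_unique)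
  have "norm (integral {0..v} F') \<le> integral {0..v} (\<lambda>w. norm (F' w))"
    by (intro integral_norm_bound_integral integrable_continuous_interval continuous_on_norm c) auto
  also have "\<dots> \<le> integral {0..l} (\<lambda>w. norm (F' w))"
    using v by (intro integral_subset_le integrable_continuous_interval continuous_on_norm c) auto
  finally have "norm (integral {0..v} F') powr p \<le> (integral {0..l} (\<lambda>w. norm (F' w))) powr p"
    using p by (intro powr_mono2) auto
  also have "\<dots> \<le> l powr (p - 1) * integral {0..l} (\<lambda>w. norm (F' w) powr p)"
    using p l by (intro powr_integral_le continuous_on_norm c) auto
  finally have I: "norm (integral {0..v} F') powr p \<le> l powr (p - 1) * integral {0..l} (\<lambda>w. norm (F' w) powr p)" .
  have cp: "continuous_on {0..l} (\<lambda>w. norm (F' w) powr p)"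
    using p by (intro continuous_on_powr' continuous_on_norm c continuous_on_const) auto
  have "norm (F v) powr p \<le> 2 powr (p - 1) * (norm (F 0) powr p + norm (integral {0..v} F') powr p)"
    unfolding eq by (rule powr_norm_add_le[OF p])
  also have "\<dots> \<le> 2 powr (p - 1) * (norm (F 0) powr p + l powr (p - 1) * integral {0..l} (\<lambda>w. norm (F' w) powr p))"
    using I by (intro mult_left_mono add_left_mono) auto
  finally have "ennreal (norm (F v) powr p) \<le>
    ennreal (2 powr (p - 1) * (norm (F 0) powr p + l powr (p - 1) * integral {0..l} (\<lambda>w. norm (F' w) powr p)))"
    by (rule ennreal_leI)
  also have "\<dots> = ennreal (2 powr (p - 1)) *
     (ennreal (norm (F 0) powr p) + ennreal (l powr (p - 1)) * (\<integral>\<^sup>+w\<in>{0..l}. ennreal (norm (F' w) powr p) \<partial>lborel))"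
    by (subst set_nn_integral_eq_integral)
       (use cp in \<open>auto simp: ennreal_mult' ennreal_plus Henstock_Kurzweil_Integration.integral_nonneg integrable_continuous_interval\<close>)
  finally show ?thesis .
qed

section \<open>Translation, Tonelli and averaging for nonnegative integrals\<close>

lemma nn_integral_shift:
  fixes h :: "real \<Rightarrow> ennreal"
  assumes "h \<in> borel_measurable borel"
  shows "(\<integral>\<^sup>+x. h (y + x) \<partial>lborel) = (\<integral>\<^sup>+x. h x \<partial>lborel)"
  using nn_integral_real_affine[OF assms, of 1 y] by simp

lemma set_nn_integral_mono':
  fixes f g :: "'a \<Rightarrow> ennreal"
  assumes "\<And>x. x \<in> A \<Longrightarrow> f x \<le> g x"
  shows "(\<integral>\<^sup>+x\<in>A. f x \<partial>M) \<le> (\<integral>\<^sup>+x\<in>A. g x \<partial>M)"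
  using assms by (intro nn_integral_mono) (auto split: split_indicator)

lemma set_nn_integral_cmult':
  assumes [measurable]: "f \<in> borel_measurable M" "A \<in> sets M"
  shows "(\<integral>\<^sup>+x\<in>A. c * f x \<partial>M) = c * (\<integral>\<^sup>+x\<in>A. f x \<partial>M)"
  by (subst nn_integral_cmult[symmetric]) (auto simp: mult.assoc)

lemma set_nn_integral_add':
  assumes [measurable]: "f \<in> borel_measurable M" "g \<in> borel_measurable M" "A \<in> sets M"
  shows "(\<integral>\<^sup>+x\<in>A. f x + g x \<partial>M) = (\<integral>\<^sup>+x\<in>A. f x \<partial>M) + (\<integral>\<^sup>+x\<in>A. g x \<partial>M)"
  by (subst nn_integral_add[symmetric]) (auto simp: distrib_right)

lemma set_nn_integral_sum':
  assumes [measurable]: "\<And>i. i \<in> I \<Longrightarrow> f i \<in> borel_measurable M" "A \<in> sets M"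
  shows "(\<integral>\<^sup>+x\<in>A. (\<Sum>i\<in>I. f i x) \<partial>M) = (\<Sum>i\<in>I. (\<integral>\<^sup>+x\<in>A. f i x \<partial>M))"
  by (subst nn_integral_sum[symmetric]) (auto simp: sum_distrib_right)

lemma set_nn_integral_swap:
  fixes f :: "real \<Rightarrow> real \<Rightarrow> ennreal"
  assumes [measurable]: "case_prod f \<in> borel_measurable (borel \<Otimes>\<^sub>M borel)" "A \<in> sets borel" "B \<in> sets borel"
  shows "(\<integral>\<^sup>+x\<in>A. (\<integral>\<^sup>+y\<in>B. f x y \<partial>lborel) \<partial>lborel) = (\<integral>\<^sup>+y\<in>B. (\<integral>\<^sup>+x\<in>A. f x y \<partial>lborel) \<partial>lborel)"
proof -
  have "(\<integral>\<^sup>+x\<in>A. (\<integral>\<^sup>+y\<in>B. f x y \<partial>lborel) \<partial>lborel)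
    = (\<integral>\<^sup>+x. (\<integral>\<^sup>+y. f x y * indicator B y * indicator A x \<partial>lborel) \<partial>lborel)"
    by (intro nn_integral_cong nn_integral_multc[symmetric]) measurable
  also have "\<dots> = (\<integral>\<^sup>+y. (\<integral>\<^sup>+x. f x y * indicator B y * indicator A x \<partial>lborel) \<partial>lborel)"
    by (rule lborel_pair.Fubini'[symmetric]) measurable
  also have "\<dots> = (\<integral>\<^sup>+y. (\<integral>\<^sup>+x. f x y * indicator A x * indicator B y \<partial>lborel) \<partial>lborel)"
    by (simp add: mult_ac)
  also have "\<dots> = (\<integral>\<^sup>+y\<in>B. (\<integral>\<^sup>+x\<in>A. f x y \<partial>lborel) \<partial>lborel)"
    by (intro nn_integral_cong nn_integral_multc) measurable
  finally show ?thesis .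
qed

text \<open>For each \<open>v\<close> in \<open>{0..l}\<close> every \<open>t\<close> is
  \<open>u + v\<close> with \<open>u = t - v\<close>. Bounds on all windows of length
  \<open>l\<close> thus give a bound on \<open>{\<alpha>..\<beta>}\<close>, at the price of
  extending the range of \<open>u\<close> by \<open>l\<close> to the left.\<close>

lemma nn_integral_average_ge:
  fixes h :: "real \<Rightarrow> ennreal"
  assumes [measurable]: "h \<in> borel_measurable borel" and l: "0 \<le> l"
  shows "ennreal l * (\<integral>\<^sup>+t\<in>{\<alpha>..\<beta>}. h t \<partial>lborel)
    \<le> (\<integral>\<^sup>+u\<in>{\<alpha> - l..\<beta>}. (\<integral>\<^sup>+v\<in>{0..l}. h (u + v) \<partial>lborel) \<partial>lborel)"
proof -
  have "ennreal l * (\<integral>\<^sup>+t\<in>{\<alpha>..\<beta>}. h t \<partial>lborel) = (\<integral>\<^sup>+v\<in>{0..l}. (\<integral>\<^sup>+t\<in>{\<alpha>..\<beta>}. h t \<partial>lborel) \<partial>lborel)"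
    using l by (subst nn_integral_cmult_indicator) (simp_all add: mult.commute)
  also have "\<dots> \<le> (\<integral>\<^sup>+v\<in>{0..l}. (\<integral>\<^sup>+u\<in>{\<alpha> - l..\<beta>}. h (u + v) \<partial>lborel) \<partial>lborel)"
  proof (rule set_nn_integral_mono')
    fix v assume v: "v \<in> {0..l}"
    have "(\<integral>\<^sup>+t\<in>{\<alpha>..\<beta>}. h t \<partial>lborel) = (\<integral>\<^sup>+u. h (v + u) * indicator {\<alpha>..\<beta>} (v + u) \<partial>lborel)"
      by (rule nn_integral_shift[symmetric]) measurable
    also have "\<dots> \<le> (\<integral>\<^sup>+u\<in>{\<alpha> - l..\<beta>}. h (u + v) \<partial>lborel)"
      using v by (intro nn_integral_mono) (auto split: split_indicator simp: add.commute)
    finally show "(\<integral>\<^sup>+t\<in>{\<alpha>..\<beta>}. h t \<partial>lborel) \<le> (\<integral>\<^sup>+u\<in>{\<alpha> - l..\<beta>}. h (u + v) \<partial>lborel)" .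
  qed
  also have "\<dots> = (\<integral>\<^sup>+u\<in>{\<alpha> - l..\<beta>}. (\<integral>\<^sup>+v\<in>{0..l}. h (u + v) \<partial>lborel) \<partial>lborel)"
    by (rule set_nn_integral_swap) auto
  finally show ?thesis .
qed

text \<open>The converse passage from windows to an interval; here the extension by \<open>l\<close>
  is to the right.\<close>

lemma nn_integral_average_le:
  fixes h :: "real \<Rightarrow> ennreal"
  assumes [measurable]: "h \<in> borel_measurable borel" and l: "0 \<le> l"
  shows "(\<integral>\<^sup>+u\<in>{\<alpha>..\<beta>}. (\<integral>\<^sup>+v\<in>{0..l}. h (u + v) \<partial>lborel) \<partial>lborel)
    \<le> ennreal l * (\<integral>\<^sup>+t\<in>{\<alpha>..\<beta> + l}. h t \<partial>lborel)"
proof -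
  have "(\<integral>\<^sup>+u\<in>{\<alpha>..\<beta>}. (\<integral>\<^sup>+v\<in>{0..l}. h (u + v) \<partial>lborel) \<partial>lborel)
    = (\<integral>\<^sup>+v\<in>{0..l}. (\<integral>\<^sup>+u\<in>{\<alpha>..\<beta>}. h (u + v) \<partial>lborel) \<partial>lborel)"
    by (rule set_nn_integral_swap) auto
  also have "\<dots> \<le> (\<integral>\<^sup>+v\<in>{0..l}. (\<integral>\<^sup>+t\<in>{\<alpha>..\<beta> + l}. h t \<partial>lborel) \<partial>lborel)"
  proof (rule set_nn_integral_mono')
    fix v assume v: "v \<in> {0..l}"
    have "(\<integral>\<^sup>+u\<in>{\<alpha>..\<beta>}. h (u + v) \<partial>lborel) \<le> (\<integral>\<^sup>+u. h (v + u) * indicator {\<alpha>..\<beta> + l} (v + u) \<partial>lborel)"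
      using v by (intro nn_integral_mono) (auto split: split_indicator simp: add.commute)
    also have "\<dots> = (\<integral>\<^sup>+t\<in>{\<alpha>..\<beta> + l}. h t \<partial>lborel)"
      by (rule nn_integral_shift) measurable
    finally show "(\<integral>\<^sup>+u\<in>{\<alpha>..\<beta>}. h (u + v) \<partial>lborel) \<le> (\<integral>\<^sup>+t\<in>{\<alpha>..\<beta> + l}. h t \<partial>lborel)" .
  qed
  also have "\<dots> = ennreal l * (\<integral>\<^sup>+t\<in>{\<alpha>..\<beta> + l}. h t \<partial>lborel)"
    using l by (subst nn_integral_cmult_indicator) (simp_all add: mult.commute)
  finally show ?thesis .
qed

text \<open>Only \<open>frac y\<close> matters. The shifted period is cut at 1 and the part beyond 1
  is moved back by one; half-open intervals keep the parts disjoint and differ from closed ones by a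
  null set.\<close>

lemma nn_integral_periodic_shift:
  fixes h :: "real \<Rightarrow> ennreal"
  assumes [measurable]: "h \<in> borel_measurable borel" and per: "\<And>x. h (x + 1) = h x"
  shows "(\<integral>\<^sup>+x\<in>{0..1}. h (x + y) \<partial>lborel) = (\<integral>\<^sup>+x\<in>{0..1}. h x \<partial>lborel)"
proof -
  have pern: "h (x + of_nat n) = h x" for x n
  proof (induction n)
    case (Suc n)
    have "x + of_nat (Suc n) = (x + of_nat n) + 1" by simp
    then show ?case using per[of "x + of_nat n"] Suc by metis
  qed simp
  have per': "h (x + of_int n) = h x" for x n
    using pern[of x "nat n"] pern[of "x + of_int n" "nat (- n)"] by (cases "n \<ge> 0") auto
  define z where "z = frac y"
  have z: "0 \<le> z" "z \<le> 1" by (auto simp: z_def frac_ge_0 less_imp_le[OF frac_lt_1])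
  have yz: "h (x + y) = h (z + x)" for x
    using per'[of "z + x" "\<lfloor>y\<rfloor>"] by (simp add: z_def frac_def algebra_simps)
  have open_closed: "(\<integral>\<^sup>+x\<in>{0..1}. f x \<partial>lborel) = (\<integral>\<^sup>+x\<in>{0<..1}. f x \<partial>lborel)" for f :: "real \<Rightarrow> ennreal"
  proof (rule nn_integral_cong_AE)
    show "AE x in lborel. f x * indicator {0..1} x = f x * indicator {0<..1} x"
      using AE_lborel_singleton[of 0] by eventually_elim (auto split: split_indicator)
  qed
  have "(\<integral>\<^sup>+x\<in>{0<..1}. h (z + x) \<partial>lborel) = (\<integral>\<^sup>+x. h (z + x) * indicator {z<..1 + z} (z + x) \<partial>lborel)"
    by (intro nn_integral_cong) (auto split: split_indicator)
  also have "\<dots> = (\<integral>\<^sup>+x. h x * indicator {z<..1 + z} x \<partial>lborel)"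
    by (rule nn_integral_shift) measurable
  also have "\<dots> = (\<integral>\<^sup>+x. h x * indicator {z<..1} x + h x * indicator {1<..1 + z} x \<partial>lborel)"
    using z by (intro nn_integral_cong) (auto split: split_indicator)
  also have "\<dots> = (\<integral>\<^sup>+x. h x * indicator {z<..1} x \<partial>lborel) + (\<integral>\<^sup>+x. h x * indicator {1<..1 + z} x \<partial>lborel)"
    by (rule nn_integral_add) measurable
  also have "(\<integral>\<^sup>+x. h x * indicator {1<..1 + z} x \<partial>lborel) = (\<integral>\<^sup>+x. h (1 + x) * indicator {1<..1 + z} (1 + x) \<partial>lborel)"
    by (rule nn_integral_shift[symmetric]) measurable
  also have "\<dots> = (\<integral>\<^sup>+x. h x * indicator {0<..z} x \<partial>lborel)"
    by (intro nn_integral_cong) (auto split: split_indicator simp: per add.commute)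
  also have "(\<integral>\<^sup>+x. h x * indicator {z<..1} x \<partial>lborel) + (\<integral>\<^sup>+x. h x * indicator {0<..z} x \<partial>lborel)
     = (\<integral>\<^sup>+x. h x * indicator {z<..1} x + h x * indicator {0<..z} x \<partial>lborel)"
    by (rule nn_integral_add[symmetric]) measurable
  also have "\<dots> = (\<integral>\<^sup>+x\<in>{0<..1}. h x \<partial>lborel)"
    using z by (intro nn_integral_cong) (auto split: split_indicator)
  finally show ?thesis by (simp add: open_closed yz)
qed

subsection \<open>Bounds for exponential sums with frequencies in a \<open>\<Lambda>(p)\<close> set\<close>

definition echar :: "real \<Rightarrow> complex" where
  "echar x = cis (2 * pi * x)"

lemma echar_add: "echar (x + y) = echar x * echar y"
  by (simp add: echar_def cis_mult distrib_left)

lemma echar_minus: "echar (- x) = cnj (echar x)"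
  by (simp add: echar_def cis_cnj)

lemma echar_0 [simp]: "echar 0 = 1"
  by (simp add: echar_def)

lemma norm_echar [simp]: "norm (echar x) = 1"
  by (simp add: echar_def)

lemma echar_of_int [simp]: "echar (of_int n) = 1"
  by (simp add: echar_def)

lemma echar_of_nat [simp]: "echar (of_nat n) = 1"
  using echar_of_int[of "int n"] by simp

lemma continuous_on_echar [continuous_intros]:
  "continuous_on A f \<Longrightarrow> continuous_on A (\<lambda>x. echar (f x))"
  unfolding echar_def by (intro continuous_intros)

lemma borel_measurable_echar [measurable]: "echar \<in> borel_measurable borel"
  by (intro borel_measurable_continuous_onI continuous_intros)

lemma echar_has_vector_derivative [derivative_intros]:
  "((\<lambda>t. echar (a * t + b)) has_vector_derivative (2 * pi * \<i> * a * echar (a * t + b))) (at t within A)"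
  unfolding echar_def has_vector_derivative_def
  by (auto intro!: derivative_eq_intros simp: fun_eq_iff scaleR_conv_of_real algebra_simps)

text \<open>The p-th power is additive over the domain, and values in \<open>ennreal\<close> allow
  Tonelli without integrability conditions.\<close>

definition Lp_pow :: "real \<Rightarrow> (real \<Rightarrow> complex) \<Rightarrow> ennreal" where
  "Lp_pow p h = (\<integral>\<^sup>+x\<in>{0..1}. ennreal (norm (h x) powr p) \<partial>lborel)"

lemma Lp_pow_shift:
  assumes [measurable]: "h \<in> borel_measurable borel" and "\<And>x. h (x + 1) = h x"
  shows "Lp_pow p (\<lambda>x. h (x + y)) = Lp_pow p h"
  unfolding Lp_pow_def by (rule nn_integral_periodic_shift) (use assms in auto)

lemma Lp_pow_norm_cong:
  assumes "\<And>x. norm (f x) = norm (g x)"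
  shows "Lp_pow p f = Lp_pow p g"
  unfolding Lp_pow_def assms ..

lemma Lp_pow_cmult:
  assumes [measurable]: "h \<in> borel_measurable borel"
  shows "Lp_pow p (\<lambda>x. k * h x) = ennreal (norm k powr p) * Lp_pow p h"
  unfolding Lp_pow_def
  by (subst nn_integral_cmult[symmetric])
     (auto simp: norm_mult powr_mult ennreal_mult' mult.assoc intro!: nn_integral_cong)

lemma Lp_pow_sum_le:
  assumes "1 \<le> p" "finite I" and [measurable]: "\<And>i. i \<in> I \<Longrightarrow> f i \<in> borel_measurable borel"
  shows "Lp_pow p (\<lambda>x. \<Sum>i\<in>I. f i x) \<le> ennreal (real (card I) powr (p - 1)) * (\<Sum>i\<in>I. Lp_pow p (f i))"
proof -
  have "Lp_pow p (\<lambda>x. \<Sum>i\<in>I. f i x)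
     \<le> (\<integral>\<^sup>+x. ennreal (real (card I) powr (p - 1)) * (\<Sum>i\<in>I. ennreal (norm (f i x) powr p) * indicator {0..1} x) \<partial>lborel)"
    unfolding Lp_pow_def
  proof (rule nn_integral_mono)
    fix x :: real
    have "ennreal (norm (\<Sum>i\<in>I. f i x) powr p) \<le> ennreal (real (card I) powr (p - 1) * (\<Sum>i\<in>I. norm (f i x) powr p))"
      using assms by (intro ennreal_leI powr_norm_sum_le_card)
    then show "ennreal (norm (\<Sum>i\<in>I. f i x) powr p) * indicator {0..1} x \<le>
       ennreal (real (card I) powr (p - 1)) * (\<Sum>i\<in>I. ennreal (norm (f i x) powr p) * indicator {0..1} x)"
      by (auto split: split_indicator simp: ennreal_mult' sum_ennreal)
  qed
  also have "\<dots> = ennreal (real (card I) powr (p - 1)) * (\<Sum>i\<in>I. Lp_pow p (f i))"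
    unfolding Lp_pow_def by (subst nn_integral_cmult) (simp_all add: nn_integral_sum)
  finally show ?thesis .
qed

lemma Lp_pow_weighted_sum_le:
  assumes "1 \<le> p" "finite I" and [measurable]: "\<And>i. i \<in> I \<Longrightarrow> f i \<in> borel_measurable borel"
    and w: "(\<Sum>i\<in>I. norm (w i)) = 1"
  shows "Lp_pow p (\<lambda>x. \<Sum>i\<in>I. w i * f i x) \<le> (\<Sum>i\<in>I. ennreal (norm (w i)) * Lp_pow p (f i))"
proof -
  have "Lp_pow p (\<lambda>x. \<Sum>i\<in>I. w i * f i x)
     \<le> (\<integral>\<^sup>+x. (\<Sum>i\<in>I. ennreal (norm (w i)) * (ennreal (norm (f i x) powr p) * indicator {0..1} x)) \<partial>lborel)"
    unfolding Lp_pow_def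
  proof (rule nn_integral_mono)
    fix x :: real
    have "norm (\<Sum>i\<in>I. w i * f i x) powr p \<le> (\<Sum>i\<in>I. norm (w i) * norm (f i x)) powr p"
      using assms(1) by (intro powr_mono2) (auto simp: norm_mult intro!: sum_norm_le)
    also have "\<dots> \<le> (\<Sum>i\<in>I. norm (w i) * norm (f i x) powr p)"
      using assms w by (intro powr_weighted_sum_le) auto
    finally have "ennreal (norm (\<Sum>i\<in>I. w i * f i x) powr p) \<le> ennreal (\<Sum>i\<in>I. norm (w i) * norm (f i x) powr p)"
      by (rule ennreal_leI)
    then show "ennreal (norm (\<Sum>i\<in>I. w i * f i x) powr p) * indicator {0..1} x \<le>
       (\<Sum>i\<in>I. ennreal (norm (w i)) * (ennreal (norm (f i x) powr p) * indicator {0..1} x))"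
      by (auto split: split_indicator simp: ennreal_mult'[symmetric] sum_ennreal)
  qed
  also have "\<dots> = (\<Sum>i\<in>I. ennreal (norm (w i)) * Lp_pow p (f i))"
    unfolding Lp_pow_def by (subst nn_integral_sum) (simp_all add: nn_integral_cmult)
  finally show ?thesis .
qed

lemma Lambda_p_set_finite: "Lambda_p_set p c0 c1 C N S \<Longrightarrow> finite S"
  unfolding Lambda_p_set_def by (meson finite_lessThan finite_subset)

text \<open>Property (a), followed by Hoelder from square sums to sums of p-th powers of the
  coefficients, which costs \<open>card S powr (p / 2 - 1)\<close>. In this additive form the bound
  can be iterated along the tree.\<close>

lemma Lambda_p_set_Lp_pow_le:
  assumes p: "2 \<le> p" and C: "0 < C" and S: "Lambda_p_set p c0 c1 C N S"
  shows "Lp_pow p (\<lambda>x. \<Sum>s\<in>S. c s * echar (real s * x))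
    \<le> ennreal (C powr p * real (card S) powr (p / 2 - 1)) * (\<Sum>s\<in>S. ennreal (norm (c s) powr p))"
proof -
  have fin: "finite S" by (rule Lambda_p_set_finite[OF S])
  define h where "h x = norm (\<Sum>s\<in>S. c s * echar (real s * x)) powr p" for x :: real
  have cont: "continuous_on {0..1} h"
    unfolding h_def using p
    by (intro continuous_on_powr' continuous_on_norm continuous_on_sum continuous_on_mult
          continuous_on_echar continuous_on_const continuous_on_id) auto
  define I where "I = integral {0..1} h"
  have I0: "0 \<le> I" unfolding I_def h_def
    using cont[unfolded h_def] by (intro Henstock_Kurzweil_Integration.integral_nonneg integrable_continuous_interval) auto
  have "(LINT x:{0..1}|lborel. h x) = I"
    unfolding I_def by (rule set_borel_integral_eq_integral(2)) (use cont borel_integrable_atLeastAtMost' in blast)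
  then have "Lp_norm_unit p (\<lambda>x. \<Sum>a\<in>S. c a * cis (2 * pi * real a * x)) = I powr (1 / p)"
    by (simp add: Lp_norm_unit_def h_def echar_def mult.assoc)
  then have *: "I powr (1 / p) \<le> C * sqrt (\<Sum>a\<in>S. (norm (c a))\<^sup>2)"
    using conjunct1[OF conjunct2[OF S[unfolded Lambda_p_set_def]], rule_format, of c] by simp
  define V where "V = (\<Sum>a\<in>S. (norm (c a))\<^sup>2)"
  have V0: "0 \<le> V" unfolding V_def by (intro sum_nonneg) auto
  have "I = (I powr (1 / p)) powr p" using I0 p by (simp add: powr_powr)
  also have "\<dots> \<le> (C * sqrt V) powr p" using * p by (intro powr_mono2) (auto simp: V_def)
  also have "\<dots> = C powr p * V powr (p / 2)"
    using C V0 by (simp add: powr_mult powr_half_sqrt[symmetric] powr_powr)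
  also have "\<dots> \<le> C powr p * (real (card S) powr (p / 2 - 1) * (\<Sum>s\<in>S. ((norm (c s))\<^sup>2) powr (p / 2)))"
    unfolding V_def using p fin by (intro mult_left_mono powr_sum_le_card) auto
  also have "(\<Sum>s\<in>S. ((norm (c s))\<^sup>2) powr (p / 2)) = (\<Sum>s\<in>S. norm (c s) powr p)"
    by (intro sum.cong refl) (simp add: powr_half_sqrt powr_powr flip: powr_numeral)
  finally have "I \<le> C powr p * (real (card S) powr (p / 2 - 1) * (\<Sum>s\<in>S. norm (c s) powr p))" .
  then have "ennreal I \<le> ennreal (C powr p * real (card S) powr (p / 2 - 1)) * ennreal (\<Sum>s\<in>S. norm (c s) powr p)"
    by (subst ennreal_mult'[symmetric]) (auto simp: mult.assoc intro: sum_nonneg ennreal_leI)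
  moreover have "Lp_pow p (\<lambda>x. \<Sum>s\<in>S. c s * echar (real s * x)) = ennreal I"
    unfolding Lp_pow_def I_def using cont
    by (subst set_nn_integral_eq_integral[symmetric]) (auto simp: h_def)
  ultimately show ?thesis by (simp add: sum_ennreal)
qed

text \<open>A window of length \<open>1 / \<bar>\<kappa>\<bar>\<close> is one full period of the sum
  with frequencies \<open>\<kappa> * s\<close>, so rescaling suffices. The offset \<open>u\<close>
  becomes a phase of the coefficients, and conjugation reduces negative \<open>\<kappa>\<close> to
  positive.\<close>

lemma Lambda_p_set_local_le:
  assumes p: "2 \<le> p" and C: "0 < C" and S: "Lambda_p_set p c0 c1 C N S" and k: "\<kappa> \<noteq> 0"
  shows "(\<integral>\<^sup>+v\<in>{0..1 / \<bar>\<kappa>\<bar>}. ennreal (norm (\<Sum>s\<in>S. c s * echar (\<kappa> * real s * (u + v))) powr p) \<partial>lborel)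
    \<le> ennreal (1 / \<bar>\<kappa>\<bar>) * (ennreal (C powr p * real (card S) powr (p / 2 - 1)) * (\<Sum>s\<in>S. ennreal (norm (c s) powr p)))"
proof -
  define d where "d s = (if \<kappa> > 0 then c s * echar (\<kappa> * real s * u) else cnj (c s * echar (\<kappa> * real s * u)))" for s
  have nd: "norm (d s) = norm (c s)" for s by (simp add: d_def norm_mult)
  have eq: "norm (\<Sum>s\<in>S. c s * echar (\<kappa> * real s * (u + v))) = norm (\<Sum>s\<in>S. d s * echar (real s * (\<bar>\<kappa>\<bar> * v)))" for v
  proof (cases "\<kappa> > 0")
    case True
    then show ?thesis by (simp add: d_def distrib_left echar_add mult_ac)
  next
    case False
    have "(\<Sum>s\<in>S. d s * echar (real s * (\<bar>\<kappa>\<bar> * v))) = cnj (\<Sum>s\<in>S. c s * echar (\<kappa> * real s * (u + v)))"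
      using False by (simp add: d_def distrib_left echar_add mult_ac flip: echar_minus)
    then show ?thesis by (metis complex_mod_cnj)
  qed
  define H where "H v = ennreal (norm (\<Sum>s\<in>S. d s * echar (real s * (\<bar>\<kappa>\<bar> * v))) powr p) * indicator {0..1 / \<bar>\<kappa>\<bar>} v" for v
  have [measurable]: "H \<in> borel_measurable borel" unfolding H_def by measurable
  have H: "H (0 + 1 / \<bar>\<kappa>\<bar> * x) = ennreal (norm (\<Sum>s\<in>S. d s * echar (real s * x)) powr p) * indicator {0..1} x" for x
  proof -
    have "\<bar>\<kappa>\<bar> * (0 + 1 / \<bar>\<kappa>\<bar> * x) = x" using k by simp
    then have "norm (\<Sum>s\<in>S. d s * echar (real s * (\<bar>\<kappa>\<bar> * (0 + 1 / \<bar>\<kappa>\<bar> * x)))) = norm (\<Sum>s\<in>S. d s * echar (real s * x))"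
      by (simp only:)
    moreover have "0 + 1 / \<bar>\<kappa>\<bar> * x \<in> {0..1 / \<bar>\<kappa>\<bar>} \<longleftrightarrow> x \<in> {0..1}"
      using k by (auto simp: zero_le_divide_iff divide_le_cancel)
    ultimately show ?thesis unfolding H_def indicator_def by (simp only:)
  qed
  have "(\<integral>\<^sup>+v\<in>{0..1 / \<bar>\<kappa>\<bar>}. ennreal (norm (\<Sum>s\<in>S. c s * echar (\<kappa> * real s * (u + v))) powr p) \<partial>lborel)
    = (\<integral>\<^sup>+v. H v \<partial>lborel)"
    unfolding eq H_def ..
  also have "\<dots> = ennreal \<bar>1 / \<bar>\<kappa>\<bar>\<bar> * (\<integral>\<^sup>+x. H (0 + 1 / \<bar>\<kappa>\<bar> * x) \<partial>lborel)"
    by (rule nn_integral_real_affine) (use k in auto)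
  also have "\<dots> = ennreal (1 / \<bar>\<kappa>\<bar>) * Lp_pow p (\<lambda>x. \<Sum>s\<in>S. d s * echar (real s * x))"
    unfolding Lp_pow_def H by simp
  also have "\<dots> \<le> ennreal (1 / \<bar>\<kappa>\<bar>) * (ennreal (C powr p * real (card S) powr (p / 2 - 1)) * (\<Sum>s\<in>S. ennreal (norm (d s) powr p)))"
    by (intro mult_left_mono Lambda_p_set_Lp_pow_le[OF p C S]) auto
  finally show ?thesis unfolding nd .
qed

text \<open>The Sobolev inequality is applied to the amplitudes alone, with the exponentials held at
  \<open>u + v\<close>. The main term then has coefficients \<open>g s u\<close> and the error term
  \<open>g' s (u + w)\<close>; neither depends on \<open>v\<close>, so the bound for constant
  coefficients applies to both, to the error term after exchanging \<open>v\<close> and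
  \<open>w\<close>.\<close>

lemma Lambda_p_set_decouple_local:
  fixes g g' :: "nat \<Rightarrow> real \<Rightarrow> complex"
  assumes p: "2 \<le> p" and C: "0 < C" and S: "Lambda_p_set p c0 c1 C N S" and k: "\<kappa> \<noteq> 0"
    and g: "\<And>s t. (g s has_vector_derivative g' s t) (at t)"
    and g': "\<And>s. continuous_on UNIV (g' s)"
  defines "l \<equiv> 1 / \<bar>\<kappa>\<bar>"
  shows "(\<integral>\<^sup>+v\<in>{0..l}. ennreal (norm (\<Sum>s\<in>S. g s (u + v) * echar (\<kappa> * real s * (u + v))) powr p) \<partial>lborel)
    \<le> ennreal (2 powr (p - 1)) * (ennreal (C powr p * real (card S) powr (p / 2 - 1)) *
       (\<Sum>s\<in>S. ennreal l * ennreal (norm (g s u) powr p)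
          + ennreal (l powr p) * (\<integral>\<^sup>+w\<in>{0..l}. ennreal (norm (g' s (u + w)) powr p) \<partial>lborel)))"
proof -
  let ?K = "C powr p * real (card S) powr (p / 2 - 1)"
  have l: "0 < l" using k by (simp add: l_def)
  have gc: "continuous_on UNIV (g s)" for s
    by (intro continuous_at_imp_continuous_on ballI has_vector_derivative_continuous[OF g])
  have [measurable]: "g s \<in> borel_measurable borel" "g' s \<in> borel_measurable borel" for s
    by (intro borel_measurable_continuous_onI gc g')+
  define A where "A v = ennreal (norm (\<Sum>s\<in>S. g s u * echar (\<kappa> * real s * (u + v))) powr p)" for v
  define B where "B v w = ennreal (norm (\<Sum>s\<in>S. g' s (u + w) * echar (\<kappa> * real s * (u + v))) powr p)" for v w
  have [measurable]: "A \<in> borel_measurable borel" unfolding A_def by measurable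
  have B[measurable]: "case_prod B \<in> borel_measurable (borel \<Otimes>\<^sub>M borel)" unfolding B_def by measurable
  have pw: "ennreal (norm (\<Sum>s\<in>S. g s (u + v) * echar (\<kappa> * real s * (u + v))) powr p)
      \<le> ennreal (2 powr (p - 1)) * (A v + ennreal (l powr (p - 1)) * (\<integral>\<^sup>+w\<in>{0..l}. B v w \<partial>lborel))"
    if v: "v \<in> {0..l}" for v
  proof -
    let ?F = "\<lambda>w. \<Sum>s\<in>S. g s (u + w) * echar (\<kappa> * real s * (u + v))"
    let ?F' = "\<lambda>w. \<Sum>s\<in>S. g' s (u + w) * echar (\<kappa> * real s * (u + v))"
    have gs: "((\<lambda>w. g s (u + w)) has_vector_derivative g' s (u + w)) (at w)" for s w
    proof -
      have "((\<lambda>w. u + w) has_vector_derivative 1) (at w)"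
        by (auto intro!: derivative_eq_intros)
      from vector_diff_chain_at[OF this g] show ?thesis by (simp add: o_def)
    qed
    have "(?F has_vector_derivative ?F' w) (at w)" for w
      by (intro has_vector_derivative_sum has_vector_derivative_mult_left gs)
    moreover have "continuous_on UNIV ?F'"
      by (intro continuous_intros continuous_on_compose2[OF g']) auto
    ultimately have "ennreal (norm (?F v) powr p) \<le> ennreal (2 powr (p - 1)) *
     (ennreal (norm (?F 0) powr p) + ennreal (l powr (p - 1)) * (\<integral>\<^sup>+w\<in>{0..l}. ennreal (norm (?F' w) powr p) \<partial>lborel))"
      using p l v by (intro powr_norm_le_base_plus_deriv) auto
    then show ?thesis by (simp add: A_def B_def)
  qed
  have "(\<integral>\<^sup>+v\<in>{0..l}. ennreal (norm (\<Sum>s\<in>S. g s (u + v) * echar (\<kappa> * real s * (u + v))) powr p) \<partial>lborel)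
     \<le> (\<integral>\<^sup>+v\<in>{0..l}. ennreal (2 powr (p - 1)) * (A v + ennreal (l powr (p - 1)) * (\<integral>\<^sup>+w\<in>{0..l}. B v w \<partial>lborel)) \<partial>lborel)"
    by (rule set_nn_integral_mono'[OF pw])
  also have "\<dots> = ennreal (2 powr (p - 1)) * ((\<integral>\<^sup>+v\<in>{0..l}. A v \<partial>lborel)
       + ennreal (l powr (p - 1)) * (\<integral>\<^sup>+v\<in>{0..l}. (\<integral>\<^sup>+w\<in>{0..l}. B v w \<partial>lborel) \<partial>lborel))"
    by (simp add: set_nn_integral_cmult' set_nn_integral_add')
  also have "(\<integral>\<^sup>+v\<in>{0..l}. (\<integral>\<^sup>+w\<in>{0..l}. B v w \<partial>lborel) \<partial>lborel) = (\<integral>\<^sup>+w\<in>{0..l}. (\<integral>\<^sup>+v\<in>{0..l}. B v w \<partial>lborel) \<partial>lborel)"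
    by (rule set_nn_integral_swap[OF B]) auto
  finally have 1: "(\<integral>\<^sup>+v\<in>{0..l}. ennreal (norm (\<Sum>s\<in>S. g s (u + v) * echar (\<kappa> * real s * (u + v))) powr p) \<partial>lborel)
    \<le> ennreal (2 powr (p - 1)) * ((\<integral>\<^sup>+v\<in>{0..l}. A v \<partial>lborel)
       + ennreal (l powr (p - 1)) * (\<integral>\<^sup>+w\<in>{0..l}. (\<integral>\<^sup>+v\<in>{0..l}. B v w \<partial>lborel) \<partial>lborel))" .
  have "(\<integral>\<^sup>+w\<in>{0..l}. (\<integral>\<^sup>+v\<in>{0..l}. B v w \<partial>lborel) \<partial>lborel)
     \<le> (\<integral>\<^sup>+w\<in>{0..l}. ennreal l * (ennreal ?K * (\<Sum>s\<in>S. ennreal (norm (g' s (u + w)) powr p))) \<partial>lborel)"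
    unfolding l_def B_def by (intro set_nn_integral_mono' Lambda_p_set_local_le[OF p C S k])
  also have "\<dots> = ennreal l * (ennreal ?K * (\<Sum>s\<in>S. (\<integral>\<^sup>+w\<in>{0..l}. ennreal (norm (g' s (u + w)) powr p) \<partial>lborel)))"
    by (simp add: set_nn_integral_cmult' set_nn_integral_sum' del: sum_ennreal)
  finally have 2: "(\<integral>\<^sup>+w\<in>{0..l}. (\<integral>\<^sup>+v\<in>{0..l}. B v w \<partial>lborel) \<partial>lborel)
    \<le> ennreal l * (ennreal ?K * (\<Sum>s\<in>S. (\<integral>\<^sup>+w\<in>{0..l}. ennreal (norm (g' s (u + w)) powr p) \<partial>lborel)))" .
  have 3: "(\<integral>\<^sup>+v\<in>{0..l}. A v \<partial>lborel) \<le> ennreal l * (ennreal ?K * (\<Sum>s\<in>S. ennreal (norm (g s u) powr p)))"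
    unfolding l_def A_def by (rule Lambda_p_set_local_le[OF p C S k])
  have "(\<integral>\<^sup>+v\<in>{0..l}. ennreal (norm (\<Sum>s\<in>S. g s (u + v) * echar (\<kappa> * real s * (u + v))) powr p) \<partial>lborel)
    \<le> ennreal (2 powr (p - 1)) * (ennreal l * (ennreal ?K * (\<Sum>s\<in>S. ennreal (norm (g s u) powr p))) +
        ennreal (l powr (p - 1)) * (ennreal l * (ennreal ?K * (\<Sum>s\<in>S. (\<integral>\<^sup>+w\<in>{0..l}. ennreal (norm (g' s (u + w)) powr p) \<partial>lborel)))))"
    by (rule order_trans[OF 1]) (intro mult_left_mono add_mono 2 3 zero_le)
  also have "ennreal (l powr (p - 1)) * (ennreal l * (ennreal ?K * X)) = ennreal ?K * (ennreal (l powr p) * X)" for X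
  proof -
    have "ennreal (l powr (p - 1)) * ennreal l = ennreal (l powr p)"
      using l by (simp add: powr_diff ennreal_mult'[symmetric])
    then show ?thesis by (metis mult.assoc mult.commute)
  qed
  also have "ennreal l * (ennreal ?K * X) = ennreal ?K * (ennreal l * X)" for X
    by (rule mult.left_commute)
  finally show ?thesis
    by (simp only: sum.distrib sum_distrib_left distrib_left)
qed

lemma borel_measurable_Lp_pow [measurable]:
  assumes [measurable]: "case_prod f \<in> borel_measurable (borel \<Otimes>\<^sub>M borel)"
  shows "(\<lambda>t. Lp_pow p (\<lambda>x. f x t)) \<in> borel_measurable borel"
proof -
  have [measurable]: "(\<lambda>(t, x). f x t) \<in> borel_measurable (borel \<Otimes>\<^sub>M borel)"
    using measurable_compose[OF measurable_pair_swap' assms] by (simp add: case_prod_beta o_def)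
  show ?thesis unfolding Lp_pow_def by measurable
qed

text \<open>The local estimate averaged over all windows of length \<open>l\<close>. The averaging
  lemmas widen the interval by \<open>l\<close> at each end, and the common factor \<open>l\<close>
  cancels at the end.\<close>

lemma Lambda_p_set_decouple:
  fixes g g' :: "nat \<Rightarrow> real \<Rightarrow> real \<Rightarrow> complex"
  assumes p: "2 \<le> p" and C: "0 < C" and S: "Lambda_p_set p c0 c1 C N S" and k: "\<kappa> \<noteq> 0"
    and mg: "\<And>s. case_prod (g s) \<in> borel_measurable (borel \<Otimes>\<^sub>M borel)"
    and mg': "\<And>s. case_prod (g' s) \<in> borel_measurable (borel \<Otimes>\<^sub>M borel)"
    and g: "\<And>s x t. (g s x has_vector_derivative g' s x t) (at t)"
    and g': "\<And>s x. continuous_on UNIV (g' s x)"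
  defines "l \<equiv> 1 / \<bar>\<kappa>\<bar>"
  shows "(\<integral>\<^sup>+t\<in>{\<alpha>..\<beta>}. Lp_pow p (\<lambda>x. \<Sum>s\<in>S. g s x t * echar (\<kappa> * real s * t)) \<partial>lborel)
    \<le> ennreal (2 powr (p - 1)) * (ennreal (C powr p * real (card S) powr (p / 2 - 1)) *
       (\<Sum>s\<in>S. (\<integral>\<^sup>+t\<in>{\<alpha> - l..\<beta> + l}. Lp_pow p (\<lambda>x. g s x t) \<partial>lborel)
          + ennreal (l powr p) * (\<integral>\<^sup>+t\<in>{\<alpha> - l..\<beta> + l}. Lp_pow p (\<lambda>x. g' s x t) \<partial>lborel)))"
proof -
  let ?c = "ennreal (2 powr (p - 1))"
  let ?K = "ennreal (C powr p * real (card S) powr (p / 2 - 1))"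
  have l: "0 < l" using k by (simp add: l_def)
  note [measurable] = mg mg'
  define F where "F x t = (\<Sum>s\<in>S. g s x t * echar (\<kappa> * real s * t))" for x t
  have mF[measurable]: "case_prod F \<in> borel_measurable (borel \<Otimes>\<^sub>M borel)" unfolding F_def by measurable
  define H where "H t = Lp_pow p (\<lambda>x. F x t)" for t
  have mH[measurable]: "H \<in> borel_measurable borel" unfolding H_def by measurable
  define P where "P s t = Lp_pow p (\<lambda>x. g s x t)" for s t
  define P' where "P' s t = Lp_pow p (\<lambda>x. g' s x t)" for s t
  have mP[measurable]: "P s \<in> borel_measurable borel" "P' s \<in> borel_measurable borel" for s
    unfolding P_def P'_def by measurable
  have inner: "(\<integral>\<^sup>+v\<in>{0..l}. H (u + v) \<partial>lborel)
     \<le> ?c * (?K * (\<Sum>s\<in>S. ennreal l * P s u + ennreal (l powr p) * (\<integral>\<^sup>+w\<in>{0..l}. P' s (u + w) \<partial>lborel)))" for u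
  proof -
    have "(\<integral>\<^sup>+v\<in>{0..l}. H (u + v) \<partial>lborel) = (\<integral>\<^sup>+x\<in>{0..1}. (\<integral>\<^sup>+v\<in>{0..l}. ennreal (norm (F x (u + v)) powr p) \<partial>lborel) \<partial>lborel)"
      unfolding H_def Lp_pow_def by (rule set_nn_integral_swap[symmetric]) auto
    also have "\<dots> \<le> (\<integral>\<^sup>+x\<in>{0..1}. ?c * (?K * (\<Sum>s\<in>S. ennreal l * ennreal (norm (g s x u) powr p)
          + ennreal (l powr p) * (\<integral>\<^sup>+w\<in>{0..l}. ennreal (norm (g' s x (u + w)) powr p) \<partial>lborel))) \<partial>lborel)"
      unfolding F_def l_def by (intro set_nn_integral_mono' Lambda_p_set_decouple_local[OF p C S k g g'])
    also have "\<dots> = ?c * (?K * (\<Sum>s\<in>S. ennreal l * P s u + ennreal (l powr p) * (\<integral>\<^sup>+w\<in>{0..l}. P' s (u + w) \<partial>lborel)))"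
    proof -
      have "(\<integral>\<^sup>+w\<in>{0..l}. P' s (u + w) \<partial>lborel)
          = (\<integral>\<^sup>+x\<in>{0..1}. (\<integral>\<^sup>+w\<in>{0..l}. ennreal (norm (g' s x (u + w)) powr p) \<partial>lborel) \<partial>lborel)" for s
        unfolding P'_def Lp_pow_def by (rule set_nn_integral_swap) auto
      then show ?thesis
        unfolding P_def Lp_pow_def
        by (simp add: set_nn_integral_cmult' set_nn_integral_add' set_nn_integral_sum' del: sum_ennreal)
    qed
    finally show ?thesis .
  qed
  let ?I = "{\<alpha> - l..\<beta>}" and ?J = "{\<alpha> - l..\<beta> + l}"
  have "ennreal l * (\<integral>\<^sup>+t\<in>{\<alpha>..\<beta>}. H t \<partial>lborel) \<le> (\<integral>\<^sup>+u\<in>?I. (\<integral>\<^sup>+v\<in>{0..l}. H (u + v) \<partial>lborel) \<partial>lborel)"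
    using l by (intro nn_integral_average_ge) auto
  also have "\<dots> \<le> (\<integral>\<^sup>+u\<in>?I. ?c * (?K * (\<Sum>s\<in>S. ennreal l * P s u + ennreal (l powr p) * (\<integral>\<^sup>+w\<in>{0..l}. P' s (u + w) \<partial>lborel))) \<partial>lborel)"
    by (intro set_nn_integral_mono' inner)
  also have "\<dots> = ?c * (?K * (\<Sum>s\<in>S. (\<integral>\<^sup>+u\<in>?I. ennreal l * P s u + ennreal (l powr p) * (\<integral>\<^sup>+w\<in>{0..l}. P' s (u + w) \<partial>lborel) \<partial>lborel)))"
    by (simp add: set_nn_integral_cmult' set_nn_integral_sum' del: sum_ennreal)
  finally have 1: "ennreal l * (\<integral>\<^sup>+t\<in>{\<alpha>..\<beta>}. H t \<partial>lborel)
    \<le> ?c * (?K * (\<Sum>s\<in>S. (\<integral>\<^sup>+u\<in>?I. ennreal l * P s u + ennreal (l powr p) * (\<integral>\<^sup>+w\<in>{0..l}. P' s (u + w) \<partial>lborel) \<partial>lborel)))" .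
  have 2: "(\<integral>\<^sup>+u\<in>?I. ennreal l * P s u + ennreal (l powr p) * (\<integral>\<^sup>+w\<in>{0..l}. P' s (u + w) \<partial>lborel) \<partial>lborel)
     \<le> ennreal l * ((\<integral>\<^sup>+t\<in>?J. P s t \<partial>lborel) + ennreal (l powr p) * (\<integral>\<^sup>+t\<in>?J. P' s t \<partial>lborel))" for s
  proof -
    have "(\<integral>\<^sup>+u\<in>?I. ennreal l * P s u + ennreal (l powr p) * (\<integral>\<^sup>+w\<in>{0..l}. P' s (u + w) \<partial>lborel) \<partial>lborel)
       = ennreal l * (\<integral>\<^sup>+u\<in>?I. P s u \<partial>lborel) + ennreal (l powr p) * (\<integral>\<^sup>+u\<in>?I. (\<integral>\<^sup>+w\<in>{0..l}. P' s (u + w) \<partial>lborel) \<partial>lborel)"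
      by (simp add: set_nn_integral_cmult' set_nn_integral_add')
    also have "\<dots> \<le> ennreal l * (\<integral>\<^sup>+t\<in>?J. P s t \<partial>lborel) + ennreal (l powr p) * (ennreal l * (\<integral>\<^sup>+t\<in>?J. P' s t \<partial>lborel))"
    proof (intro add_mono mult_left_mono zero_le)
      show "(\<integral>\<^sup>+u\<in>?I. P s u \<partial>lborel) \<le> (\<integral>\<^sup>+t\<in>?J. P s t \<partial>lborel)"
        using l by (intro nn_integral_mono) (auto split: split_indicator)
      show "(\<integral>\<^sup>+u\<in>?I. (\<integral>\<^sup>+w\<in>{0..l}. P' s (u + w) \<partial>lborel) \<partial>lborel) \<le> ennreal l * (\<integral>\<^sup>+t\<in>?J. P' s t \<partial>lborel)"
        using l by (intro nn_integral_average_le) auto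
    qed
    also have "\<dots> = ennreal l * ((\<integral>\<^sup>+t\<in>?J. P s t \<partial>lborel) + ennreal (l powr p) * (\<integral>\<^sup>+t\<in>?J. P' s t \<partial>lborel))"
      by (simp only: distrib_left mult.left_commute)
    finally show ?thesis .
  qed
  have "ennreal l * (\<integral>\<^sup>+t\<in>{\<alpha>..\<beta>}. H t \<partial>lborel)
    \<le> ?c * (?K * (\<Sum>s\<in>S. ennreal l * ((\<integral>\<^sup>+t\<in>?J. P s t \<partial>lborel) + ennreal (l powr p) * (\<integral>\<^sup>+t\<in>?J. P' s t \<partial>lborel))))"
    by (rule order_trans[OF 1]) (intro mult_left_mono sum_mono 2 zero_le)
  also have "\<dots> = ennreal l * (?c * (?K * (\<Sum>s\<in>S. (\<integral>\<^sup>+t\<in>?J. P s t \<partial>lborel) + ennreal (l powr p) * (\<integral>\<^sup>+t\<in>?J. P' s t \<partial>lborel))))"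
    by (simp only: sum_distrib_left[symmetric] mult.left_commute)
  finally have "(\<integral>\<^sup>+t\<in>{\<alpha>..\<beta>}. H t \<partial>lborel)
     \<le> ?c * (?K * (\<Sum>s\<in>S. (\<integral>\<^sup>+t\<in>?J. P s t \<partial>lborel) + ennreal (l powr p) * (\<integral>\<^sup>+t\<in>?J. P' s t \<partial>lborel)))"
    using l by (subst (asm) ennreal_mult_le_mult_iff) auto
  then show ?thesis unfolding H_def F_def P_def P'_def .
qed

subsection \<open>Fejer kernels and Fourier multipliers on the circle\<close>

lemma sum_echar_orthogonal:
  fixes n :: int
  assumes "0 < M"
  shows "(\<Sum>l<M. echar (of_int n * (real l / real M))) = (if int M dvd n then of_nat M else 0)"
proof -
  define z where "z = echar (of_int n / real M)"
  have pow: "echar (of_int n * (real l / real M)) = z ^ l" for l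
    unfolding z_def echar_def Complex.DeMoivre by (rule arg_cong[where f = cis]) simp
  have zM: "z ^ M = 1"
    using pow[of M, symmetric] assms by simp
  show ?thesis
  proof (cases "int M dvd n")
    case True
    then obtain q where "n = int M * q" by auto
    then have "z = echar (of_int q)" using assms by (simp add: z_def)
    then show ?thesis unfolding pow using True by simp
  next
    case False
    have "z \<noteq> 1"
    proof
      assume "z = 1"
      then have "cos (2 * pi * (of_int n / real M)) = 1" by (simp add: z_def echar_def complex_eq_iff)
      then obtain q :: int where "2 * pi * (of_int n / real M) = of_int q * 2 * pi"
        unfolding cos_one_2pi_int by blast
      then have "real_of_int n = real_of_int (q * int M)" using assms by (simp add: field_simps)
      then have "n = q * int M" by (simp only: of_int_eq_iff)
      then show False using False by simp
    qed
    then have "(\<Sum>l<M. z ^ l) = 0" by (simp add: geometric_sum zM)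
    then show ?thesis unfolding pow using False by simp
  qed
qed

definition hat :: "real \<Rightarrow> real" where
  "hat y = max 0 (1 - \<bar>y\<bar>)"

text \<open>
  \<open>1 / M\<close> times the Fejer kernel of degree \<open>R - 1\<close>: a probability weight on every translate of the
  grid of spacing \<open>1 / M\<close>, provided that \<open>R \<le> M\<close>.
\<close>

definition fejer :: "nat \<Rightarrow> nat \<Rightarrow> real \<Rightarrow> real" where
  "fejer M R y = (norm (\<Sum>i<R. echar (real i * y)))\<^sup>2 / (real M * real R)"

lemma fejer_nonneg: "0 \<le> fejer M R y"
  by (simp add: fejer_def)

lemma fejer_eq_double_sum:
  "complex_of_real (fejer M R y) = (\<Sum>i<R. \<Sum>k<R. echar (real i * y - real k * y)) / (of_nat M * of_nat R)"
proof -
  have "complex_of_real ((norm (\<Sum>i<R. echar (real i * y)))\<^sup>2)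
     = (\<Sum>i<R. echar (real i * y)) * cnj (\<Sum>i<R. echar (real i * y))"
    by (rule complex_norm_square)
  also have "\<dots> = (\<Sum>i<R. \<Sum>k<R. echar (real i * y - real k * y))"
    by (simp add: sum_product echar_add[symmetric] echar_minus[symmetric])
  finally show ?thesis by (simp add: fejer_def)
qed

lemma card_diff_pairs: "card {(i, k). i < R \<and> k < R \<and> int i - int k = n} = nat (int R - \<bar>n\<bar>)"
proof (cases "n \<ge> 0")
  case True
  have "bij_betw (\<lambda>k. (k + nat n, k)) {..<R - nat n} {(i, k). i < R \<and> k < R \<and> int i - int k = n}"
    using True by (intro bij_betwI[where g = snd]) auto
  then have "card {(i, k). i < R \<and> k < R \<and> int i - int k = n} = R - nat n"
    using bij_betw_same_card by fastforce
  then show ?thesis using True by auto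
next
  case False
  have "bij_betw (\<lambda>k. (k, k + nat (- n))) {..<R - nat (- n)} {(i, k). i < R \<and> k < R \<and> int i - int k = n}"
    using False by (intro bij_betwI[where g = fst]) auto
  then have "card {(i, k). i < R \<and> k < R \<and> int i - int k = n} = R - nat (- n)"
    using bij_betw_same_card by fastforce
  then show ?thesis using False by auto
qed

text \<open>The size condition excludes aliasing: \<open>n - (i - k)\<close> stays below
  \<open>M\<close> in absolute value, so only pairs with \<open>i - k = n\<close> survive the sum
  over the grid, and there are \<open>R - \<bar>n\<bar>\<close> of them.\<close>

lemma fejer_transform:
  fixes n :: int
  assumes "0 < R" "\<bar>n\<bar> + int R \<le> int M"
  shows "(\<Sum>l<M. complex_of_real (fejer M R (x - real l / real M)) * echar (of_int n * (real l / real M)))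
    = complex_of_real (hat (of_int n / real R)) * echar (of_int n * x)"
proof -
  have M: "0 < M" using assms by auto
  have "(\<Sum>l<M. complex_of_real (fejer M R (x - real l / real M)) * echar (of_int n * (real l / real M)))
     = (\<Sum>l<M. \<Sum>i<R. \<Sum>k<R. echar ((real i - real k) * x) * echar (of_int (n - (int i - int k)) * (real l / real M))) / (of_nat M * of_nat R)"
    unfolding fejer_eq_double_sum sum_divide_distrib sum_distrib_right
    by (intro sum.cong refl) (simp add: echar_add[symmetric] algebra_simps diff_divide_distrib add_divide_distrib)
  also have "(\<Sum>l<M. \<Sum>i<R. \<Sum>k<R. echar ((real i - real k) * x) * echar (of_int (n - (int i - int k)) * (real l / real M)))
     = (\<Sum>i<R. \<Sum>k<R. echar ((real i - real k) * x) * (\<Sum>l<M. echar (of_int (n - (int i - int k)) * (real l / real M))))"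
    unfolding sum_distrib_left
    by (subst sum.swap, rule sum.cong[OF refl], subst sum.swap) simp
  also have "\<dots> = (\<Sum>i<R. \<Sum>k<R. if int i - int k = n then echar (of_int n * x) * of_nat M else 0)"
  proof (intro sum.cong refl)
    fix i k assume ik: "i \<in> {..<R}" "k \<in> {..<R}"
    have dvd: "int M dvd (n - (int i - int k)) \<longleftrightarrow> int i - int k = n"
    proof
      assume "int M dvd (n - (int i - int k))"
      moreover have "\<bar>n - (int i - int k)\<bar> < int M" using ik assms by auto
      ultimately have "n - (int i - int k) = 0" using dvd_imp_le_int[of "n - (int i - int k)" "int M"] by auto
      then show "int i - int k = n" by simp
    qed auto
    show "echar ((real i - real k) * x) * (\<Sum>l<M. echar (of_int (n - (int i - int k)) * (real l / real M)))
       = (if int i - int k = n then echar (of_int n * x) * of_nat M else 0)"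
    proof (cases "int i - int k = n")
      case True
      then have "real i - real k = real_of_int n" by auto
      then show ?thesis by (simp only: sum_echar_orthogonal[OF M] dvd if_P[OF True])
    qed (simp only: sum_echar_orthogonal[OF M] dvd if_False mult_zero_right)
  qed
  also have "\<dots> = (\<Sum>(i, k)\<in>{..<R} \<times> {..<R}. if int i - int k = n then echar (of_int n * x) * of_nat M else 0)"
    by (simp add: sum.cartesian_product)
  also have "\<dots> = (\<Sum>(i, k)\<in>{(i, k). i < R \<and> k < R \<and> int i - int k = n}. echar (of_int n * x) * of_nat M)"
    by (rule sum.mono_neutral_cong_right) (auto split: if_splits)
  also have "\<dots> = of_nat (nat (int R - \<bar>n\<bar>)) * (echar (of_int n * x) * of_nat M)"
    unfolding case_prod_beta by (simp add: card_diff_pairs[unfolded case_prod_beta])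
  finally have "(\<Sum>l<M. complex_of_real (fejer M R (x - real l / real M)) * echar (of_int n * (real l / real M)))
     = of_nat (nat (int R - \<bar>n\<bar>)) / of_nat R * echar (of_int n * x)"
    using M by simp
  moreover have "hat (of_int n / real R) = real (nat (int R - \<bar>n\<bar>)) / real R"
    using assms(1) by (auto simp: hat_def max_def field_simps abs_if nat_diff_distrib split: if_splits)
  ultimately show ?thesis by simp
qed

lemma fejer_sum:
  assumes "0 < R" "R \<le> M"
  shows "(\<Sum>l<M. fejer M R (x - real l / real M)) = 1"
proof -
  have "complex_of_real (\<Sum>l<M. fejer M R (x - real l / real M)) = 1"
    using fejer_transform[of R 0 M x] assms by (simp add: hat_def)
  then show ?thesis by (simp only: of_real_eq_1_iff)
qed

text \<open>After centring the sum at \<open>(R - 1) / 2\<close> all phases are at most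
  \<open>2 * pi / 8\<close>, which is below \<open>pi / 3\<close>, so every term has real part at
  least 1/2. The sum is at least \<open>R / 2\<close>, and
  \<open>(R / 2)\<^sup>2 / (2 * R * R) = 1 / 8\<close>.\<close>

lemma fejer_ge:
  fixes m :: int
  assumes "0 < R" "\<bar>y - of_int m\<bar> \<le> 1 / (4 * real R)"
  shows "fejer (2 * R) R y \<ge> 1 / 8"
proof -
  let ?D = "\<Sum>i<R. echar (real i * y)"
  define z where "z = y - of_int m"
  have ez: "echar (real i * y) = echar (real i * z)" for i
  proof -
    have "real i * y = real i * z + of_int (int i * m)" by (simp add: z_def algebra_simps)
    then show ?thesis by (simp only: echar_add echar_of_int mult_1_right)
  qed
  let ?c = "(real R - 1) / 2"
  have "echar (- ?c * z) * ?D = (\<Sum>i<R. echar ((real i - ?c) * z))"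
    unfolding sum_distrib_left ez echar_add[symmetric]
    by (intro sum.cong refl arg_cong[where f = echar]) (simp add: algebra_simps)
  then have n: "norm ?D = norm (\<Sum>i<R. echar ((real i - ?c) * z))"
    by (simp only: norm_mult norm_echar mult_1_left flip: \<open>echar (- ?c * z) * ?D = _\<close>)
  have "real R / 2 = (\<Sum>i<R. 1 / 2 :: real)" by simp
  also have "\<dots> \<le> (\<Sum>i<R. Re (echar ((real i - ?c) * z)))"
  proof (rule sum_mono)
    fix i assume i: "i \<in> {..<R}"
    then have "real i + 1 \<le> real R" by auto
    then have "\<bar>real i - ?c\<bar> \<le> real R / 2" by (simp add: abs_if field_simps)
    then have "\<bar>real i - ?c\<bar> * \<bar>z\<bar> \<le> real R / 2 * (1 / (4 * real R))"
      using assms by (intro mult_mono) (auto simp: z_def)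
    also have "\<dots> = 1 / 8" using assms by simp
    finally have a: "\<bar>(real i - ?c) * z\<bar> \<le> 1 / 8" by (simp add: abs_mult)
    have "2 * pi * \<bar>(real i - ?c) * z\<bar> \<le> 2 * pi * (1 / 8)"
      using a by (intro mult_left_mono) auto
    then have "\<bar>2 * pi * ((real i - ?c) * z)\<bar> \<le> pi / 3"
      by (simp only: abs_mult) (simp add: abs_mult)
    then have "cos (pi / 3) \<le> cos \<bar>2 * pi * ((real i - ?c) * z)\<bar>"
      by (intro cos_monotone_0_pi_le) auto
    then show "1 / 2 \<le> Re (echar ((real i - ?c) * z))"
      by (simp add: cos_60 echar_def)
  qed
  also have "\<dots> = Re (\<Sum>i<R. echar ((real i - ?c) * z))" by simp
  also have "\<dots> \<le> norm ?D" unfolding n by (rule complex_Re_le_cmod)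
  finally have "(real R / 2)\<^sup>2 \<le> (norm ?D)\<^sup>2" by (intro power_mono) auto
  then show ?thesis using assms(1) by (simp add: fejer_def power2_eq_square field_simps)
qed

section \<open>Trigonometric polynomials and multiplier norms\<close>

definition trig :: "int set \<Rightarrow> (int \<Rightarrow> complex) \<Rightarrow> real \<Rightarrow> complex" where
  "trig Z c x = (\<Sum>n\<in>Z. c n * echar (of_int n * x))"

lemma continuous_on_trig [continuous_intros]:
  "continuous_on A f \<Longrightarrow> continuous_on A (\<lambda>x. trig Z c (f x))"
  unfolding trig_def by (intro continuous_intros)

lemma borel_measurable_trig [measurable]: "trig Z c \<in> borel_measurable borel"
  by (intro borel_measurable_continuous_onI continuous_on_trig continuous_on_id)

lemma trig_add_1: "trig Z c (x + 1) = trig Z c x"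
  by (simp add: trig_def distrib_left echar_add)

lemma trig_cong: "(\<And>n. n \<in> Z \<Longrightarrow> c n = d n) \<Longrightarrow> trig Z c = trig Z d"
  by (simp add: trig_def fun_eq_iff)

text \<open>An operator norm bound, raised to the power \<open>p\<close>. Since only values on
  \<open>Z\<close> count, multipliers that grow linearly can be controlled near a centre.\<close>

definition multiplier_bound :: "real \<Rightarrow> int set \<Rightarrow> (int \<Rightarrow> complex) \<Rightarrow> real \<Rightarrow> bool" where
  "multiplier_bound p Z \<mu> B \<longleftrightarrow>
     (\<forall>c. Lp_pow p (trig Z (\<lambda>n. \<mu> n * c n)) \<le> ennreal (B powr p) * Lp_pow p (trig Z c))"

lemma multiplier_boundD:
  "multiplier_bound p Z \<mu> B \<Longrightarrow> Lp_pow p (trig Z (\<lambda>n. \<mu> n * c n)) \<le> ennreal (B powr p) * Lp_pow p (trig Z c)"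
  by (simp add: multiplier_bound_def)

lemma multiplier_bound_cong:
  assumes "multiplier_bound p Z \<mu> B" "\<And>n. n \<in> Z \<Longrightarrow> \<mu> n = \<nu> n"
  shows "multiplier_bound p Z \<nu> B"
  unfolding multiplier_bound_def
proof
  fix c
  have "trig Z (\<lambda>n. \<nu> n * c n) = trig Z (\<lambda>n. \<mu> n * c n)"
    by (rule trig_cong) (simp add: assms(2))
  then show "Lp_pow p (trig Z (\<lambda>n. \<nu> n * c n)) \<le> ennreal (B powr p) * Lp_pow p (trig Z c)"
    using multiplier_boundD[OF assms(1)] by simp
qed

lemma multiplier_bound_mono:
  assumes "multiplier_bound p Z \<mu> B" "0 \<le> B" "B \<le> B'" "0 \<le> p"
  shows "multiplier_bound p Z \<mu> B'"
  unfolding multiplier_bound_def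
proof
  fix c
  have "ennreal (B powr p) * Lp_pow p (trig Z c) \<le> ennreal (B' powr p) * Lp_pow p (trig Z c)"
    using assms by (intro mult_right_mono ennreal_leI powr_mono2) auto
  then show "Lp_pow p (trig Z (\<lambda>n. \<mu> n * c n)) \<le> ennreal (B' powr p) * Lp_pow p (trig Z c)"
    using multiplier_boundD[OF assms(1), of c] by (rule order_trans[rotated])
qed

lemma multiplier_bound_mult:
  assumes "multiplier_bound p Z \<mu> A" "multiplier_bound p Z \<nu> B" "0 \<le> A" "0 \<le> B"
  shows "multiplier_bound p Z (\<lambda>n. \<mu> n * \<nu> n) (A * B)"
  unfolding multiplier_bound_def
proof
  fix c
  have "Lp_pow p (trig Z (\<lambda>n. \<mu> n * (\<nu> n * c n))) \<le> ennreal (A powr p) * Lp_pow p (trig Z (\<lambda>n. \<nu> n * c n))"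
    by (rule multiplier_boundD[OF assms(1)])
  also have "\<dots> \<le> ennreal (A powr p) * (ennreal (B powr p) * Lp_pow p (trig Z c))"
    by (intro mult_left_mono multiplier_boundD[OF assms(2)]) auto
  finally show "Lp_pow p (trig Z (\<lambda>n. \<mu> n * \<nu> n * c n)) \<le> ennreal ((A * B) powr p) * Lp_pow p (trig Z c)"
    using assms by (simp add: powr_mult ennreal_mult' mult.assoc)
qed

lemma multiplier_bound_const: "multiplier_bound p Z (\<lambda>n. k) (norm k)"
proof -
  have "trig Z (\<lambda>n. k * c n) = (\<lambda>x. k * trig Z c x)" for c
    by (simp add: trig_def fun_eq_iff sum_distrib_left mult.assoc)
  then show ?thesis unfolding multiplier_bound_def by (simp add: Lp_pow_cmult)
qed

lemma multiplier_bound_sum: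
  assumes "1 \<le> p" "finite I" "\<And>i. i \<in> I \<Longrightarrow> multiplier_bound p Z (\<mu> i) B" "0 \<le> B"
  shows "multiplier_bound p Z (\<lambda>n. \<Sum>i\<in>I. \<mu> i n) (real (card I) * B)"
  unfolding multiplier_bound_def
proof
  fix c
  have "trig Z (\<lambda>n. (\<Sum>i\<in>I. \<mu> i n) * c n) = (\<lambda>x. \<Sum>i\<in>I. trig Z (\<lambda>n. \<mu> i n * c n) x)"
    unfolding trig_def sum_distrib_right by (intro ext sum.swap)
  then have "Lp_pow p (trig Z (\<lambda>n. (\<Sum>i\<in>I. \<mu> i n) * c n))
     \<le> ennreal (real (card I) powr (p - 1)) * (\<Sum>i\<in>I. Lp_pow p (trig Z (\<lambda>n. \<mu> i n * c n)))"
    using assms by (simp add: Lp_pow_sum_le)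
  also have "\<dots> \<le> ennreal (real (card I) powr (p - 1)) * (\<Sum>i\<in>I. ennreal (B powr p) * Lp_pow p (trig Z c))"
    by (intro mult_left_mono sum_mono multiplier_boundD assms) auto
  also have "\<dots> = ennreal (real (card I) powr (p - 1) * real (card I) * B powr p) * Lp_pow p (trig Z c)"
    by (simp add: ennreal_mult' ennreal_of_nat_eq_real_of_nat mult.assoc)
  also have "real (card I) powr (p - 1) * real (card I) = real (card I) powr p"
    using assms by (cases "card I = 0") (auto simp: powr_diff)
  finally show "Lp_pow p (trig Z (\<lambda>n. (\<Sum>i\<in>I. \<mu> i n) * c n)) \<le> ennreal ((real (card I) * B) powr p) * Lp_pow p (trig Z c)"
    using assms by (simp add: powr_mult)
qed

lemma multiplier_bound_add:
  assumes "1 \<le> p" "multiplier_bound p Z \<mu> B" "multiplier_bound p Z \<nu> B" "0 \<le> B"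
  shows "multiplier_bound p Z (\<lambda>n. \<mu> n + \<nu> n) (2 * B)"
  using multiplier_bound_sum[OF assms(1), of "{True, False}" Z "\<lambda>b. if b then \<mu> else \<nu>" B] assms by simp

text \<open>On frequencies in \<open>Z\<close> the multiplier is a finite average of translates,
  weighted by a modulated Fejer kernel of total mass one; \<open>M\<close> is chosen so that no
  \<open>n - \<nu>\<close> with \<open>n \<in> Z\<close> is aliased. Hence the bound 1, whatever
  \<open>Z\<close>, \<open>r\<close> and the centre.\<close>

lemma multiplier_bound_hat:
  assumes "1 \<le> p" "finite Z" "0 < r"
  shows "multiplier_bound p Z (\<lambda>n. complex_of_real (hat (of_int (n - \<nu>) / real r))) 1"
  unfolding multiplier_bound_def
proof
  fix c
  define M where "M = nat (Max (insert 0 ((\<lambda>n. \<bar>n - \<nu>\<bar>) ` Z))) + r"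
  have M: "\<bar>n - \<nu>\<bar> + int r \<le> int M" if "n \<in> Z" for n
  proof -
    have "\<bar>n - \<nu>\<bar> \<le> Max (insert 0 ((\<lambda>n. \<bar>n - \<nu>\<bar>) ` Z))" using assms that by (intro Max_ge) auto
    then show ?thesis unfolding M_def by linarith
  qed
  have "r \<le> M" by (simp add: M_def)
  define w where "w l = complex_of_real (fejer M r (0 - real l / real M)) * echar (of_int (- \<nu>) * (real l / real M))" for l
  have w1: "(\<Sum>l<M. norm (w l)) = 1"
    using fejer_sum[OF assms(3) \<open>r \<le> M\<close>, of 0] by (simp add: w_def norm_mult fejer_nonneg)
  have "trig Z (\<lambda>n. complex_of_real (hat (of_int (n - \<nu>) / real r)) * c n) x
     = (\<Sum>l<M. w l * trig Z c (x + real l / real M))" for x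
  proof -
    have "(\<Sum>l<M. w l * trig Z c (x + real l / real M))
       = (\<Sum>n\<in>Z. \<Sum>l<M. w l * (c n * echar (of_int n * (x + real l / real M))))"
      unfolding trig_def sum_distrib_left by (rule sum.swap)
    also have "\<dots> = (\<Sum>n\<in>Z. c n * echar (of_int n * x) *
        (\<Sum>l<M. complex_of_real (fejer M r (0 - real l / real M)) * echar (of_int (n - \<nu>) * (real l / real M))))"
      unfolding sum_distrib_left
    proof (intro sum.cong refl)
      fix n l
      let ?y = "real l / real M"
      have "echar (of_int (- \<nu>) * ?y) * echar (of_int n * (x + ?y)) = echar (of_int n * x) * echar (of_int (n - \<nu>) * ?y)"
        unfolding echar_add[symmetric] by (rule arg_cong[where f = echar]) (simp add: algebra_simps diff_divide_distrib)
      moreover have "A * B * (D * E) = D * F * (A * G)" if "B * E = F * G" for A B D E F G :: complex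
      proof -
        have "A * B * (D * E) = A * D * (B * E)" by (simp add: mult_ac)
        then show ?thesis by (simp add: that mult_ac)
      qed
      ultimately show "w l * (c n * echar (of_int n * (x + ?y)))
        = c n * echar (of_int n * x) * (complex_of_real (fejer M r (0 - ?y)) * echar (of_int (n - \<nu>) * ?y))"
        unfolding w_def by blast
    qed
    also have "\<dots> = (\<Sum>n\<in>Z. c n * echar (of_int n * x) * complex_of_real (hat (of_int (n - \<nu>) / real r)))"
      using fejer_transform[OF assms(3) M, of _ 0] by (intro sum.cong refl) simp
    finally show ?thesis by (simp add: trig_def mult_ac)
  qed
  then have "Lp_pow p (trig Z (\<lambda>n. complex_of_real (hat (of_int (n - \<nu>) / real r)) * c n))
     = Lp_pow p (\<lambda>x. \<Sum>l<M. w l * trig Z c (x + real l / real M))" by (rule arg_cong[where f = "Lp_pow p", OF ext])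
  also have "\<dots> \<le> (\<Sum>l<M. ennreal (norm (w l)) * Lp_pow p (\<lambda>x. trig Z c (x + real l / real M)))"
    using assms w1 by (intro Lp_pow_weighted_sum_le) auto
  also have "\<dots> = (\<Sum>l<M. ennreal (norm (w l))) * Lp_pow p (trig Z c)"
    by (simp add: Lp_pow_shift trig_add_1 sum_distrib_right del: sum_ennreal)
  also have "(\<Sum>l<M. ennreal (norm (w l))) = 1"
    using w1 by (simp add: sum_ennreal)
  finally show "Lp_pow p (trig Z (\<lambda>n. complex_of_real (hat (of_int (n - \<nu>) / real r)) * c n))
     \<le> ennreal (1 powr p) * Lp_pow p (trig Z c)" by simp
qed

text \<open>A Bernstein inequality: within distance \<open>r\<close> of \<open>\<xi>\<close>, the
  function \<open>n - \<xi>\<close> is \<open>r\<close> times the difference of the hats of width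
  \<open>r\<close> centred at \<open>\<xi> + r\<close> and \<open>\<xi> - r\<close>.\<close>

lemma multiplier_bound_shifted_id:
  assumes "1 \<le> p" "finite Z" "0 < r" and Z: "\<And>n. n \<in> Z \<Longrightarrow> \<bar>n - \<xi>\<bar> \<le> int r"
  shows "multiplier_bound p Z (\<lambda>n. of_int (n - \<xi>)) (2 * real r)"
proof -
  let ?h = "\<lambda>\<nu> n. complex_of_real (hat (of_int (n - \<nu>) / real r))"
  have h: "multiplier_bound p Z (\<lambda>n. k * ?h \<nu> n) (norm k)" for \<nu> k
    using multiplier_bound_mult[OF multiplier_bound_const multiplier_bound_hat] assms by fastforce
  have "multiplier_bound p Z (\<lambda>n. of_nat r * ?h (\<xi> + int r) n + (- of_nat r) * ?h (\<xi> - int r) n) (2 * real r)"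
    using h[of "of_nat r"] h[of "- of_nat r"] assms by (intro multiplier_bound_add) (simp_all del: of_int_diff of_int_add)
  then show ?thesis
  proof (rule multiplier_bound_cong)
    fix n assume "n \<in> Z"
    define d where "d = real_of_int (n - \<xi>)"
    have d: "\<bar>d\<bar> \<le> real r" using Z[OF \<open>n \<in> Z\<close>] unfolding d_def by linarith
    have "real r * hat ((d - real r) / real r) - real r * hat ((d + real r) / real r) = d"
      using d assms(3) by (auto simp: hat_def max_def abs_if field_simps split: if_splits)
    then have "complex_of_real (real r * hat ((d - real r) / real r) - real r * hat ((d + real r) / real r)) = complex_of_real d"
      by simp
    then show "of_nat r * ?h (\<xi> + int r) n + (- of_nat r) * ?h (\<xi> - int r) n = of_int (n - \<xi>)"
      by (simp add: d_def algebra_simps)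
  qed
qed

subsection \<open>Decoupling along the tree of digits\<close>

locale cantor_tree =
  fixes p c0 c1 C :: real and N N0 :: nat and S :: "nat \<Rightarrow> real \<Rightarrow> nat set"
  assumes p: "2 \<le> p" and C: "0 < C" and N: "2 \<le> N" and N0: "0 < N0"
    and S: "\<And>m b. b \<in> cantor_points N S m \<Longrightarrow> Lambda_p_set p c0 c1 C N (S m b)"
    and card_S: "\<And>m b. b \<in> cantor_points N S m \<Longrightarrow> card (S m b) = N0"
begin

text \<open>\<open>cantor_points\<close> appends the finest digit, whereas this recursion branches
  at the coarsest one, the first to be decoupled. The arguments are the depth, the generation of
  \<open>b\<close>, and \<open>b\<close>.\<close>

primrec descendants :: "nat \<Rightarrow> nat \<Rightarrow> real \<Rightarrow> real set" where
  "descendants 0 m b = {b}"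
| "descendants (Suc h) m b = (\<Union>s\<in>S m b. descendants h (Suc m) (b + real s / real N ^ Suc m))"

lemma child_in_points:
  "b \<in> cantor_points N S m \<Longrightarrow> s \<in> S m b \<Longrightarrow> b + real s / real N ^ Suc m \<in> cantor_points N S (Suc m)"
  by (simp only: cantor_points.simps) blast

lemma finite_S: "b \<in> cantor_points N S m \<Longrightarrow> finite (S m b)"
  using S Lambda_p_set_finite by blast

lemma digit_less: "b \<in> cantor_points N S m \<Longrightarrow> s \<in> S m b \<Longrightarrow> real s \<le> real N - 2"
  using S[of b m] unfolding Lambda_p_set_def by fastforce

lemma descendants_in_points:
  "b \<in> cantor_points N S m \<Longrightarrow> a \<in> descendants h m b \<Longrightarrow> a \<in> cantor_points N S (m + h)"
proof (induction h arbitrary: m b)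
  case (Suc h)
  from Suc.prems(2) obtain s where s: "s \<in> S m b" and a: "a \<in> descendants h (Suc m) (b + real s / real N ^ Suc m)"
    by auto
  show ?case using Suc.IH[OF child_in_points[OF Suc.prems(1) s] a] by simp
qed simp

lemma finite_descendants: "b \<in> cantor_points N S m \<Longrightarrow> finite (descendants h m b)"
proof (induction h arbitrary: m b)
  case (Suc h)
  then show ?case using child_in_points[OF Suc.prems] finite_S[OF Suc.prems] by auto
qed simp

lemma descendants_range:
  "b \<in> cantor_points N S m \<Longrightarrow> a \<in> descendants h m b \<Longrightarrow> b \<le> a \<and> a < b + 1 / real N ^ m"
proof (induction h arbitrary: m b)
  case 0
  then show ?case using N by simp
next
  case (Suc h)
  from Suc.prems(2) obtain s where s: "s \<in> S m b" and a: "a \<in> descendants h (Suc m) (b + real s / real N ^ Suc m)"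
    by auto
  have ih: "b + real s / real N ^ Suc m \<le> a" "a < b + real s / real N ^ Suc m + 1 / real N ^ Suc m"
    using Suc.IH[OF child_in_points[OF Suc.prems(1) s] a] by auto
  have "real s / real N ^ Suc m + 1 / real N ^ Suc m = (real s + 1) / real N ^ Suc m"
    by (simp add: add_divide_distrib)
  also have "\<dots> \<le> real N / real N ^ Suc m"
    using digit_less[OF Suc.prems(1) s] by (intro divide_right_mono) auto
  also have "\<dots> = 1 / real N ^ m" using N by simp
  finally have "a < b + 1 / real N ^ m" using ih by linarith
  moreover have "0 \<le> real s / real N ^ Suc m" by simp
  ultimately show ?case using ih by linarith
qed

text \<open>Descendants of different children lie in disjoint half-open intervals, so none is
  counted twice.\<close>

lemma sum_descendants_Suc:
  fixes f :: "real \<Rightarrow> 'b::comm_monoid_add"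
  assumes b: "b \<in> cantor_points N S m"
  shows "sum f (descendants (Suc h) m b) = (\<Sum>s\<in>S m b. sum f (descendants h (Suc m) (b + real s / real N ^ Suc m)))"
  unfolding descendants.simps
proof (rule sum.UNION_disjoint)
  show "\<forall>s\<in>S m b. finite (descendants h (Suc m) (b + real s / real N ^ Suc m))"
    using finite_descendants child_in_points[OF b] by blast
  have le: "b + real s / real N ^ Suc m + 1 / real N ^ Suc m \<le> b + real s' / real N ^ Suc m" if "s < s'" for s s'
  proof -
    have "(real s + 1) / real N ^ Suc m \<le> real s' / real N ^ Suc m"
      using that by (intro divide_right_mono) auto
    then show ?thesis by (simp add: add_divide_distrib)
  qed
  have False if "s \<in> S m b" "s' \<in> S m b" "s < s'" "x \<in> descendants h (Suc m) (b + real s / real N ^ Suc m)"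
    "x \<in> descendants h (Suc m) (b + real s' / real N ^ Suc m)" for s s' x
    using le[OF that(3)] descendants_range[OF child_in_points[OF b that(1)] that(4)]
      descendants_range[OF child_in_points[OF b that(2)] that(5)] by linarith
  then show "\<forall>s\<in>S m b. \<forall>s'\<in>S m b. s \<noteq> s' \<longrightarrow>
    descendants h (Suc m) (b + real s / real N ^ Suc m) \<inter> descendants h (Suc m) (b + real s' / real N ^ Suc m) = {}"
    by (metis disjoint_iff linorder_neqE_nat)
qed (rule finite_S[OF b])

lemma card_descendants: "b \<in> cantor_points N S m \<Longrightarrow> card (descendants h m b) = N0 ^ h"
proof (induction h arbitrary: m b)
  case (Suc h)
  have "card (descendants (Suc h) m b) = (\<Sum>s\<in>S m b. card (descendants h (Suc m) (b + real s / real N ^ Suc m)))"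
    using sum_descendants_Suc[OF Suc.prems, of "\<lambda>_. 1::nat" h] by simp
  also have "\<dots> = (\<Sum>s\<in>S m b. N0 ^ h)"
    by (intro sum.cong refl Suc.IH child_in_points[OF Suc.prems])
  finally show ?case by (simp add: card_S[OF Suc.prems])
qed simp

text \<open>The price of one level: \<open>2 powr (p - 1)\<close> from the Sobolev step, the
  Lambda(p) bound with its Hoelder factor, and \<open>1 + (8 * pi) powr p\<close> for an amplitude
  and its derivative at the scale of one period.\<close>

definition decoupling_const :: real where
  "decoupling_const = 2 powr (p - 1) * (C powr p * real N0 powr (p / 2 - 1)) * (1 + (8 * pi) powr p)"

lemma decoupling_const_nonneg: "0 \<le> decoupling_const"
  by (simp add: decoupling_const_def)

text \<open>With \<open>e = b + s / N ^ Suc m\<close> the bracket equals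
  \<open>(n - \<xi>) * (a - b) + \<xi> * (a - e)\<close>. The first part is small because
  \<open>a - b \<le> 1 / N ^ m\<close> and \<open>r * N \<le> \<bar>\<xi>\<bar>\<close>, the second
  because \<open>a - e \<le> 1 / N ^ Suc m\<close>. Without the phase of the digit \<open>s\<close>,
  a piece therefore varies only at the scale \<open>N ^ Suc m / \<bar>\<xi>\<bar>\<close>.\<close>

lemma frequency_multiplier_bound:
  fixes \<xi> :: int
  assumes Z: "finite Z" "\<And>n. n \<in> Z \<Longrightarrow> \<bar>n - \<xi>\<bar> \<le> int r" and r: "0 < r" "real r * real N \<le> \<bar>of_int \<xi>\<bar>"
    and b: "b \<in> cantor_points N S m" and s: "s \<in> S m b"
    and a: "a \<in> descendants h (Suc m) (b + real s / real N ^ Suc m)"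
  shows "multiplier_bound p Z
     (\<lambda>n. 2 * pi * \<i> * (of_int n * (a - b) - of_int \<xi> / real N ^ Suc m * real s))
     (8 * pi * (\<bar>of_int \<xi>\<bar> / real N ^ Suc m))"
proof -
  let ?e = "b + real s / real N ^ Suc m"
  define L where "L = \<bar>real_of_int \<xi>\<bar> / real N ^ Suc m"
  have L0: "0 \<le> L" by (simp add: L_def)
  have "a \<in> descendants (Suc h) m b" using a s by auto
  then have ab: "0 \<le> a - b" "a - b \<le> 1 / real N ^ m"
    using descendants_range[OF b, of a "Suc h"] by linarith+
  have ae: "0 \<le> a - ?e" "a - ?e \<le> 1 / real N ^ Suc m"
    using descendants_range[OF child_in_points[OF b s] a] by linarith+
  have "2 * real r * \<bar>a - b\<bar> \<le> 2 * real r * (1 / real N ^ m)"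
    using ab by (intro mult_left_mono) auto
  also have "\<dots> = 2 * (real r * real N) / real N ^ Suc m" using N by simp
  also have "\<dots> \<le> 2 * \<bar>of_int \<xi>\<bar> / real N ^ Suc m"
    using r by (intro divide_right_mono mult_left_mono) auto
  also have "\<dots> = 2 * L" by (simp only: L_def times_divide_eq_right)
  finally have le: "norm (complex_of_real (a - b)) * (2 * real r) \<le> 2 * L"
    by (simp only: norm_of_real mult.commute)
  have "multiplier_bound p Z (\<lambda>n. complex_of_real (a - b) * of_int (n - \<xi>)) (norm (complex_of_real (a - b)) * (2 * real r))"
    by (rule multiplier_bound_mult[OF multiplier_bound_const multiplier_bound_shifted_id]) (use p Z r in simp_all)
  then have 1: "multiplier_bound p Z (\<lambda>n. complex_of_real (a - b) * of_int (n - \<xi>)) (2 * L)"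
    by (rule multiplier_bound_mono) (use le p in simp_all)
  have "\<bar>of_int \<xi> * (a - ?e)\<bar> \<le> \<bar>of_int \<xi>\<bar> * (1 / real N ^ Suc m)"
    unfolding abs_mult using ae by (intro mult_left_mono) auto
  also have "\<dots> = L" by (simp add: L_def)
  also have "\<dots> \<le> 2 * L" using L0 by simp
  finally have le: "norm (complex_of_real (of_int \<xi> * (a - ?e))) \<le> 2 * L" by (simp only: norm_of_real)
  have 2: "multiplier_bound p Z (\<lambda>n. complex_of_real (of_int \<xi> * (a - ?e))) (2 * L)"
    by (rule multiplier_bound_mono[OF multiplier_bound_const _ le]) (use p in simp_all)
  have "multiplier_bound p Z (\<lambda>n. complex_of_real (a - b) * of_int (n - \<xi>) + complex_of_real (of_int \<xi> * (a - ?e))) (2 * (2 * L))"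
    using p L0 by (intro multiplier_bound_add 1 2) auto
  from multiplier_bound_mult[OF multiplier_bound_const this, of "2 * pi * \<i>"] L0
  have "multiplier_bound p Z (\<lambda>n. 2 * pi * \<i> * (complex_of_real (a - b) * of_int (n - \<xi>) + complex_of_real (of_int \<xi> * (a - ?e)))) (8 * pi * L)"
    by (simp add: norm_mult mult_ac)
  then show ?thesis unfolding L_def
    by (rule multiplier_bound_cong) (simp add: algebra_simps)
qed

text \<open>Plain Hoelder, for the levels finer than the frequency of the piece, which are not
  decoupled.\<close>

lemma Lp_pow_descendants_le:
  assumes b: "b \<in> cantor_points N S m"
  shows "Lp_pow p (\<lambda>x. \<Sum>a\<in>descendants h m b. trig Z (c a) (x + t * a))
    \<le> ennreal (real N0 powr (real h * (p - 1))) * (\<Sum>a\<in>descendants h m b. Lp_pow p (trig Z (c a)))"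
proof -
  have "Lp_pow p (\<lambda>x. \<Sum>a\<in>descendants h m b. trig Z (c a) (x + t * a))
    \<le> ennreal (real (card (descendants h m b)) powr (p - 1)) * (\<Sum>a\<in>descendants h m b. Lp_pow p (\<lambda>x. trig Z (c a) (x + t * a)))"
    using p by (intro Lp_pow_sum_le finite_descendants[OF b]) auto
  also have "real (card (descendants h m b)) powr (p - 1) = real N0 powr (real h * (p - 1))"
    using N0 by (simp add: card_descendants[OF b] powr_powr flip: powr_realpow)
  finally show ?thesis by (simp add: Lp_pow_shift trig_add_1)
qed

text \<open>Induction on the number \<open>k - m\<close> of levels left. The coefficients
  \<open>c\<close> must be arbitrary: the hypothesis is used for the amplitudes and again for their
  derivatives, whose coefficients carry the residual frequencies. Every level widens the
  \<open>t\<close>-interval by \<open>N ^ Suc m / \<bar>\<xi>\<bar>\<close> at both ends, and the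
  summand with the factor 4 dominates this geometric sum.\<close>

lemma decoupling:
  fixes \<xi> :: int and r k j :: nat
  assumes Z: "finite Z" "\<And>n. n \<in> Z \<Longrightarrow> \<bar>n - \<xi>\<bar> \<le> int r" and r: "0 < r" and kj: "k \<le> j"
    and k: "0 < k \<Longrightarrow> real r * real N \<le> \<bar>of_int \<xi>\<bar>"
  shows "m \<le> k \<Longrightarrow> b \<in> cantor_points N S m \<Longrightarrow> \<alpha> \<le> \<beta> \<Longrightarrow>
    (\<integral>\<^sup>+t\<in>{\<alpha>..\<beta>}. Lp_pow p (\<lambda>x. \<Sum>a\<in>descendants (j - m) m b. trig Z (c a) (x + t * a)) \<partial>lborel)
      \<le> ennreal (decoupling_const ^ (k - m) * real N0 powr (real (j - k) * (p - 1))
             * (\<beta> - \<alpha> + 4 * (real N ^ k - real N ^ m) / \<bar>of_int \<xi>\<bar>))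
          * (\<Sum>a\<in>descendants (j - m) m b. Lp_pow p (trig Z (c a)))"
proof (induction "k - m" arbitrary: m b c \<alpha> \<beta>)
  case 0
  then have m: "m = k" by simp
  let ?L = "\<Sum>a\<in>descendants (j - m) m b. Lp_pow p (trig Z (c a))"
  have "(\<integral>\<^sup>+t\<in>{\<alpha>..\<beta>}. Lp_pow p (\<lambda>x. \<Sum>a\<in>descendants (j - m) m b. trig Z (c a) (x + t * a)) \<partial>lborel)
    \<le> (\<integral>\<^sup>+t\<in>{\<alpha>..\<beta>}. ennreal (real N0 powr (real (j - m) * (p - 1))) * ?L \<partial>lborel)"
    by (intro set_nn_integral_mono' Lp_pow_descendants_le 0)
  also have "\<dots> = ennreal (real N0 powr (real (j - m) * (p - 1)) * (\<beta> - \<alpha>)) * ?L"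
    using 0 by (subst nn_integral_cmult_indicator) (auto simp: ennreal_mult' mult_ac)
  finally show ?case using m by simp
next
  case (Suc d)
  then have mk: "m < k" and d: "d = k - Suc m" by auto
  have jm: "j - m = Suc (j - Suc m)" using mk kj by simp
  have rN: "real r * real N \<le> \<bar>of_int \<xi>\<bar>" using k mk by simp
  moreover have "0 < real r * real N" using r N by simp
  ultimately have \<xi>: "0 < \<bar>real_of_int \<xi>\<bar>" by linarith
  let ?D = "\<lambda>s. descendants (j - Suc m) (Suc m) (b + real s / real N ^ Suc m)"
  \<comment> \<open>The digit \<open>s\<close> moves the point by \<open>s / N ^ Suc m\<close>, so
    at frequency \<open>\<xi>\<close> it contributes the frequency \<open>\<kappa> * s\<close> in
    \<open>t\<close>.\<close>
  define \<kappa> where "\<kappa> = of_int \<xi> / real N ^ Suc m"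
  define l where "l = 1 / \<bar>\<kappa>\<bar>"
  have \<kappa>: "\<kappa> \<noteq> 0" using \<xi> N by (simp add: \<kappa>_def)
  have l: "0 < l" "l = real N ^ Suc m / \<bar>of_int \<xi>\<bar>" using \<kappa> N by (auto simp: l_def \<kappa>_def abs_divide)
  \<comment> \<open>What is left of the frequency in \<open>t\<close> after recentring at
    \<open>b\<close> and removing the phase of the digit.\<close>
  define \<theta> where "\<theta> s a n = of_int n * (a - b) - \<kappa> * real s" for s :: nat and a and n :: int
  define g where "g s x t = (\<Sum>a\<in>?D s. \<Sum>n\<in>Z. c a n * echar (\<theta> s a n * t + of_int n * x))" for s and x t :: real
  define g' where "g' s x t = (\<Sum>a\<in>?D s. \<Sum>n\<in>Z. c a n * (2 * pi * \<i> * \<theta> s a n * echar (\<theta> s a n * t + of_int n * x)))" for s and x t :: real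
  have phase: "echar (\<theta> s a n * t + of_int n * x) = echar (- (\<kappa> * real s * t)) * echar (of_int n * (x + t * (a - b)))" for s a n t x
    unfolding echar_add[symmetric] by (rule arg_cong[where f = echar]) (simp add: \<theta>_def algebra_simps)
  have g_eq: "g s x t = echar (- (\<kappa> * real s * t)) * (\<Sum>a\<in>?D s. trig Z (c a) (x + t * (a - b)))" for s x t
    unfolding g_def trig_def sum_distrib_left phase by (simp add: mult_ac)
  have g'_eq: "g' s x t = echar (- (\<kappa> * real s * t)) * (\<Sum>a\<in>?D s. trig Z (\<lambda>n. (2 * pi * \<i> * \<theta> s a n) * c a n) (x + t * (a - b)))" for s x t
    unfolding g'_def trig_def sum_distrib_left phase by (simp add: mult_ac)
  \<comment> \<open>Recentring at \<open>b\<close> translates \<open>x\<close> by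
    \<open>t * b\<close>, which the norm over a period does not see.\<close>
  have shear: "Lp_pow p (\<lambda>x. \<Sum>a\<in>A. trig Z (e a) (x + t * (a - b))) = Lp_pow p (\<lambda>x. \<Sum>a\<in>A. trig Z (e a) (x + t * a))" for A e t
  proof -
    let ?G = "\<lambda>x. \<Sum>a\<in>A. trig Z (e a) (x + t * (a - b))"
    have G1: "?G (x + 1) = ?G x" for x
    proof (rule sum.cong[OF refl])
      fix a
      show "trig Z (e a) (x + 1 + t * (a - b)) = trig Z (e a) (x + t * (a - b))"
        using trig_add_1[of Z "e a" "x + t * (a - b)"] by (simp add: add_ac)
    qed
    have "Lp_pow p (\<lambda>x. ?G (x + t * b)) = Lp_pow p ?G"
      by (rule Lp_pow_shift) (measurable, rule G1)
    then show ?thesis by (simp add: right_diff_distrib)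
  qed
  have norm_g: "Lp_pow p (\<lambda>x. g s x t) = Lp_pow p (\<lambda>x. \<Sum>a\<in>?D s. trig Z (c a) (x + t * a))" for s t
    unfolding shear[symmetric] by (rule Lp_pow_norm_cong) (simp add: g_eq norm_mult)
  have norm_g': "Lp_pow p (\<lambda>x. g' s x t) = Lp_pow p (\<lambda>x. \<Sum>a\<in>?D s. trig Z (\<lambda>n. (2 * pi * \<i> * \<theta> s a n) * c a n) (x + t * a))" for s t
    unfolding shear[symmetric] by (rule Lp_pow_norm_cong) (simp only: g'_eq norm_mult norm_echar mult_1_left)
  have norm_sum: "Lp_pow p (\<lambda>x. \<Sum>a\<in>descendants (j - m) m b. trig Z (c a) (x + t * a))
     = Lp_pow p (\<lambda>x. \<Sum>s\<in>S m b. g s x t * echar (\<kappa> * real s * t))" for t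
    unfolding shear[symmetric]
  proof (rule Lp_pow_norm_cong, rule arg_cong[where f = norm])
    fix x
    have "g s x t * echar (\<kappa> * real s * t) = (\<Sum>a\<in>?D s. trig Z (c a) (x + t * (a - b)))" for s
    proof -
      have "echar (- (\<kappa> * real s * t)) * echar (\<kappa> * real s * t) = 1"
        unfolding echar_add[symmetric] by simp
      then show ?thesis unfolding g_eq by (simp add: mult_ac)
    qed
    then show "(\<Sum>a\<in>descendants (j - m) m b. trig Z (c a) (x + t * (a - b)))
      = (\<Sum>s\<in>S m b. g s x t * echar (\<kappa> * real s * t))"
      unfolding jm by (subst sum_descendants_Suc[OF Suc.prems(2)]) simp
  qed
  define E where "E = decoupling_const ^ (k - Suc m) * real N0 powr (real (j - k) * (p - 1))
             * (\<beta> + l - (\<alpha> - l) + 4 * (real N ^ k - real N ^ Suc m) / \<bar>of_int \<xi>\<bar>)"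
  let ?L = "\<lambda>s. \<Sum>a\<in>?D s. Lp_pow p (trig Z (c a))"
  have le: "\<alpha> - l \<le> \<beta> + l" using l Suc.prems by linarith
  have IH1: "(\<integral>\<^sup>+t\<in>{\<alpha> - l..\<beta> + l}. Lp_pow p (\<lambda>x. g s x t) \<partial>lborel) \<le> ennreal E * ?L s" if s: "s \<in> S m b" for s
    unfolding norm_g E_def
    by (rule Suc.hyps(1)[OF d _ child_in_points[OF Suc.prems(2) s] le]) (use mk in simp)
  have IH2: "(\<integral>\<^sup>+t\<in>{\<alpha> - l..\<beta> + l}. Lp_pow p (\<lambda>x. g' s x t) \<partial>lborel) \<le> ennreal E * (ennreal ((8 * pi / l) powr p) * ?L s)" if s: "s \<in> S m b" for s
  proof -
    have "(\<integral>\<^sup>+t\<in>{\<alpha> - l..\<beta> + l}. Lp_pow p (\<lambda>x. g' s x t) \<partial>lborel)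
      \<le> ennreal E * (\<Sum>a\<in>?D s. Lp_pow p (trig Z (\<lambda>n. (2 * pi * \<i> * \<theta> s a n) * c a n)))"
      unfolding norm_g' E_def
      by (rule Suc.hyps(1)[OF d _ child_in_points[OF Suc.prems(2) s] le]) (use mk in simp)
    also have "\<dots> \<le> ennreal E * (\<Sum>a\<in>?D s. ennreal ((8 * pi / l) powr p) * Lp_pow p (trig Z (c a)))"
    proof (intro mult_left_mono sum_mono)
      fix a assume a: "a \<in> ?D s"
      have "8 * pi * (\<bar>of_int \<xi>\<bar> / real N ^ Suc m) = 8 * pi / l" by (simp add: l(2))
      with frequency_multiplier_bound[OF Z r rN Suc.prems(2) s a]
      have "multiplier_bound p Z (\<lambda>n. 2 * pi * \<i> * \<theta> s a n) (8 * pi / l)"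
        by (simp add: \<theta>_def \<kappa>_def)
      then show "Lp_pow p (trig Z (\<lambda>n. (2 * pi * \<i> * \<theta> s a n) * c a n)) \<le> ennreal ((8 * pi / l) powr p) * Lp_pow p (trig Z (c a))"
        by (rule multiplier_boundD)
    qed auto
    finally show ?thesis by (simp only: sum_distrib_left)
  qed
  have step: "(\<integral>\<^sup>+t\<in>{\<alpha>..\<beta>}. Lp_pow p (\<lambda>x. \<Sum>s\<in>S m b. g s x t * echar (\<kappa> * real s * t)) \<partial>lborel)
    \<le> ennreal (2 powr (p - 1)) * (ennreal (C powr p * real (card (S m b)) powr (p / 2 - 1)) *
       (\<Sum>s\<in>S m b. (\<integral>\<^sup>+t\<in>{\<alpha> - l..\<beta> + l}. Lp_pow p (\<lambda>x. g s x t) \<partial>lborel)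
          + ennreal (l powr p) * (\<integral>\<^sup>+t\<in>{\<alpha> - l..\<beta> + l}. Lp_pow p (\<lambda>x. g' s x t) \<partial>lborel)))"
    unfolding l_def
  proof (rule Lambda_p_set_decouple[OF p C S[OF Suc.prems(2)] \<kappa>])
    show "case_prod (g s) \<in> borel_measurable (borel \<Otimes>\<^sub>M borel)" for s
      unfolding g_def by measurable
    show "case_prod (g' s) \<in> borel_measurable (borel \<Otimes>\<^sub>M borel)" for s
      unfolding g'_def by measurable
    show "(g s x has_vector_derivative g' s x t) (at t)" for s x t
      unfolding g_def[abs_def] g'_def
      by (intro has_vector_derivative_sum has_vector_derivative_mult_right echar_has_vector_derivative)
    show "continuous_on UNIV (g' s x)" for s x
      unfolding g'_def[abs_def] by (intro continuous_intros)
  qed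
  also have "\<dots> \<le> ennreal (2 powr (p - 1)) * (ennreal (C powr p * real (card (S m b)) powr (p / 2 - 1)) *
       (\<Sum>s\<in>S m b. ennreal E * ?L s + ennreal (l powr p) * (ennreal E * (ennreal ((8 * pi / l) powr p) * ?L s))))"
    by (intro mult_left_mono sum_mono add_mono IH1 IH2) auto
  also have "(\<Sum>s\<in>S m b. ennreal E * ?L s + ennreal (l powr p) * (ennreal E * (ennreal ((8 * pi / l) powr p) * ?L s)))
     = ennreal (1 + (8 * pi) powr p) * (ennreal E * (\<Sum>s\<in>S m b. ?L s))"
  proof -
    have "ennreal (l powr p) * ennreal ((8 * pi / l) powr p) = ennreal ((8 * pi) powr p)"
      using l(1) by (simp add: ennreal_mult'[symmetric] powr_mult[symmetric])
    then have AB: "1 + ennreal (l powr p) * ennreal ((8 * pi / l) powr p) = ennreal (1 + (8 * pi) powr p)"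
      by (simp only:) simp
    have "ennreal E * X + ennreal (l powr p) * (ennreal E * (ennreal ((8 * pi / l) powr p) * X))
       = (1 + ennreal (l powr p) * ennreal ((8 * pi / l) powr p)) * (ennreal E * X)" for X
      unfolding distrib_right mult_1_left by (simp only: mult_ac)
    then have "ennreal E * X + ennreal (l powr p) * (ennreal E * (ennreal ((8 * pi / l) powr p) * X))
       = ennreal (1 + (8 * pi) powr p) * (ennreal E * X)" for X
      by (simp only: AB)
    then show ?thesis by (simp only: sum_distrib_left[of _ _ "S m b", symmetric])
  qed
  also have "(\<Sum>s\<in>S m b. ?L s) = (\<Sum>a\<in>descendants (j - m) m b. Lp_pow p (trig Z (c a)))"
    unfolding jm by (rule sum_descendants_Suc[OF Suc.prems(2), symmetric])
  also have "ennreal (2 powr (p - 1)) * (ennreal (C powr p * real (card (S m b)) powr (p / 2 - 1)) *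
     (ennreal (1 + (8 * pi) powr p) * (ennreal E * X))) = ennreal (decoupling_const * E) * X" for X
    unfolding card_S[OF Suc.prems(2)] decoupling_const_def
    by (simp add: ennreal_mult' mult.assoc[symmetric] del: ennreal_plus)
  also have "ennreal (decoupling_const * E) * X \<le> ennreal (decoupling_const ^ (k - m) * real N0 powr (real (j - k) * (p - 1))
             * (\<beta> - \<alpha> + 4 * (real N ^ k - real N ^ m) / \<bar>of_int \<xi>\<bar>)) * X" for X
  proof (intro mult_right_mono ennreal_leI)
    \<comment> \<open>The constant 4 is fixed here:
      \<open>2 * N ^ Suc m \<le> 4 * (N ^ Suc m - N ^ m)\<close> because
      \<open>N \<ge> 2\<close>.\<close>
    have "2 * l + 4 * (real N ^ k - real N ^ Suc m) / \<bar>of_int \<xi>\<bar> \<le> 4 * (real N ^ k - real N ^ m) / \<bar>of_int \<xi>\<bar>"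
    proof -
      have "2 * real N ^ m \<le> real N * real N ^ m" using N by (intro mult_right_mono) auto
      then have "2 * real N ^ Suc m + 4 * (real N ^ k - real N ^ Suc m) \<le> 4 * (real N ^ k - real N ^ m)" by simp
      then have "(2 * real N ^ Suc m + 4 * (real N ^ k - real N ^ Suc m)) / \<bar>of_int \<xi>\<bar> \<le> 4 * (real N ^ k - real N ^ m) / \<bar>of_int \<xi>\<bar>"
        by (intro divide_right_mono) auto
      then show ?thesis by (simp only: l(2) add_divide_distrib times_divide_eq_right)
    qed
    then have "\<beta> + l - (\<alpha> - l) + 4 * (real N ^ k - real N ^ Suc m) / \<bar>of_int \<xi>\<bar> \<le> \<beta> - \<alpha> + 4 * (real N ^ k - real N ^ m) / \<bar>of_int \<xi>\<bar>"
      by linarith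
    moreover have "decoupling_const ^ (k - m) = decoupling_const * decoupling_const ^ (k - Suc m)"
      using mk by (simp add: Suc_diff_Suc flip: power_Suc)
    ultimately show "decoupling_const * E \<le> decoupling_const ^ (k - m) * real N0 powr (real (j - k) * (p - 1))
             * (\<beta> - \<alpha> + 4 * (real N ^ k - real N ^ m) / \<bar>of_int \<xi>\<bar>)"
      unfolding E_def mult.assoc[symmetric] using decoupling_const_nonneg
      by (simp only:) (intro mult_left_mono mult_nonneg_nonneg zero_le_power; simp)
  qed simp
  finally show ?case unfolding norm_sum .
qed

end

subsection \<open>Maximal estimates for frequency-localised pieces\<close>

text \<open>Sobolev embedding at scale \<open>\<rho>\<close>: the inequality with base point
  \<open>t\<close> in \<open>{t0..t0 + \<rho>}\<close>, run backwards to \<open>t0\<close>, is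
  averaged over \<open>t\<close>. The integrals on the right are over a fixed interval, so one bound
  serves all admissible \<open>t0\<close>.\<close>

lemma powr_norm_le_local_average:
  fixes F F' :: "real \<Rightarrow> complex"
  assumes p: "1 \<le> p" and \<rho>: "0 < \<rho>" and ab: "a \<le> t0 - \<rho>" "t0 + \<rho> \<le> b"
    and F: "\<And>t. (F has_vector_derivative F' t) (at t)" and F': "continuous_on UNIV F'"
  shows "ennreal \<rho> * ennreal (norm (F t0) powr p) \<le> ennreal (2 powr (p - 1)) *
     ((\<integral>\<^sup>+t\<in>{a..b}. ennreal (norm (F t) powr p) \<partial>lborel)
       + ennreal (\<rho> powr p) * (\<integral>\<^sup>+t\<in>{a..b}. ennreal (norm (F' t) powr p) \<partial>lborel))"
proof -
  let ?J = "\<integral>\<^sup>+t\<in>{a..b}. ennreal (norm (F' t) powr p) \<partial>lborel"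
  have [measurable]: "F \<in> borel_measurable borel" "F' \<in> borel_measurable borel"
    by (intro borel_measurable_continuous_onI F' continuous_at_imp_continuous_on ballI has_vector_derivative_continuous[OF F])+
  have pw: "ennreal (norm (F t0) powr p) \<le> ennreal (2 powr (p - 1)) * (ennreal (norm (F t) powr p) + ennreal (\<rho> powr (p - 1)) * ?J)"
    if t: "t \<in> {t0..t0 + \<rho>}" for t
  proof -
    have "((\<lambda>w. F (t - w)) has_vector_derivative - F' (t - w)) (at w)" for w
    proof -
      have "((\<lambda>w. t - w) has_vector_derivative - 1) (at w)"
        by (auto intro!: derivative_eq_intros)
      from vector_diff_chain_at[OF this F] show ?thesis by (simp add: o_def)
    qed
    moreover have "continuous_on UNIV (\<lambda>w. - F' (t - w))"
      by (intro continuous_intros continuous_on_compose2[OF F']) auto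
    ultimately have "ennreal (norm (F (t - (t - t0))) powr p) \<le> ennreal (2 powr (p - 1)) *
      (ennreal (norm (F (t - 0)) powr p) + ennreal (\<rho> powr (p - 1)) * (\<integral>\<^sup>+w\<in>{0..\<rho>}. ennreal (norm (- F' (t - w)) powr p) \<partial>lborel))"
      using t by (intro powr_norm_le_base_plus_deriv p \<rho>) auto
    also have "(\<integral>\<^sup>+w\<in>{0..\<rho>}. ennreal (norm (- F' (t - w)) powr p) \<partial>lborel) \<le> ?J"
    proof -
      have "?J = ennreal \<bar>- 1\<bar> * (\<integral>\<^sup>+w. ennreal (norm (F' (t + - 1 * w)) powr p) * indicator {a..b} (t + - 1 * w) \<partial>lborel)"
        by (rule nn_integral_real_affine) auto
      also have "\<dots> \<ge> (\<integral>\<^sup>+w\<in>{0..\<rho>}. ennreal (norm (- F' (t - w)) powr p) \<partial>lborel)"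
        using t ab by (auto intro!: nn_integral_mono split: split_indicator)
      finally show ?thesis .
    qed
    finally show ?thesis by (simp add: mult_left_mono add_left_mono)
  qed
  have "ennreal \<rho> * ennreal (norm (F t0) powr p) = (\<integral>\<^sup>+t\<in>{t0..t0 + \<rho>}. ennreal (norm (F t0) powr p) \<partial>lborel)"
    using \<rho> by (subst nn_integral_cmult_indicator) (auto simp: mult.commute)
  also have "\<dots> \<le> (\<integral>\<^sup>+t\<in>{t0..t0 + \<rho>}. ennreal (2 powr (p - 1)) * (ennreal (norm (F t) powr p) + ennreal (\<rho> powr (p - 1)) * ?J) \<partial>lborel)"
    by (intro set_nn_integral_mono' pw)
  also have "\<dots> = ennreal (2 powr (p - 1)) * ((\<integral>\<^sup>+t\<in>{t0..t0 + \<rho>}. ennreal (norm (F t) powr p) \<partial>lborel)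
      + (\<integral>\<^sup>+t\<in>{t0..t0 + \<rho>}. ennreal (\<rho> powr (p - 1)) * ?J \<partial>lborel))"
    by (subst set_nn_integral_cmult', measurable, subst set_nn_integral_add') simp_all
  also have "(\<integral>\<^sup>+t\<in>{t0..t0 + \<rho>}. ennreal (\<rho> powr (p - 1)) * ?J \<partial>lborel) = ennreal (\<rho> powr p) * ?J"
    using \<rho> by (subst nn_integral_cmult_indicator) (auto simp: powr_diff mult_ac ennreal_mult'[symmetric] mult.assoc[symmetric])
  also have "(\<integral>\<^sup>+t\<in>{t0..t0 + \<rho>}. ennreal (norm (F t) powr p) \<partial>lborel) \<le> (\<integral>\<^sup>+t\<in>{a..b}. ennreal (norm (F t) powr p) \<partial>lborel)"
    using ab \<rho> by (intro nn_integral_mono) (auto split: split_indicator)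
  finally show ?thesis by (simp add: mult_left_mono add_right_mono)
qed

text \<open>Loss of a decoupled level after \<open>N0 powr (- p / 2)\<close> has been replaced by
  \<open>c0 powr (- p / 2) / N\<close>. It must be free of \<open>N\<close>, since its
  \<open>j\<close>-th power has to be absorbed in \<open>N powr (j * \<delta> / 2)\<close>.\<close>

definition loss_base :: "real \<Rightarrow> real \<Rightarrow> real \<Rightarrow> real" where
  "loss_base p c0 C = 2 powr (p - 1) * C powr p * (1 + (8 * pi) powr p) * c0 powr (- p / 2)"

lemma loss_base_nonneg: "0 \<le> loss_base p c0 C"
  by (simp add: loss_base_def)

text \<open>\<open>T + 6\<close> bounds the widened \<open>t\<close>-interval, and
  \<open>16 * pi * N\<^sup>2\<close> the derivative in \<open>t\<close> measured in units of
  \<open>N ^ k\<close>. Dependence on \<open>N\<close> is harmless, as no \<open>j\<close>-th power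
  of this is taken.\<close>

definition piece_const :: "real \<Rightarrow> nat \<Rightarrow> real \<Rightarrow> real" where
  "piece_const p N T = 2 powr (p - 1) * ((T + 6) * (1 + (16 * pi * (real N)\<^sup>2) powr p))"

context cantor_tree
begin

text \<open>The exponents of \<open>N0\<close> are \<open>- j * p\<close> from the normalisation,
  \<open>k * (p / 2 - 1)\<close> from decoupled levels, \<open>(j - k) * (p - 1)\<close> from the
  others and \<open>j\<close> from the number of points; they add up to \<open>- k * p / 2\<close>.
  Then the lower bound in (b) turns \<open>N0\<close> into \<open>N\<close>.\<close>

lemma decoupling_total_const_le:
  assumes c0: "0 < c0" and kj: "k \<le> j"
  shows "(1 / real N0 ^ j) powr p * (decoupling_const ^ k * real N0 powr (real (j - k) * (p - 1))) * real N0 ^ j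
    \<le> loss_base p c0 C ^ k * (1 / real N ^ k)"
proof -
  define n where "n = real N0"
  have n: "0 < n" using N0 by (simp add: n_def)
  define A where "A = 2 powr (p - 1) * C powr p * (1 + (8 * pi) powr p)"
  have A: "0 \<le> A" by (simp add: A_def)
  have Q: "decoupling_const = A * n powr (p / 2 - 1)"
    by (simp add: decoupling_const_def A_def n_def mult_ac)
  have "(1 / n ^ j) powr p * (decoupling_const ^ k * n powr (real (j - k) * (p - 1))) * n ^ j
     = A ^ k * (n powr (- real j * p) * n powr (real k * (p / 2 - 1)) * n powr (real (j - k) * (p - 1)) * n powr real j)"
  proof -
    have "(1 / n ^ j) powr p = n powr (- real j * p)"
      using n by (simp add: powr_divide powr_minus_divide powr_powr flip: powr_realpow)
    moreover have "decoupling_const ^ k = A ^ k * n powr (real k * (p / 2 - 1))"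
      unfolding Q power_mult_distrib using n by (simp add: powr_powr mult.commute flip: powr_realpow)
    moreover have "n ^ j = n powr real j" using n by (simp add: powr_realpow)
    ultimately show ?thesis by (simp only: mult_ac)
  qed
  also have "\<dots> = A ^ k * n powr (- real j * p + real k * (p / 2 - 1) + real (j - k) * (p - 1) + real j)"
    by (simp only: powr_add)
  also have "- real j * p + real k * (p / 2 - 1) + real (j - k) * (p - 1) + real j = (- p / 2) * real k"
    using kj by (simp add: of_nat_diff field_simps)
  also have "n powr ((- p / 2) * real k) = (n powr (- p / 2)) ^ k"
    using n by (simp add: powr_powr flip: powr_realpow)
  also have "\<dots> \<le> (c0 powr (- p / 2) * (1 / real N)) ^ k"
  proof (rule power_mono)
    have "c0 * real N powr (2 / p) \<le> n"
      using S[of 1 0] card_S[of 1 0] unfolding Lambda_p_set_def n_def by simp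
    then have "n powr (- p / 2) \<le> (c0 * real N powr (2 / p)) powr (- p / 2)"
      using c0 N p by (intro powr_mono2') auto
    also have "\<dots> = c0 powr (- p / 2) * (1 / real N)"
      using c0 N p by (simp add: powr_mult powr_powr powr_minus_divide)
    finally show "n powr (- p / 2) \<le> c0 powr (- p / 2) * (1 / real N)" .
  qed simp
  also have "A ^ k * (c0 powr (- p / 2) * (1 / real N)) ^ k = loss_base p c0 C ^ k * (1 / real N ^ k)"
    by (simp add: loss_base_def A_def power_mult_distrib power_divide)
  finally show ?thesis using A unfolding n_def by (simp add: mult_left_mono)
qed

lemma root_in_points: "1 \<in> cantor_points N S 0"
  by simp

text \<open>The coefficients may depend on \<open>a\<close> because differentiation in
  \<open>t\<close> multiplies them by \<open>n * a\<close>. The interval has length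
  \<open>T + 2\<close> and is widened by at most 4, since
  \<open>N ^ k \<le> \<bar>\<xi>\<bar>\<close>.\<close>

lemma global_decoupling:
  fixes \<xi> :: int and r k j :: nat
  assumes Z: "finite Z" "\<And>n. n \<in> Z \<Longrightarrow> \<bar>n - \<xi>\<bar> \<le> int r" and r: "0 < r" and kj: "k \<le> j"
    and k: "0 < k \<Longrightarrow> real r * real N \<le> \<bar>of_int \<xi>\<bar>" "0 < k \<Longrightarrow> real N ^ k \<le> \<bar>of_int \<xi>\<bar>"
    and c0: "0 < c0" and T: "0 \<le> T"
    and c: "\<And>a. a \<in> descendants j 0 1 \<Longrightarrow> Lp_pow p (trig Z (c a)) \<le> L"
  shows "(\<integral>\<^sup>+t\<in>{-1..T+1}. Lp_pow p (\<lambda>x. (1 / of_nat N0 ^ j) * (\<Sum>a\<in>descendants j 0 1. trig Z (c a) (x + t * a))) \<partial>lborel)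
    \<le> ennreal (loss_base p c0 C ^ k * (1 / real N ^ k) * (T + 6)) * L"
proof -
  let ?D = "descendants j 0 1"
  let ?q = "(1 / real N0 ^ j) powr p"
  let ?K = "decoupling_const ^ k * real N0 powr (real (j - k) * (p - 1))"
  have [measurable]: "(\<lambda>t. Lp_pow p (\<lambda>x. \<Sum>a\<in>?D. trig Z (c a) (x + t * a))) \<in> borel_measurable borel"
    by measurable
  have norm_q: "norm (1 / of_nat N0 ^ j :: complex) = 1 / real N0 ^ j" by (simp add: norm_divide norm_power)
  have "(\<integral>\<^sup>+t\<in>{-1..T+1}. Lp_pow p (\<lambda>x. (1 / of_nat N0 ^ j) * (\<Sum>a\<in>?D. trig Z (c a) (x + t * a))) \<partial>lborel)
    = (\<integral>\<^sup>+t\<in>{-1..T+1}. ennreal ?q * Lp_pow p (\<lambda>x. \<Sum>a\<in>?D. trig Z (c a) (x + t * a)) \<partial>lborel)"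
    by (subst Lp_pow_cmult) (simp_all add: norm_q)
  also have "\<dots> = ennreal ?q * (\<integral>\<^sup>+t\<in>{-1..T+1}. Lp_pow p (\<lambda>x. \<Sum>a\<in>?D. trig Z (c a) (x + t * a)) \<partial>lborel)"
    by (rule set_nn_integral_cmult') measurable
  also have "\<dots> \<le> ennreal ?q * (ennreal (?K * (T + 6)) * (\<Sum>a\<in>?D. L))"
  proof (intro mult_left_mono)
    have "1 \<le> real N ^ k" using N by simp
    then have nn: "0 \<le> (4 * real N ^ k - 4) / \<bar>of_int \<xi>\<bar>" by simp
    have "(\<integral>\<^sup>+t\<in>{-1..T+1}. Lp_pow p (\<lambda>x. \<Sum>a\<in>?D. trig Z (c a) (x + t * a)) \<partial>lborel)
      \<le> ennreal (?K * (T + 1 - (-1) + 4 * (real N ^ k - real N ^ 0) / \<bar>of_int \<xi>\<bar>)) * (\<Sum>a\<in>?D. Lp_pow p (trig Z (c a)))"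
      using decoupling[OF Z r kj k(1), where m = 0 and b = 1 and \<alpha> = "-1" and \<beta> = "T + 1" and c = c] T by simp
    also have "\<dots> \<le> ennreal (?K * (T + 6)) * (\<Sum>a\<in>?D. L)"
    proof (intro mult_mono ennreal_leI sum_mono c)
      have "4 * (real N ^ k - real N ^ 0) / \<bar>of_int \<xi>\<bar> \<le> 4"
      proof (cases "k = 0")
        case False
        then have "0 < \<bar>real_of_int \<xi>\<bar>" using k(2) N by (smt (verit) zero_less_power of_nat_0_less_iff bot_nat_0.not_eq_extremum not_numeral_le_zero)
        then show ?thesis using k(2) False by (simp add: divide_le_eq)
      qed simp
      then show "T + 1 - (-1) + 4 * (real N ^ k - real N ^ 0) / \<bar>of_int \<xi>\<bar> \<le> T + 6" by linarith
    qed (use T nn decoupling_const_nonneg in auto)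
    finally show "(\<integral>\<^sup>+t\<in>{-1..T+1}. Lp_pow p (\<lambda>x. \<Sum>a\<in>?D. trig Z (c a) (x + t * a)) \<partial>lborel)
      \<le> ennreal (?K * (T + 6)) * (\<Sum>a\<in>?D. L)" .
  qed simp
  also have "\<dots> = ennreal (?q * ?K * real N0 ^ j * (T + 6)) * L"
  proof -
    have "(\<Sum>a\<in>?D. L) = ennreal (real N0 ^ j) * L"
      by (simp add: card_descendants[OF root_in_points] ennreal_of_nat_eq_real_of_nat flip: of_nat_power)
    moreover have "?q * ?K * real N0 ^ j * (T + 6) = ?q * (?K * (T + 6) * real N0 ^ j)" by simp
    moreover have "0 \<le> ?K * (T + 6)" using T decoupling_const_nonneg by simp
    moreover have "ennreal A * (ennreal B * (ennreal D * L)) = ennreal (A * (B * D)) * L"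
      if "0 \<le> A" "0 \<le> B" "0 \<le> D" for A B D
      using that by (simp add: ennreal_mult mult.assoc)
    ultimately show ?thesis by (simp only: powr_ge_zero zero_le_power of_nat_0_le_iff)
  qed
  also have "\<dots> \<le> ennreal (loss_base p c0 C ^ k * (1 / real N ^ k) * (T + 6)) * L"
    using decoupling_total_const_le[OF c0 kj] T by (intro mult_right_mono ennreal_leI) auto
  finally show ?thesis .
qed

end

lemma trig_has_vector_derivative:
  "((\<lambda>t. trig Z c (x + t * a)) has_vector_derivative
     trig Z (\<lambda>n. (2 * pi * \<i> * (of_int n * complex_of_real a)) * c n) (x + t * a)) (at t)"
proof -
  have "((\<lambda>t. \<Sum>n\<in>Z. c n * echar ((of_int n * a) * t + of_int n * x)) has_vector_derivative
     (\<Sum>n\<in>Z. c n * (2 * pi * \<i> * of_real (of_int n * a) * echar ((of_int n * a) * t + of_int n * x)))) (at t)"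
    by (intro has_vector_derivative_sum has_vector_derivative_mult_right echar_has_vector_derivative)
  moreover have "(\<Sum>n\<in>Z. c n * echar ((of_int n * a) * t + of_int n * x)) = trig Z c (x + t * a)" for t
    unfolding trig_def by (simp add: algebra_simps)
  moreover have "(\<Sum>n\<in>Z. c n * (2 * pi * \<i> * of_real (of_int n * a) * echar ((of_int n * a) * t + of_int n * x)))
     = trig Z (\<lambda>n. (2 * pi * \<i> * (of_int n * complex_of_real a)) * c n) (x + t * a)"
    unfolding trig_def by (intro sum.cong refl) (simp add: algebra_simps)
  ultimately show ?thesis by simp
qed

text \<open>In the splitting \<open>n = (n - \<xi>) + \<xi>\<close> both parts have norm at most
  \<open>L\<close>.\<close>

lemma derivative_multiplier_bound:
  fixes \<xi> :: int
  assumes p: "1 \<le> p" and Z: "finite Z" "\<And>n. n \<in> Z \<Longrightarrow> \<bar>n - \<xi>\<bar> \<le> int r" and r: "0 < r"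
    and L: "2 * real r \<le> L" "\<bar>of_int \<xi>\<bar> \<le> L" and a: "\<bar>a\<bar> \<le> 2"
  shows "multiplier_bound p Z (\<lambda>n. 2 * pi * \<i> * (of_int n * complex_of_real a)) (8 * pi * L)"
proof -
  have L0: "0 \<le> L" using L by linarith
  have 1: "multiplier_bound p Z (\<lambda>n. of_int (n - \<xi>)) L"
    by (rule multiplier_bound_mono[OF multiplier_bound_shifted_id[OF p Z(1) r Z(2)]]) (use L p in auto)
  have 2: "multiplier_bound p Z (\<lambda>n. of_int \<xi>) L"
    by (rule multiplier_bound_mono[OF multiplier_bound_const]) (use L p in auto)
  have 3: "multiplier_bound p Z (\<lambda>n. of_int (n - \<xi>) + of_int \<xi>) (2 * L)"
    by (rule multiplier_bound_add[OF p 1 2 L0])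
  have "norm (2 * pi * \<i> * complex_of_real a) \<le> 4 * pi" using a by (simp add: norm_mult)
  then have 4: "multiplier_bound p Z (\<lambda>n. 2 * pi * \<i> * complex_of_real a) (4 * pi)"
    by (rule multiplier_bound_mono[OF multiplier_bound_const, rotated]) (use p in auto)
  have "multiplier_bound p Z (\<lambda>n. (2 * pi * \<i> * complex_of_real a) * (of_int (n - \<xi>) + of_int \<xi>)) (4 * pi * (2 * L))"
    by (rule multiplier_bound_mult[OF 4 3]) (use L0 in auto)
  moreover have "4 * pi * (2 * L) = 8 * pi * L" by simp
  ultimately show ?thesis by (auto intro: multiplier_bound_cong)
qed

context cantor_tree
begin

text \<open>A maximal estimate in which the dilation factor is an arbitrary function of the cell.
  The Sobolev step at scale \<open>1 / N ^ k\<close> costs \<open>N ^ k\<close>, which is exactly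
  the gain of the decoupling.\<close>

lemma piece_estimate:
  fixes \<xi> :: int and r k j M :: nat and \<tau> :: "nat \<Rightarrow> real"
  assumes Z: "finite Z" "\<And>n. n \<in> Z \<Longrightarrow> \<bar>n - \<xi>\<bar> \<le> int r" and r: "0 < r" and kj: "k \<le> j"
    and k: "0 < k \<Longrightarrow> real r * real N \<le> \<bar>of_int \<xi>\<bar>" "0 < k \<Longrightarrow> real N ^ k \<le> \<bar>of_int \<xi>\<bar>"
    and c0: "0 < c0" and T: "0 \<le> T"
    and L: "2 * real r \<le> 2 * real N ^ (k + 2)" "\<bar>of_int \<xi>\<bar> \<le> 2 * real N ^ (k + 2)"
    and M: "0 < M" and Q: "Q \<subseteq> {..<M}" and \<tau>: "\<And>q. q \<in> Q \<Longrightarrow> 0 \<le> \<tau> q \<and> \<tau> q \<le> T"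
  shows "(\<Sum>q\<in>Q. (\<integral>\<^sup>+x\<in>{real q / real M..<(real q + 1) / real M}.
        ennreal (norm ((1 / of_nat N0 ^ j) * (\<Sum>a\<in>descendants j 0 1. trig Z c (x + \<tau> q * a))) powr p) \<partial>lborel))
     \<le> ennreal (piece_const p N T * loss_base p c0 C ^ k) * Lp_pow p (trig Z c)"
proof -
  let ?D = "descendants j 0 1"
  let ?I = "{-1..T + 1}"
  let ?c = "ennreal (2 powr (p - 1))"
  define w where "w = (1 / of_nat N0 ^ j :: complex)"
  define G where "G x t = w * (\<Sum>a\<in>?D. trig Z c (x + t * a))" for x t
  define G' where "G' x t = w * (\<Sum>a\<in>?D. trig Z (\<lambda>n. (2 * pi * \<i> * (of_int n * complex_of_real a)) * c n) (x + t * a))" for x t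
  have mG[measurable]: "case_prod G \<in> borel_measurable (borel \<Otimes>\<^sub>M borel)" unfolding G_def by measurable
  have mG'[measurable]: "case_prod G' \<in> borel_measurable (borel \<Otimes>\<^sub>M borel)" unfolding G'_def by measurable
  have der: "(G x has_vector_derivative G' x t) (at t)" for x t
    unfolding G_def[abs_def] G'_def
    by (intro has_vector_derivative_mult_right has_vector_derivative_sum trig_has_vector_derivative)
  have cont: "continuous_on UNIV (G' x)" for x
    unfolding G'_def[abs_def] by (intro continuous_intros)
  \<comment> \<open>\<open>\<rho> \<le> 1\<close> keeps \<open>{t0 - \<rho>..t0 + \<rho>}\<close>
    inside \<open>{-1..T + 1}\<close>.\<close>
  define \<rho> where "\<rho> = 1 / real N ^ k"
  have \<rho>: "0 < \<rho>" "\<rho> \<le> 1" using N by (auto simp: \<rho>_def)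
  define W where "W x = ?c * ((\<integral>\<^sup>+t\<in>?I. ennreal (norm (G x t) powr p) \<partial>lborel)
       + ennreal (\<rho> powr p) * (\<integral>\<^sup>+t\<in>?I. ennreal (norm (G' x t) powr p) \<partial>lborel))" for x
  have [measurable]: "W \<in> borel_measurable borel" unfolding W_def by measurable
  have W: "ennreal \<rho> * ennreal (norm (G x t0) powr p) \<le> W x" if "0 \<le> t0" "t0 \<le> T" for x t0
    unfolding W_def by (rule powr_norm_le_local_average) (use p \<rho> that der cont in auto)
  let ?cell = "\<lambda>q. {real q / real M..<(real q + 1) / real M}"
  have disj: "disjoint_family_on ?cell Q"
    unfolding disjoint_family_on_def
  proof (intro ballI impI)
    have *: "?cell q \<inter> ?cell q' = {}" if "q < q'" for q q'
    proof -
      have "(real q + 1) / real M \<le> real q' / real M" using that M by (intro divide_right_mono) auto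
      then show ?thesis by auto
    qed
    show "?cell q \<inter> ?cell q' = {}" if "q \<noteq> q'" for q q'
      using *[of q q'] *[of q' q] that by (metis Int_commute linorder_neqE_nat)
  qed
  have finQ: "finite Q" using Q finite_subset by blast
  have sub: "(\<Union>q\<in>Q. ?cell q) \<subseteq> {0..1}"
  proof (intro UN_least subsetI)
    fix q x assume q: "q \<in> Q" and x: "x \<in> ?cell q"
    have "(real q + 1) / real M \<le> 1" using q Q M by (auto simp: divide_le_eq)
    moreover have "0 \<le> real q / real M" by simp
    moreover have "real q / real M \<le> x" "x < (real q + 1) / real M" using x by auto
    ultimately show "x \<in> {0..1}" unfolding atLeastAtMost_iff by linarith
  qed
  have "ennreal \<rho> * (\<Sum>q\<in>Q. (\<integral>\<^sup>+x\<in>?cell q. ennreal (norm (G x (\<tau> q)) powr p) \<partial>lborel))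
     = (\<Sum>q\<in>Q. (\<integral>\<^sup>+x\<in>?cell q. ennreal \<rho> * ennreal (norm (G x (\<tau> q)) powr p) \<partial>lborel))"
    unfolding sum_distrib_left by (intro sum.cong refl set_nn_integral_cmult'[symmetric]) measurable
  also have "\<dots> \<le> (\<Sum>q\<in>Q. (\<integral>\<^sup>+x\<in>?cell q. W x \<partial>lborel))"
    by (intro sum_mono set_nn_integral_mono' W) (use \<tau> in auto)
  also have "\<dots> = (\<integral>\<^sup>+x\<in>(\<Union>q\<in>Q. ?cell q). W x \<partial>lborel)"
    by (subst nn_integral_sum[symmetric])
      (simp_all add: indicator_UN_disjoint[OF finQ disj] sum_distrib_left)
  also have "\<dots> \<le> (\<integral>\<^sup>+x\<in>{0..1}. W x \<partial>lborel)"
  proof (rule nn_integral_mono)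
    fix x
    show "W x * indicator (\<Union>q\<in>Q. ?cell q) x \<le> W x * indicator {0..1} x"
      using subsetD[OF sub, of x] by (cases "x \<in> (\<Union>q\<in>Q. ?cell q)") simp_all
  qed
  also have "\<dots> = ?c * ((\<integral>\<^sup>+x\<in>{0..1}. (\<integral>\<^sup>+t\<in>?I. ennreal (norm (G x t) powr p) \<partial>lborel) \<partial>lborel)
       + ennreal (\<rho> powr p) * (\<integral>\<^sup>+x\<in>{0..1}. (\<integral>\<^sup>+t\<in>?I. ennreal (norm (G' x t) powr p) \<partial>lborel) \<partial>lborel))"
    unfolding W_def by (simp add: set_nn_integral_cmult' set_nn_integral_add')
  also have "(\<integral>\<^sup>+x\<in>{0..1}. (\<integral>\<^sup>+t\<in>?I. ennreal (norm (G' x t) powr p) \<partial>lborel) \<partial>lborel) = (\<integral>\<^sup>+t\<in>?I. Lp_pow p (\<lambda>x. G' x t) \<partial>lborel)"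
    unfolding Lp_pow_def by (rule set_nn_integral_swap) measurable
  also have "(\<integral>\<^sup>+x\<in>{0..1}. (\<integral>\<^sup>+t\<in>?I. ennreal (norm (G x t) powr p) \<partial>lborel) \<partial>lborel) = (\<integral>\<^sup>+t\<in>?I. Lp_pow p (\<lambda>x. G x t) \<partial>lborel)"
    unfolding Lp_pow_def by (rule set_nn_integral_swap) measurable
  finally have 1: "ennreal \<rho> * (\<Sum>q\<in>Q. (\<integral>\<^sup>+x\<in>?cell q. ennreal (norm (G x (\<tau> q)) powr p) \<partial>lborel))
     \<le> ?c * ((\<integral>\<^sup>+t\<in>?I. Lp_pow p (\<lambda>x. G x t) \<partial>lborel) + ennreal (\<rho> powr p) * (\<integral>\<^sup>+t\<in>?I. Lp_pow p (\<lambda>x. G' x t) \<partial>lborel))" .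
  define E where "E = loss_base p c0 C ^ k * (1 / real N ^ k) * (T + 6)"
  have E0: "0 \<le> E" using T by (simp add: E_def loss_base_nonneg)
  let ?L = "Lp_pow p (trig Z c)"
  have 2: "(\<integral>\<^sup>+t\<in>?I. Lp_pow p (\<lambda>x. G x t) \<partial>lborel) \<le> ennreal E * ?L"
    unfolding G_def w_def E_def by (rule global_decoupling[OF Z r kj k c0 T]) auto
  let ?B = "8 * pi * (2 * real N ^ (k + 2))"
  have 3: "(\<integral>\<^sup>+t\<in>?I. Lp_pow p (\<lambda>x. G' x t) \<partial>lborel) \<le> ennreal E * (ennreal (?B powr p) * ?L)"
    unfolding G'_def w_def E_def
  proof (rule global_decoupling[OF Z r kj k c0 T])
    fix a assume "a \<in> ?D"
    then have "\<bar>a\<bar> \<le> 2" using descendants_range[OF root_in_points, of a j] by auto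
    then show "Lp_pow p (trig Z (\<lambda>n. (2 * pi * \<i> * (of_int n * complex_of_real a)) * c n)) \<le> ennreal (?B powr p) * ?L"
      using p by (intro multiplier_boundD derivative_multiplier_bound[OF _ Z r L]) auto
  qed
  have "\<rho> * ?B = 16 * pi * (real N)\<^sup>2" using N by (simp add: \<rho>_def power_add power2_eq_square)
  then have B: "\<rho> powr p * ?B powr p = (16 * pi * (real N)\<^sup>2) powr p"
    by (simp only: powr_mult[of \<rho> ?B, symmetric])
  have "ennreal \<rho> * (\<Sum>q\<in>Q. (\<integral>\<^sup>+x\<in>?cell q. ennreal (norm (G x (\<tau> q)) powr p) \<partial>lborel))
     \<le> ?c * (ennreal E * ?L + ennreal (\<rho> powr p) * (ennreal E * (ennreal (?B powr p) * ?L)))"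
    by (rule order_trans[OF 1]) (intro mult_left_mono add_mono 2 3 zero_le)
  also have "ennreal E * ?L + ennreal (\<rho> powr p) * (ennreal E * (ennreal (?B powr p) * ?L))
     = (1 + ennreal (\<rho> powr p) * ennreal (?B powr p)) * (ennreal E * ?L)"
    unfolding distrib_right mult_1_left by (simp only: mult_ac)
  also have "1 + ennreal (\<rho> powr p) * ennreal (?B powr p) = ennreal (1 + (16 * pi * (real N)\<^sup>2) powr p)"
    using B by (simp add: ennreal_mult'[symmetric])
  also have "?c * (ennreal (1 + (16 * pi * (real N)\<^sup>2) powr p) * (ennreal E * ?L))
     = ennreal (2 powr (p - 1) * ((1 + (16 * pi * (real N)\<^sup>2) powr p) * E)) * ?L"
    using E0 by (simp add: ennreal_mult mult.assoc del: ennreal_plus)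
  also have "2 powr (p - 1) * ((1 + (16 * pi * (real N)\<^sup>2) powr p) * E) = \<rho> * (piece_const p N T * loss_base p c0 C ^ k)"
    by (simp add: piece_const_def E_def \<rho>_def mult_ac)
  also have "ennreal (\<rho> * (piece_const p N T * loss_base p c0 C ^ k)) * ?L
     = ennreal \<rho> * (ennreal (piece_const p N T * loss_base p c0 C ^ k) * ?L)"
    using \<rho> by (simp add: ennreal_mult' mult.assoc)
  finally show ?thesis
    using \<rho> unfolding G_def w_def by (subst (asm) ennreal_mult_le_mult_iff) auto
qed

end

section \<open>A partition of the frequencies into pieces\<close>

lemma sum_hat_eq_1:
  fixes y :: real and L :: int
  assumes "\<bar>y\<bar> \<le> of_int L"
  shows "(\<Sum>i\<in>{-L..L}. hat (y - of_int i)) = 1"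
proof -
  define q where "q = \<lfloor>y\<rfloor>"
  have q: "of_int q \<le> y" "y < of_int q + 1" unfolding q_def by linarith+
  have ran: "{q, q + 1} \<subseteq> {-L..L + 1}" using assms q unfolding q_def by auto linarith+
  \<comment> \<open>The extra index \<open>L + 1\<close> has a vanishing hat; it makes room for
    \<open>q + 1\<close> in the boundary case \<open>y = L\<close>.\<close>
  have "(\<Sum>i\<in>{-L..L}. hat (y - of_int i)) = (\<Sum>i\<in>{-L..L + 1}. hat (y - of_int i))"
    using assms by (intro sum.mono_neutral_left) (auto simp: hat_def)
  also have "\<dots> = (\<Sum>i\<in>{q, q + 1}. hat (y - of_int i))"
  proof (rule sum.mono_neutral_right)
    show "\<forall>i\<in>{-L..L + 1} - {q, q + 1}. hat (y - of_int i) = 0"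
    proof
      fix i assume "i \<in> {-L..L + 1} - {q, q + 1}"
      then have "i \<le> q - 1 \<or> i \<ge> q + 2" by auto
      then have "real_of_int i \<le> of_int q - 1 \<or> real_of_int i \<ge> of_int q + 2" by linarith
      then show "hat (y - of_int i) = 0" using q by (auto simp: hat_def)
    qed
  qed (use ran in auto)
  also have "\<dots> = hat (y - of_int q) + hat (y - of_int q - 1)" by (simp add: diff_diff_eq)
  also have "\<dots> = 1" using q by (simp add: hat_def)
  finally show ?thesis .
qed

text \<open>
  Frequency multipliers. The trapezoid \<open>trapezoid N k\<close> is \<open>1\<close> up to \<open>N ^ (k + 1)\<close> and vanishes beyond
  \<open>(N + 1) * N ^ k\<close>. On the support of \<open>trapezoid N k\<close> but off that of \<open>trapezoid N (k - 1)\<close>, the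
  hats of width \<open>N ^ (k - 1)\<close> have centres larger than \<open>N\<close> times their width.
\<close>

definition trapezoid :: "nat \<Rightarrow> nat \<Rightarrow> int \<Rightarrow> real" where
  "trapezoid N k n = (\<Sum>i\<in>{-int N..int N}. hat (of_int (n - i * int N ^ k) / real (N ^ k)))"

text \<open>For \<open>k > 0\<close> the bound comes from
  \<open>(N + 1) * N ^ k = (N\<^sup>2 + N) * N ^ (k - 1)\<close>, where \<open>trapezoid N k\<close>
  ends. For \<open>k = 0\<close> truncated subtraction gives hats of width 1, and no central indices
  are removed.\<close>

definition piece_index :: "nat \<Rightarrow> nat \<Rightarrow> int set" where
  "piece_index N k = {i. \<bar>i\<bar> \<le> int (N\<^sup>2 + N) \<and> (k = 0 \<or> int N < \<bar>i\<bar>)}"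

definition piece_multiplier :: "nat \<Rightarrow> nat \<Rightarrow> int \<Rightarrow> int \<Rightarrow> real" where
  "piece_multiplier N k i n = hat (of_int (n - i * int N ^ (k - 1)) / real (N ^ (k - 1))) * trapezoid N k n"

lemma hat_grid: "0 < N \<Longrightarrow> hat (of_int (n - i * int N ^ k) / real (N ^ k)) = hat (of_int n / real N ^ k - of_int i)"
  by (simp add: diff_divide_distrib)

lemma trapezoid_eq_1:
  assumes "0 < N" "\<bar>n\<bar> \<le> int N ^ Suc k"
  shows "trapezoid N k n = 1"
proof -
  have "\<bar>real_of_int n\<bar> \<le> real N * real N ^ k"
    using assms(2) by (metis of_int_abs of_int_le_iff of_int_of_nat_eq of_int_power power_Suc)
  then have "\<bar>of_int n / real N ^ k\<bar> \<le> of_int (int N)"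
    using assms by (simp add: abs_divide divide_le_eq)
  then show ?thesis unfolding trapezoid_def hat_grid[OF assms(1)] by (rule sum_hat_eq_1)
qed

lemma trapezoid_eq_0:
  assumes "0 < N" "(int N + 1) * int N ^ k \<le> \<bar>n\<bar>"
  shows "trapezoid N k n = 0"
  unfolding trapezoid_def hat_grid[OF assms(1)]
proof (rule sum.neutral, rule ballI)
  fix i assume i: "i \<in> {-int N..int N}"
  have "real_of_int ((int N + 1) * int N ^ k) \<le> real_of_int \<bar>n\<bar>" using assms(2) by (rule of_int_le_iff[THEN iffD2])
  then have "real N + 1 \<le> \<bar>of_int n / real N ^ k\<bar>"
    using assms(1) by (simp add: abs_divide le_divide_eq)
  moreover have "\<bar>real_of_int i\<bar> \<le> real N" using i by auto
  ultimately have "1 \<le> \<bar>of_int n / real N ^ k - of_int i\<bar>" by linarith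
  then show "hat (of_int n / real N ^ k - of_int i) = 0" by (simp add: hat_def)
qed

text \<open>A telescoping sum. On the support of \<open>trapezoid N (Suc J)\<close> the hats of
  width \<open>N ^ J\<close> add up to 1, and the omitted central ones are exactly
  \<open>trapezoid N J\<close>, whose support lies where \<open>trapezoid N (Suc J)\<close> is 1. So
  level \<open>Suc J\<close> contributes the difference of the two trapezoids.\<close>

lemma sum_piece_multiplier:
  assumes N: "2 \<le> N"
  shows "(\<Sum>k\<le>J. \<Sum>i\<in>piece_index N k. piece_multiplier N k i n) = trapezoid N J n"
proof (induction J)
  case 0
  have idx: "piece_index N 0 = {-int (N\<^sup>2 + N)..int (N\<^sup>2 + N)}" by (auto simp: piece_index_def)
  show ?case
  proof (cases "trapezoid N 0 n = 0")
    case True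
    then show ?thesis by (simp add: piece_multiplier_def)
  next
    case False
    then have "\<bar>n\<bar> < int N + 1" using trapezoid_eq_0[of N 0 n] N by force
    then have "\<bar>n\<bar> \<le> int (N\<^sup>2 + N)"
      using zero_le_power2[of "int N"] unfolding of_nat_add of_nat_power by linarith
    then have "\<bar>real_of_int n\<bar> \<le> of_int (int (N\<^sup>2 + N))" by (simp only: of_int_abs[symmetric] of_int_le_iff)
    from sum_hat_eq_1[OF this] show ?thesis
      by (simp add: idx piece_multiplier_def flip: sum_distrib_right)
  qed
next
  case (Suc J)
  let ?K = "{-int (N\<^sup>2 + N)..int (N\<^sup>2 + N)}"
  have idx: "piece_index N (Suc J) = ?K - {-int N..int N}" by (auto simp: piece_index_def)
  have sub: "{-int N..int N} \<subseteq> ?K" by auto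
  have "(\<Sum>i\<in>piece_index N (Suc J). piece_multiplier N (Suc J) i n)
     = ((\<Sum>i\<in>?K. hat (of_int n / real N ^ J - of_int i)) - trapezoid N J n) * trapezoid N (Suc J) n"
    unfolding idx piece_multiplier_def sum_distrib_right[symmetric] using N
    by (simp only: diff_Suc_1 hat_grid trapezoid_def sum_diff[OF _ sub] finite_atLeastAtMost_int)
  also have "\<dots> = trapezoid N (Suc J) n - trapezoid N J n"
  proof -
    have "(\<Sum>i\<in>?K. hat (of_int n / real N ^ J - of_int i)) * trapezoid N (Suc J) n = trapezoid N (Suc J) n"
    proof (cases "trapezoid N (Suc J) n = 0")
      case False
      then have "\<bar>n\<bar> < (int N + 1) * int N ^ Suc J" using trapezoid_eq_0[of N "Suc J" n] N by force
      then have "\<bar>n\<bar> \<le> (int N * int N + int N) * int N ^ J" by (simp add: algebra_simps)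
      then have "real_of_int \<bar>n\<bar> \<le> real_of_int ((int N * int N + int N) * int N ^ J)" by (simp only: of_int_le_iff)
      then have "\<bar>of_int n / real N ^ J\<bar> \<le> of_int (int (N\<^sup>2 + N))"
        using N by (simp add: abs_divide divide_le_eq power2_eq_square)
      from sum_hat_eq_1[OF this] show ?thesis by simp
    qed simp
    moreover have "trapezoid N J n * trapezoid N (Suc J) n = trapezoid N J n"
    proof (cases "trapezoid N J n = 0")
      case False
      then have "\<bar>n\<bar> < (int N + 1) * int N ^ J" using trapezoid_eq_0[of N J n] N by force
      also have "\<dots> \<le> (int N * int N) * int N ^ J"
      proof (rule mult_right_mono)
        have "2 * int N \<le> int N * int N" using N by (intro mult_right_mono) auto
        then show "int N + 1 \<le> int N * int N" using N by linarith
      qed simp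
      finally show ?thesis using trapezoid_eq_1[of N n "Suc J"] N by simp
    qed simp
    ultimately show ?thesis by (simp only: left_diff_distrib)
  qed
  finally show ?case using Suc by simp
qed

subsection \<open>Incidences on the grid\<close>

lemma fejer_eq_trig:
  assumes "0 < R"
  shows "complex_of_real (fejer M R y) = trig {-(int R - 1)..int R - 1} (\<lambda>n. complex_of_real (hat (of_int n / real R) / real M)) y"
proof -
  let ?Z = "{-(int R - 1)..int R - 1}"
  let ?P = "{..<R} \<times> {..<R}"
  have "(\<Sum>i<R. \<Sum>k<R. echar (real i * y - real k * y)) = (\<Sum>z\<in>?P. echar (of_int (int (fst z) - int (snd z)) * y))"
    by (simp add: sum.cartesian_product case_prod_beta left_diff_distrib)
  also have "\<dots> = (\<Sum>n\<in>?Z. \<Sum>z | z \<in> ?P \<and> int (fst z) - int (snd z) = n. echar (of_int (int (fst z) - int (snd z)) * y))"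
    by (rule sum.group[symmetric]) auto
  also have "\<dots> = (\<Sum>n\<in>?Z. of_nat (nat (int R - \<bar>n\<bar>)) * echar (of_int n * y))"
  proof (rule sum.cong[OF refl])
    fix n
    have "{z. z \<in> ?P \<and> int (fst z) - int (snd z) = n} = {(i, k). i < R \<and> k < R \<and> int i - int k = n}"
      by auto
    then have "card {z. z \<in> ?P \<and> int (fst z) - int (snd z) = n} = nat (int R - \<bar>n\<bar>)"
      by (simp only: card_diff_pairs)
    moreover have "(\<Sum>z | z \<in> ?P \<and> int (fst z) - int (snd z) = n. echar (of_int (int (fst z) - int (snd z)) * y))
        = (\<Sum>z | z \<in> ?P \<and> int (fst z) - int (snd z) = n. echar (of_int n * y))"
      by (rule sum.cong) auto
    ultimately show "(\<Sum>z | z \<in> ?P \<and> int (fst z) - int (snd z) = n. echar (of_int (int (fst z) - int (snd z)) * y))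
        = of_nat (nat (int R - \<bar>n\<bar>)) * echar (of_int n * y)"
      by (simp only: sum_constant)
  qed
  finally have eq: "(\<Sum>i<R. \<Sum>k<R. echar (real i * y - real k * y))
     = (\<Sum>n\<in>?Z. of_nat (nat (int R - \<bar>n\<bar>)) * echar (of_int n * y))" .
  show ?thesis
    unfolding fejer_eq_double_sum eq trig_def sum_divide_distrib
  proof (rule sum.cong[OF refl])
    fix n assume "n \<in> ?Z"
    then have "\<bar>n\<bar> \<le> int R" by auto
    then have "hat (of_int n / real R) = real (nat (int R - \<bar>n\<bar>)) / real R"
      using assms by (auto simp: hat_def max_def field_simps abs_if nat_diff_distrib split: if_splits)
    then show "of_nat (nat (int R - \<bar>n\<bar>)) * echar (of_int n * y) / (of_nat M * of_nat R)
       = complex_of_real (hat (of_int n / real R) / real M) * echar (of_int n * y)"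
      by simp
  qed
qed

lemma borel_measurable_fejer [measurable]: "fejer M R \<in> borel_measurable borel"
  unfolding fejer_def[abs_def] by measurable

text \<open>The \<open>M\<close> translates over the grid have equal integrals by periodicity, and
  they sum to 1.\<close>

lemma nn_integral_fejer:
  assumes "0 < R" "R \<le> M"
  shows "ennreal (real M) * (\<integral>\<^sup>+x\<in>{0..1}. ennreal (fejer M R (x - y)) \<partial>lborel) = 1"
proof -
  define I where "I = (\<integral>\<^sup>+x\<in>{0..1}. ennreal (fejer M R x) \<partial>lborel)"
  have per: "fejer M R (x + 1) = fejer M R x" for x
    by (simp add: fejer_def distrib_left echar_add)
  have I: "(\<integral>\<^sup>+x\<in>{0..1}. ennreal (fejer M R (x - z)) \<partial>lborel) = I" for z
    using nn_integral_periodic_shift[of "\<lambda>x. ennreal (fejer M R x)" "- z"] per by (simp add: I_def)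
  have "ennreal (real M) * I = (\<Sum>l<M. (\<integral>\<^sup>+x\<in>{0..1}. ennreal (fejer M R (x - real l / real M)) \<partial>lborel))"
    unfolding I by (simp add: ennreal_of_nat_eq_real_of_nat)
  also have "\<dots> = (\<integral>\<^sup>+x\<in>{0..1}. (\<Sum>l<M. ennreal (fejer M R (x - real l / real M))) \<partial>lborel)"
    by (rule set_nn_integral_sum'[symmetric]) auto
  also have "\<dots> = (\<integral>\<^sup>+x\<in>{0..1}. 1 \<partial>(lborel::real measure))"
    using fejer_sum[OF assms] by (simp add: fejer_nonneg sum_ennreal)
  finally show ?thesis unfolding I by simp
qed

lemma finite_piece_index: "finite (piece_index N k)"
  by (rule finite_subset[of _ "{-int (N\<^sup>2 + N)..int (N\<^sup>2 + N)}"]) (auto simp: piece_index_def)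

lemma card_piece_index: "card (piece_index N k) \<le> 2 * N\<^sup>2 + 2 * N + 1"
proof -
  have "card (piece_index N k) \<le> card {-int (N\<^sup>2 + N)..int (N\<^sup>2 + N)}"
    by (rule card_mono) (auto simp: piece_index_def)
  moreover have "card {-int K..int K} = 2 * K + 1" for K by simp
  ultimately show ?thesis by (metis add_mult_distrib2)
qed

lemma multiplier_bound_piece:
  assumes "1 \<le> p" "finite Z" "0 < N"
  shows "multiplier_bound p Z (\<lambda>n. complex_of_real (piece_multiplier N k i n)) (2 * real N + 1)"
proof -
  have h: "multiplier_bound p Z (\<lambda>n. complex_of_real (hat (of_int (n - i * int N ^ k) / real (N ^ k)))) 1" for i k
    using assms by (intro multiplier_bound_hat) auto
  have "multiplier_bound p Z (\<lambda>n. \<Sum>i\<in>{-int N..int N}. complex_of_real (hat (of_int (n - i * int N ^ k) / real (N ^ k)))) (real (card {-int N..int N}) * 1)"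
    using assms by (intro multiplier_bound_sum h) auto
  then have "multiplier_bound p Z (\<lambda>n. complex_of_real (trapezoid N k n)) (2 * real N + 1)"
    by (simp add: trapezoid_def)
  from multiplier_bound_mult[OF h[of i "k - 1"] this] show ?thesis
    by (simp add: piece_multiplier_def)
qed

text \<open>The factors come from the lower bound 1/8 on the averages, the number of pieces per
  level, the maximal estimate, and the norm of a piece multiplier.\<close>

definition incidence_const :: "real \<Rightarrow> nat \<Rightarrow> real \<Rightarrow> real" where
  "incidence_const p N T = 8 powr p * (2 * (real N)\<^sup>2 + 2 * real N + 1) powr p * piece_const p N T * (2 * real N + 1) powr p"

context cantor_tree
begin

text \<open>The hat leaves only frequencies within \<open>r = N ^ (k - 1)\<close> of
  \<open>\<xi> = i * N ^ (k - 1)\<close>. For \<open>k > 0\<close> the index condition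
  \<open>N < \<bar>i\<bar>\<close> gives \<open>r * N \<le> \<bar>\<xi>\<bar>\<close>; for
  \<open>k = 0\<close> nothing is decoupled. The maximum with 1 permits the same exponent
  \<open>j\<close> for all pieces.\<close>

lemma piece_multiplier_estimate:
  fixes \<tau> :: "nat \<Rightarrow> real"
  assumes c0: "0 < c0" and T: "0 \<le> T" and Z: "finite Z" and kj: "k \<le> j" and i: "i \<in> piece_index N k"
    and M: "0 < M" and Q: "Q \<subseteq> {..<M}" and \<tau>: "\<And>q. q \<in> Q \<Longrightarrow> 0 \<le> \<tau> q \<and> \<tau> q \<le> T"
  shows "(\<Sum>q\<in>Q. (\<integral>\<^sup>+x\<in>{real q / real M..<(real q + 1) / real M}.
        ennreal (norm ((1 / of_nat N0 ^ j) * (\<Sum>a\<in>descendants j 0 1.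
          trig Z (\<lambda>n. complex_of_real (piece_multiplier N k i n) * c n) (x + \<tau> q * a))) powr p) \<partial>lborel))
     \<le> ennreal (piece_const p N T * max 1 (loss_base p c0 C) ^ j * (2 * real N + 1) powr p) * Lp_pow p (trig Z c)"
proof -
  let ?c = "\<lambda>n. complex_of_real (piece_multiplier N k i n) * c n"
  define r where "r = N ^ (k - 1)"
  define \<xi> where "\<xi> = i * int N ^ (k - 1)"
  define Z' where "Z' = {n \<in> Z. \<bar>n - \<xi>\<bar> \<le> int r}"
  have r: "0 < r" using N by (simp add: r_def)
  have eq: "trig Z ?c = trig Z' ?c"
  proof
    fix x
    show "trig Z ?c x = trig Z' ?c x"
      unfolding trig_def
    proof (rule sum.mono_neutral_right)
      show "\<forall>n\<in>Z - Z'. ?c n * echar (of_int n * x) = 0"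
      proof
        fix n assume "n \<in> Z - Z'"
        then have "int r < \<bar>n - \<xi>\<bar>" by (auto simp: Z'_def)
        then have "real r < \<bar>of_int (n - \<xi>)\<bar>" by linarith
        then have "1 \<le> \<bar>of_int (n - \<xi>) / real r\<bar>" using r by (simp add: abs_divide)
        then have "hat (of_int (n - \<xi>) / real r) = 0" by (simp add: hat_def)
        then show "?c n * echar (of_int n * x) = 0" by (simp add: piece_multiplier_def r_def \<xi>_def)
      qed
    qed (use Z in \<open>auto simp: Z'_def\<close>)
  qed
  have absxi: "\<bar>of_int \<xi>\<bar> = \<bar>real_of_int i\<bar> * real N ^ (k - 1)"
    by (simp add: \<xi>_def abs_mult power_abs)
  have k1: "real r * real N \<le> \<bar>of_int \<xi>\<bar>" if "0 < k"
  proof -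
    have "int N < \<bar>i\<bar>" using i that by (auto simp: piece_index_def)
    then have "real N \<le> \<bar>real_of_int i\<bar>" by linarith
    then show ?thesis unfolding absxi r_def by (simp add: mult.commute mult_right_mono)
  qed
  have k2: "real N ^ k \<le> \<bar>of_int \<xi>\<bar>" if "0 < k"
  proof -
    have "real r * real N = real N ^ k" using that by (cases k) (simp_all add: r_def mult.commute)
    then show ?thesis using k1[OF that] by simp
  qed
  have pw: "real N ^ (k - 1) \<le> real N ^ k" using N by (intro power_increasing) auto
  have N2: "real N \<le> (real N)\<^sup>2" using mult_right_mono[of 1 "real N" "real N"] N by (simp add: power2_eq_square)
  have L1: "2 * real r \<le> 2 * real N ^ (k + 2)"
  proof -
    have "real N ^ (k - 1) \<le> real N ^ (k + 2)" using N by (intro power_increasing) auto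
    then show ?thesis by (simp add: r_def)
  qed
  have L2: "\<bar>of_int \<xi>\<bar> \<le> 2 * real N ^ (k + 2)"
  proof -
    have "\<bar>i\<bar> \<le> int (N\<^sup>2 + N)" using i by (auto simp: piece_index_def)
    then have "real_of_int \<bar>i\<bar> \<le> real_of_int (int (N\<^sup>2 + N))" by (simp only: of_int_le_iff)
    moreover have "real_of_int (int (N\<^sup>2 + N)) = (real N)\<^sup>2 + real N" by simp
    ultimately have "\<bar>real_of_int i\<bar> \<le> 2 * (real N)\<^sup>2" using N2 unfolding of_int_abs by linarith
    then have "\<bar>of_int \<xi>\<bar> \<le> 2 * (real N)\<^sup>2 * real N ^ k" unfolding absxi using pw by (intro mult_mono) auto
    then show ?thesis by (simp add: power_add power2_eq_square mult_ac)
  qed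
  have "(\<Sum>q\<in>Q. (\<integral>\<^sup>+x\<in>{real q / real M..<(real q + 1) / real M}.
        ennreal (norm ((1 / of_nat N0 ^ j) * (\<Sum>a\<in>descendants j 0 1. trig Z ?c (x + \<tau> q * a))) powr p) \<partial>lborel))
     \<le> ennreal (piece_const p N T * loss_base p c0 C ^ k) * Lp_pow p (trig Z ?c)"
    unfolding eq
    by (rule piece_estimate[OF _ _ r kj k1 k2 c0 T L1 L2 M Q \<tau>]) (use Z in \<open>auto simp: Z'_def\<close>)
  also have "\<dots> \<le> ennreal (piece_const p N T * max 1 (loss_base p c0 C) ^ j) * (ennreal ((2 * real N + 1) powr p) * Lp_pow p (trig Z c))"
  proof (intro mult_mono ennreal_leI mult_left_mono)
    have "loss_base p c0 C ^ k \<le> max 1 (loss_base p c0 C) ^ k" by (intro power_mono) (auto simp: loss_base_nonneg)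
    also have "\<dots> \<le> max 1 (loss_base p c0 C) ^ j" using kj by (intro power_increasing) auto
    finally show "loss_base p c0 C ^ k \<le> max 1 (loss_base p c0 C) ^ j" .
    show "0 \<le> piece_const p N T" using T by (simp add: piece_const_def)
    show "Lp_pow p (trig Z ?c) \<le> ennreal ((2 * real N + 1) powr p) * Lp_pow p (trig Z c)"
      using p N Z by (intro multiplier_boundD multiplier_bound_piece) auto
  qed (auto simp: loss_base_nonneg)
  finally show ?thesis
    by (simp add: ennreal_mult'' mult.assoc)
qed

text \<open>Both counts are compared with norms of a sum \<open>g\<close> of Fejer kernels centred
  at \<open>W\<close>. By \<open>hit\<close>, the average of \<open>g\<close> over the dilated
  endpoints is at least 1/8 on each cell of \<open>Q\<close>; and \<open>0 \<le> g \<le> 1\<close>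
  gives \<open>g powr p \<le> g\<close>, with integral \<open>card W / M\<close>. The maximal
  estimates for the pieces connect the two.\<close>

lemma incidence_bound:
  fixes \<tau> :: "nat \<Rightarrow> real" and j :: nat
  defines "R \<equiv> N ^ j"
  defines "M \<equiv> 2 * R"
  assumes c0: "0 < c0" and T: "0 \<le> T"
    and Q: "Q \<subseteq> {..<M}" and W: "W \<subseteq> {..<M}" and \<tau>: "\<And>q. q \<in> Q \<Longrightarrow> 0 \<le> \<tau> q \<and> \<tau> q \<le> T"
    and hit: "\<And>q a x. q \<in> Q \<Longrightarrow> a \<in> descendants j 0 1 \<Longrightarrow> x \<in> {real q / real M..<(real q + 1) / real M} \<Longrightarrow>
        \<exists>w\<in>W. \<exists>m::int. \<bar>x + \<tau> q * a - real w / real M - of_int m\<bar> \<le> 1 / (4 * real R)"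
  shows "real (card Q) \<le> incidence_const p N T * (real (j + 1) powr p * max 1 (loss_base p c0 C) ^ j) * real (card W)"
proof -
  have R: "0 < R" using N by (simp add: R_def)
  have RM: "R \<le> M" "0 < M" using R by (auto simp: M_def)
  let ?D = "descendants j 0 1"
  let ?cell = "\<lambda>q. {real q / real M..<(real q + 1) / real M}"
  have finQ: "finite Q" and finW: "finite W" using Q W finite_subset by blast+
  define Z where "Z = {-(int R - 1)..int R - 1}"
  have finZ: "finite Z" by (simp add: Z_def)
  define c where "c n = (\<Sum>w\<in>W. complex_of_real (hat (of_int n / real R) / real M) * echar (- (of_int n * (real w / real M))))" for n :: int
  define g where "g x = (\<Sum>w\<in>W. fejer M R (x - real w / real M))" for x
  have g_trig: "complex_of_real (g x) = trig Z c x" for x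
  proof -
    have "complex_of_real (g x) = (\<Sum>w\<in>W. \<Sum>n\<in>Z. complex_of_real (hat (of_int n / real R) / real M) * echar (of_int n * (x - real w / real M)))"
      unfolding g_def Z_def of_real_sum fejer_eq_trig[OF R] trig_def ..
    also have "\<dots> = (\<Sum>n\<in>Z. \<Sum>w\<in>W. complex_of_real (hat (of_int n / real R) / real M) * echar (of_int n * (x - real w / real M)))"
      by (rule sum.swap)
    also have "\<dots> = trig Z c x"
      unfolding trig_def c_def sum_distrib_right
    proof (intro sum.cong refl)
      fix n w
      have "echar (of_int n * (x - real w / real M)) = echar (- (of_int n * (real w / real M))) * echar (of_int n * x)"
        unfolding echar_add[symmetric] by (rule arg_cong[where f = echar]) (simp add: algebra_simps)
      then show "complex_of_real (hat (of_int n / real R) / real M) * echar (of_int n * (x - real w / real M))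
        = complex_of_real (hat (of_int n / real R) / real M) * echar (- (of_int n * (real w / real M))) * echar (of_int n * x)"
        by (simp only: mult.assoc)
    qed
    finally show ?thesis .
  qed
  have g0: "0 \<le> g x" for x unfolding g_def by (intro sum_nonneg fejer_nonneg)
  have g1: "g x \<le> 1" for x
  proof -
    have "g x \<le> (\<Sum>l<M. fejer M R (x - real l / real M))"
      unfolding g_def using W by (intro sum_mono2 fejer_nonneg) auto
    then show ?thesis using fejer_sum[OF R RM(1)] by simp
  qed
  have Lp_g: "ennreal (real M) * Lp_pow p (trig Z c) \<le> ennreal (real (card W))"
  proof -
    have "Lp_pow p (trig Z c) \<le> (\<integral>\<^sup>+x\<in>{0..1}. (\<Sum>w\<in>W. ennreal (fejer M R (x - real w / real M))) \<partial>lborel)"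
      unfolding Lp_pow_def
    proof (rule set_nn_integral_mono')
      fix x
      have "g x powr p \<le> g x powr 1" using g0 g1 p by (intro powr_mono') auto
      then have "norm (trig Z c x) powr p \<le> g x" using g0[of x] by (simp add: g_trig[symmetric])
      then have "ennreal (norm (trig Z c x) powr p) \<le> ennreal (g x)" by (rule ennreal_leI)
      then show "ennreal (norm (trig Z c x) powr p) \<le> (\<Sum>w\<in>W. ennreal (fejer M R (x - real w / real M)))"
        by (simp add: g_def sum_ennreal fejer_nonneg)
    qed
    also have "\<dots> = (\<Sum>w\<in>W. (\<integral>\<^sup>+x\<in>{0..1}. ennreal (fejer M R (x - real w / real M)) \<partial>lborel))"
      by (rule set_nn_integral_sum') auto
    finally have "ennreal (real M) * Lp_pow p (trig Z c)
      \<le> ennreal (real M) * (\<Sum>w\<in>W. (\<integral>\<^sup>+x\<in>{0..1}. ennreal (fejer M R (x - real w / real M)) \<partial>lborel))"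
      by (rule mult_left_mono) simp
    also have "\<dots> = ennreal (real (card W))"
      unfolding sum_distrib_left nn_integral_fejer[OF R RM(1)] by (simp add: ennreal_of_nat_eq_real_of_nat)
    finally show ?thesis .
  qed
  \<comment> \<open>Levels up to \<open>j - 1\<close> suffice, because
    \<open>trapezoid N (j - 1)\<close> is 1 up to \<open>N ^ j\<close>, beyond the degree of
    \<open>g\<close>. For \<open>j = 0\<close> this still contains level 0.\<close>
  define P where "P = Sigma {..j - 1} (piece_index N)"
  have finP: "finite P" unfolding P_def by (intro finite_SigmaI finite_piece_index) auto
  let ?B = "2 * (real N)\<^sup>2 + 2 * real N + 1"
  have cardP: "real (card P) \<le> real (j + 1) * ?B"
  proof -
    have "card P = (\<Sum>k\<le>j - 1. card (piece_index N k))" unfolding P_def by (intro card_SigmaI) (auto simp: finite_piece_index)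
    also have "\<dots> \<le> (\<Sum>k\<le>j - 1. 2 * N\<^sup>2 + 2 * N + 1)" by (intro sum_mono card_piece_index)
    also have "\<dots> = Suc (j - 1) * (2 * N\<^sup>2 + 2 * N + 1)" by (simp only: sum_constant card_atMost of_nat_id)
    also have "\<dots> \<le> (j + 1) * (2 * N\<^sup>2 + 2 * N + 1)" by (intro mult_right_mono) auto
    finally have "real (card P) \<le> real ((j + 1) * (2 * N\<^sup>2 + 2 * N + 1))" by (simp only: of_nat_le_iff)
    then show ?thesis by (simp add: algebra_simps)
  qed
  define f where "f z = trig Z (\<lambda>n. complex_of_real (piece_multiplier N (fst z) (snd z) n) * c n)" for z
  have decomp: "trig Z c x = (\<Sum>z\<in>P. f z x)" for x
  proof -
    have "(\<Sum>z\<in>P. f z x) = (\<Sum>n\<in>Z. (\<Sum>z\<in>P. complex_of_real (piece_multiplier N (fst z) (snd z) n)) * c n * echar (of_int n * x))"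
      unfolding f_def trig_def sum_distrib_right by (rule sum.swap)
    also have "\<dots> = trig Z c x"
      unfolding trig_def
    proof (rule sum.cong[OF refl])
      fix n assume n: "n \<in> Z"
      have "(\<Sum>z\<in>P. piece_multiplier N (fst z) (snd z) n) = (\<Sum>k\<le>j - 1. \<Sum>i\<in>piece_index N k. piece_multiplier N k i n)"
        unfolding P_def by (subst sum.Sigma) (auto simp: finite_piece_index case_prod_beta)
      also have "\<dots> = trapezoid N (j - 1) n" by (rule sum_piece_multiplier[OF N])
      also have "\<dots> = 1"
      proof (rule trapezoid_eq_1)
        have "\<bar>n\<bar> \<le> int N ^ j" using n by (auto simp: Z_def R_def)
        also have "\<dots> \<le> int N ^ Suc (j - 1)" using N by (intro power_increasing) auto
        finally show "\<bar>n\<bar> \<le> int N ^ Suc (j - 1)" .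
      qed (use N in simp)
      finally have "(\<Sum>z\<in>P. complex_of_real (piece_multiplier N (fst z) (snd z) n)) = 1"
        by (simp flip: of_real_sum)
      then show "(\<Sum>z\<in>P. complex_of_real (piece_multiplier N (fst z) (snd z) n)) * c n * echar (of_int n * x) = c n * echar (of_int n * x)"
        by simp
    qed
    finally show ?thesis by simp
  qed
  define w where "w = (1 / of_nat N0 ^ j :: complex)"
  define G where "G z q x = w * (\<Sum>a\<in>?D. f z (x + \<tau> q * a))" for z q x
  have [measurable]: "G z q \<in> borel_measurable borel" for z q
    unfolding G_def[abs_def] f_def by measurable
  have lower: "(1 / 8) powr p \<le> real (card P) powr (p - 1) * (\<Sum>z\<in>P. norm (G z q x) powr p)" if q: "q \<in> Q" and x: "x \<in> ?cell q" for q x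
  proof -
    have "(\<Sum>z\<in>P. G z q x) = w * (\<Sum>a\<in>?D. trig Z c (x + \<tau> q * a))"
      unfolding G_def decomp sum_distrib_left[symmetric] by (rule arg_cong[where f = "(*) w"], rule sum.swap)
    also have "\<dots> = complex_of_real (1 / real N0 ^ j * (\<Sum>a\<in>?D. g (x + \<tau> q * a)))"
      unfolding g_trig[symmetric] w_def by simp
    finally have eq: "norm (\<Sum>z\<in>P. G z q x) = 1 / real N0 ^ j * (\<Sum>a\<in>?D. g (x + \<tau> q * a))"
      using g0 by (simp only: norm_of_real) (simp add: sum_nonneg)
    have "1 / 8 = 1 / real N0 ^ j * (\<Sum>a\<in>?D. 1 / 8)"
      using N0 by (simp add: card_descendants[OF root_in_points])
    also have "\<dots> \<le> 1 / real N0 ^ j * (\<Sum>a\<in>?D. g (x + \<tau> q * a))"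
    proof (intro mult_left_mono sum_mono)
      fix a assume a: "a \<in> ?D"
      from hit[OF q a x] obtain v m where v: "v \<in> W" and m: "\<bar>x + \<tau> q * a - real v / real M - of_int m\<bar> \<le> 1 / (4 * real R)"
        by blast
      have "1 / 8 \<le> fejer M R (x + \<tau> q * a - real v / real M)"
        unfolding M_def by (rule fejer_ge[OF R]) (use m in \<open>simp add: M_def\<close>)
      also have "\<dots> \<le> g (x + \<tau> q * a)"
        unfolding g_def by (rule member_le_sum[OF v]) (use finW in \<open>auto simp: fejer_nonneg\<close>)
      finally show "1 / 8 \<le> g (x + \<tau> q * a)" .
    qed simp
    finally have "1 / 8 \<le> norm (\<Sum>z\<in>P. G z q x)" by (simp only: eq)
    then have "(1 / 8) powr p \<le> norm (\<Sum>z\<in>P. G z q x) powr p" using p by (intro powr_mono2) auto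
    \<comment> \<open>Hoelder over the pieces; their number grows linearly in \<open>j\<close>,
      whence the factor \<open>(j + 1) powr p\<close>.\<close>
    also have "\<dots> \<le> real (card P) powr (p - 1) * (\<Sum>z\<in>P. norm (G z q x) powr p)"
      using p finP by (intro powr_norm_sum_le_card) auto
    finally show ?thesis .
  qed
  let ?K = "ennreal (real (card P) powr (p - 1))"
  have cell: "ennreal ((1 / 8) powr p) * ennreal (1 / real M) \<le> ?K * (\<Sum>z\<in>P. (\<integral>\<^sup>+x\<in>?cell q. ennreal (norm (G z q x) powr p) \<partial>lborel))" if q: "q \<in> Q" for q
  proof -
    have "emeasure lborel (?cell q) = ennreal ((real q + 1) / real M - real q / real M)"
      by (rule emeasure_lborel_Ico) (simp add: divide_right_mono)
    also have "(real q + 1) / real M - real q / real M = 1 / real M" by (simp add: add_divide_distrib)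
    finally have "ennreal ((1 / 8) powr p) * ennreal (1 / real M) = (\<integral>\<^sup>+x\<in>?cell q. ennreal ((1 / 8) powr p) \<partial>lborel)"
      by (subst nn_integral_cmult_indicator) auto
    also have "\<dots> \<le> (\<integral>\<^sup>+x\<in>?cell q. ?K * (\<Sum>z\<in>P. ennreal (norm (G z q x) powr p)) \<partial>lborel)"
    proof (rule set_nn_integral_mono')
      fix x assume "x \<in> ?cell q"
      from ennreal_leI[OF lower[OF q this]]
      show "ennreal ((1 / 8) powr p) \<le> ?K * (\<Sum>z\<in>P. ennreal (norm (G z q x) powr p))"
        by (simp add: ennreal_mult' sum_ennreal)
    qed
    also have "\<dots> = ?K * (\<integral>\<^sup>+x\<in>?cell q. (\<Sum>z\<in>P. ennreal (norm (G z q x) powr p)) \<partial>lborel)"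
      by (rule set_nn_integral_cmult') measurable
    also have "(\<integral>\<^sup>+x\<in>?cell q. (\<Sum>z\<in>P. ennreal (norm (G z q x) powr p)) \<partial>lborel) = (\<Sum>z\<in>P. (\<integral>\<^sup>+x\<in>?cell q. ennreal (norm (G z q x) powr p) \<partial>lborel))"
      by (rule set_nn_integral_sum') measurable
    finally show ?thesis .
  qed
  define A where "A = piece_const p N T * max 1 (loss_base p c0 C) ^ j * (2 * real N + 1) powr p"
  have A0: "0 \<le> A" using T by (simp add: A_def piece_const_def)
  have "ennreal (real (card Q)) * (ennreal ((1 / 8) powr p) * ennreal (1 / real M))
      = (\<Sum>q\<in>Q. ennreal ((1 / 8) powr p) * ennreal (1 / real M))"
    by (simp add: ennreal_of_nat_eq_real_of_nat)
  also have "\<dots> \<le> (\<Sum>q\<in>Q. ?K * (\<Sum>z\<in>P. (\<integral>\<^sup>+x\<in>?cell q. ennreal (norm (G z q x) powr p) \<partial>lborel)))"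
    by (intro sum_mono cell)
  also have "\<dots> = ?K * (\<Sum>z\<in>P. \<Sum>q\<in>Q. (\<integral>\<^sup>+x\<in>?cell q. ennreal (norm (G z q x) powr p) \<partial>lborel))"
    by (subst sum.swap) (simp only: sum_distrib_left)
  also have "\<dots> \<le> ?K * (\<Sum>z\<in>P. ennreal A * Lp_pow p (trig Z c))"
  proof (intro mult_left_mono sum_mono)
    fix z assume z: "z \<in> P"
    then have "fst z \<le> j" "snd z \<in> piece_index N (fst z)" by (auto simp: P_def)
    then show "(\<Sum>q\<in>Q. (\<integral>\<^sup>+x\<in>?cell q. ennreal (norm (G z q x) powr p) \<partial>lborel)) \<le> ennreal A * Lp_pow p (trig Z c)"
      unfolding G_def w_def f_def A_def
      by (intro piece_multiplier_estimate c0 T finZ RM(2) Q \<tau>)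
  qed simp
  also have "\<dots> = ?K * (ennreal (real (card P)) * (ennreal A * Lp_pow p (trig Z c)))"
    by (simp add: ennreal_of_nat_eq_real_of_nat)
  finally have "ennreal (real M) * (ennreal (real (card Q)) * (ennreal ((1 / 8) powr p) * ennreal (1 / real M)))
     \<le> ennreal (real M) * (?K * (ennreal (real (card P)) * (ennreal A * Lp_pow p (trig Z c))))"
    by (rule mult_left_mono) simp
  also have "\<dots> = ?K * (ennreal (real (card P)) * (ennreal A * (ennreal (real M) * Lp_pow p (trig Z c))))"
    by (simp only: mult_ac)
  also have "\<dots> \<le> ?K * (ennreal (real (card P)) * (ennreal A * ennreal (real (card W))))"
    by (intro mult_left_mono Lp_g) auto
  finally have "ennreal (real M * (real (card Q) * ((1 / 8) powr p * (1 / real M))))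
     \<le> ennreal (real (card P) powr (p - 1) * (real (card P) * (A * real (card W))))"
    using A0 by (simp only: ennreal_mult' ennreal_mult'' of_nat_0_le_iff powr_ge_zero mult_nonneg_nonneg divide_nonneg_nonneg zero_le_one)
  then have "real M * (real (card Q) * ((1 / 8) powr p * (1 / real M)))
     \<le> real (card P) powr (p - 1) * (real (card P) * (A * real (card W)))"
    using A0 by (subst (asm) ennreal_le_iff) auto
  then have "real (card Q) * (1 / 8) powr p \<le> (real (card P) powr (p - 1) * real (card P)) * (A * real (card W))"
    using RM by (simp add: mult_ac)
  also have "real (card P) powr (p - 1) * real (card P) = real (card P) powr p"
    using p by (cases "card P = 0") (auto simp: powr_diff)
  also have "real (card P) powr p * (A * real (card W)) \<le> (real (j + 1) * ?B) powr p * (A * real (card W))"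
    using cardP A0 p by (intro mult_right_mono powr_mono2) auto
  finally have "8 powr p * (real (card Q) * (1 / 8) powr p) \<le> 8 powr p * ((real (j + 1) * ?B) powr p * (A * real (card W)))"
    by (rule mult_left_mono) simp
  moreover have "8 powr p * (real (card Q) * (1 / 8) powr p) = real (card Q)"
    by (simp add: powr_divide)
  moreover have "(real (j + 1) * ?B) powr p = real (j + 1) powr p * ?B powr p"
    by (rule powr_mult)
  ultimately have "real (card Q) \<le> 8 powr p * (real (j + 1) powr p * ?B powr p * (A * real (card W)))"
    by (simp only:)
  then show ?thesis
    by (simp add: incidence_const_def A_def mult_ac)
qed

end

subsection \<open>From grid counts to measures of neighbourhoods\<close>

definition cells :: "nat \<Rightarrow> real set \<Rightarrow> int set" where
  "cells M X = {v. \<exists>x\<in>X. of_int v \<le> real M * x \<and> real M * x < of_int v + 1}"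

lemma floor_in_cells: "x \<in> X \<Longrightarrow> \<lfloor>real M * x\<rfloor> \<in> cells M X"
  unfolding cells_def by (intro CollectI bexI[of _ x]) (auto simp: floor_correct)

abbreviation grid_interval :: "nat \<Rightarrow> int \<Rightarrow> real set" where
  "grid_interval M v \<equiv> {of_int v / real M..<(of_int v + 1) / real M}"

lemma emeasure_grid_interval: "0 < M \<Longrightarrow> emeasure lborel (grid_interval M v) = ennreal (1 / real M)"
  by (subst emeasure_lborel_Ico) (auto simp: divide_right_mono add_divide_distrib)

lemma grid_interval_disjoint: "0 < M \<Longrightarrow> disjoint_family_on (grid_interval M) V"
  unfolding disjoint_family_on_def
proof (intro ballI impI)
  fix u v :: int
  assume M: "0 < M" and "u \<noteq> v"
  have "u = v" if "x \<in> grid_interval M u" "x \<in> grid_interval M v" for x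
  proof -
    have "of_int u \<le> x * real M" "x * real M < of_int u + 1" "of_int v \<le> x * real M" "x * real M < of_int v + 1"
      using that M by (auto simp: divide_le_eq less_divide_eq)
    then show ?thesis by linarith
  qed
  then show "grid_interval M u \<inter> grid_interval M v = {}" using \<open>u \<noteq> v\<close> by blast
qed

lemma open_nbhd: "open (nbhd r X)"
  unfolding nbhd_def by auto

lemma emeasure_le_cells:
  assumes "0 < M" "finite (cells M X)"
  shows "emeasure lborel X \<le> ennreal (real (card (cells M X)) / real M)"
proof -
  have sub: "X \<subseteq> (\<Union>v\<in>cells M X. grid_interval M v)"
  proof
    fix x assume "x \<in> X"
    moreover have "x \<in> grid_interval M \<lfloor>real M * x\<rfloor>"
    proof -
      have "of_int \<lfloor>real M * x\<rfloor> \<le> real M * x" "real M * x < of_int \<lfloor>real M * x\<rfloor> + 1" by linarith+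
      then show ?thesis using assms(1) by (auto simp: divide_le_eq less_divide_eq mult.commute)
    qed
    ultimately show "x \<in> (\<Union>v\<in>cells M X. grid_interval M v)" using floor_in_cells by blast
  qed
  have "emeasure lborel X \<le> emeasure lborel (\<Union>v\<in>cells M X. grid_interval M v)"
    using assms(2) by (intro emeasure_mono sub sets.finite_UN) auto
  also have "\<dots> \<le> (\<Sum>v\<in>cells M X. emeasure lborel (grid_interval M v))"
    using assms(2) by (intro emeasure_subadditive_finite) auto
  also have "\<dots> = ennreal (real (card (cells M X)) / real M)"
    using assms(1) by (simp add: emeasure_grid_interval ennreal_of_nat_eq_real_of_nat ennreal_mult'[symmetric])
  finally show ?thesis .
qed

text \<open>Two points of a grid interval are less than \<open>1 / M\<close> apart, so an interval
  that meets \<open>X\<close> lies in the neighbourhood. Finite subfamilies \<open>F\<close> allow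
  the case of infinitely many cells to be deduced.\<close>

lemma emeasure_nbhd_ge_cells:
  assumes M: "0 < M" and r: "1 / real M \<le> r" and F: "F \<subseteq> cells M X" "finite F"
  shows "ennreal (real (card F) / real M) \<le> emeasure lborel (nbhd r X)"
proof -
  have sub: "(\<Union>v\<in>F. grid_interval M v) \<subseteq> nbhd r X"
  proof (rule UN_least, rule subsetI)
    fix v y assume "v \<in> F" and y: "y \<in> grid_interval M v"
    then obtain x where x: "x \<in> X" "of_int v \<le> real M * x" "real M * x < of_int v + 1"
      using F unfolding cells_def by blast
    have "of_int v \<le> real M * y" "real M * y < of_int v + 1"
      using y M by (auto simp: divide_le_eq less_divide_eq mult.commute)
    then have "\<bar>real M * x - real M * y\<bar> < 1" using x by linarith
    then have "real M * \<bar>x - y\<bar> < 1" using M by (simp add: abs_mult flip: right_diff_distrib)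
    then have "\<bar>x - y\<bar> < 1 / real M" using M by (simp add: field_simps)
    then have "y \<in> ball x r" using r by (simp add: dist_real_def)
    then show "y \<in> nbhd r X" using x by (auto simp: nbhd_def)
  qed
  have "ennreal (real (card F) / real M) = (\<Sum>v\<in>F. emeasure lborel (grid_interval M v))"
    using M by (simp add: emeasure_grid_interval ennreal_of_nat_eq_real_of_nat ennreal_mult'[symmetric])
  also have "\<dots> = emeasure lborel (\<Union>v\<in>F. grid_interval M v)"
    using F M grid_interval_disjoint by (intro sum_emeasure) auto
  also have "\<dots> \<le> emeasure lborel (nbhd r X)"
    using open_nbhd by (intro emeasure_mono sub) auto
  finally show ?thesis .
qed

lemma emeasure_nbhd_infinite_cells:
  assumes M: "0 < M" and r: "1 / real M \<le> r" and inf: "infinite (cells M X)"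
  shows "emeasure lborel (nbhd r X) = \<infinity>"
proof -
  have le: "of_nat n \<le> emeasure lborel (nbhd r X)" for n
  proof -
    obtain F where F: "F \<subseteq> cells M X" "finite F" "card F = n * M"
      using infinite_arbitrarily_large[OF inf] by blast
    have "ennreal (real (card F) / real M) = of_nat n"
      using M F by (simp add: ennreal_of_nat_eq_real_of_nat)
    then show ?thesis using emeasure_nbhd_ge_cells[OF M r F(1,2)] by simp
  qed
  show ?thesis
  proof (rule ccontr)
    assume "emeasure lborel (nbhd r X) \<noteq> \<infinity>"
    then have "emeasure lborel (nbhd r X) < top" by (simp add: less_top)
    then obtain n where "emeasure lborel (nbhd r X) < of_nat n" using ennreal_Ex_less_of_nat by blast
    then show False using le[of n] by (simp add: leD)
  qed
qed

lemma incidence_const_pos: "0 \<le> T \<Longrightarrow> 0 < incidence_const p N T"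
proof -
  assume T: "0 \<le> T"
  have "2 * (real N)\<^sup>2 + 2 * real N + 1 \<noteq> 0" using zero_le_power2[of "real N"] by linarith
  then show ?thesis
    unfolding incidence_const_def piece_const_def using T by (intro mult_pos_pos) (auto simp: add_pos_nonneg)
qed

text \<open>\<open>2 * D + 1\<close> times \<open>L + 4\<close> in the notation of the proof of
  \<open>card_cells_le\<close>: the thickening of the cells of \<open>X\<close>, and the number of
  unit blocks that one cell serves.\<close>

definition overlap_const :: "real \<Rightarrow> real" where
  "overlap_const T = (2 * (\<lceil>2 * T\<rceil> + 5) + 1) * (\<lceil>3 * T\<rceil> + 8)"

lemma overlap_const_pos: "0 \<le> T \<Longrightarrow> 0 < overlap_const T"
proof -
  assume T: "0 \<le> T"
  have "0 \<le> \<lceil>2 * T\<rceil>" "0 \<le> \<lceil>3 * T\<rceil>" using T by (simp_all add: zero_le_ceiling)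
  moreover have "0 < (2 * (A + 5) + 1) * (B + 8)" if "0 \<le> A" "0 \<le> B" for A B :: int
    using that by (intro mult_pos_pos) auto
  ultimately have "0 < (2 * (\<lceil>2 * T\<rceil> + 5) + 1) * (\<lceil>3 * T\<rceil> + 8)" by blast
  then show ?thesis unfolding overlap_const_def by (simp only: of_int_0_less_iff)
qed

context cantor_tree
begin

lemma cantor_stage_Suc_subset: "cantor_stage N S (Suc k) \<subseteq> cantor_stage N S k"
proof
  fix x assume "x \<in> cantor_stage N S (Suc k)"
  then obtain a s where a: "a \<in> cantor_points N S k" and s: "s \<in> S k a"
    and x: "a + real s / real N ^ Suc k \<le> x" "x \<le> a + real s / real N ^ Suc k + 1 / real N ^ Suc k"
    unfolding cantor_stage_def by auto
  have "real s / real N ^ Suc k + 1 / real N ^ Suc k = (real s + 1) / real N ^ Suc k"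
    by (simp add: add_divide_distrib)
  also have "\<dots> \<le> real N / real N ^ Suc k"
    using digit_less[OF a s] by (intro divide_right_mono) auto
  also have "\<dots> = 1 / real N ^ k" using N by simp
  finally have "x \<le> a + 1 / real N ^ k" using x by linarith
  moreover have "0 \<le> real s / real N ^ Suc k" by simp
  then have "a \<le> x" using x by linarith
  ultimately show "x \<in> cantor_stage N S k" unfolding cantor_stage_def using a by auto
qed

text \<open>Digits are chosen forever, and the left endpoints increase to a point of every stage.
  Strictness on the right comes from digits being at most \<open>N - 2\<close>, which makes the
  right endpoints strictly decrease.\<close>

lemma cantor_set_meets_interval:
  assumes a: "a \<in> cantor_points N S m"
  obtains e where "e \<in> (\<Inter>j\<in>{1..}. cantor_stage N S j)" "a \<le> e" "e < a + 1 / real N ^ m"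
proof -
  define b where "b = rec_nat a (\<lambda>h y. y + real (SOME s. s \<in> S (m + h) y) / real N ^ Suc (m + h))"
  have b0: "b 0 = a" by (simp add: b_def)
  have ex: "\<exists>s. s \<in> S k y" if "y \<in> cantor_points N S k" for k y
    using card_S[OF that] N0 by (metis card.empty less_not_refl ex_in_conv)
  have step: "\<exists>s. s \<in> S (m + h) (b h) \<and> b (Suc h) = b h + real s / real N ^ Suc (m + h)" if "b h \<in> cantor_points N S (m + h)" for h
    using someI_ex[OF ex[OF that]] by (auto simp: b_def)
  have bp: "b h \<in> cantor_points N S (m + h)" for h
  proof (induction h)
    case (Suc h)
    from step[OF Suc] obtain s where "s \<in> S (m + h) (b h)" "b (Suc h) = b h + real s / real N ^ Suc (m + h)" by blast
    then show ?case using child_in_points[OF Suc] by simp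
  qed (simp add: b0 a)
  define u where "u h = b h + 1 / real N ^ (m + h)" for h
  have mono_b: "b h \<le> b (Suc h)" for h
    using step[OF bp[of h]] by auto
  have strict_u: "u (Suc h) < u h" for h
  proof -
    from step[OF bp[of h]] obtain s where s: "s \<in> S (m + h) (b h)" "b (Suc h) = b h + real s / real N ^ Suc (m + h)" by blast
    have "u (Suc h) = b h + (real s + 1) / real N ^ Suc (m + h)"
      by (simp add: u_def s(2) add_divide_distrib)
    also have "(real s + 1) / real N ^ Suc (m + h) < real N / real N ^ Suc (m + h)"
      using digit_less[OF bp s(1)] N by (intro divide_strict_right_mono) auto
    also have "real N / real N ^ Suc (m + h) = 1 / real N ^ (m + h)" using N by simp
    finally show ?thesis by (simp add: u_def)
  qed
  have inc: "b h \<le> b k" if "h \<le> k" for h k using that by (rule lift_Suc_mono_le[where f = b, OF mono_b])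
  have dec: "u k \<le> u h" if "h \<le> k" for h k using that by (rule lift_Suc_antimono_le[where f = u, OF less_imp_le[OF strict_u]])
  have bu: "b k \<le> u h" for h k
  proof -
    have "b k \<le> b (max h k)" by (rule inc) simp
    also have "\<dots> \<le> u (max h k)" by (simp add: u_def)
    also have "\<dots> \<le> u h" by (rule dec) simp
    finally show ?thesis .
  qed
  define e where "e = (SUP h. b h)"
  have lower: "b h \<le> e" for h
    unfolding e_def by (rule cSUP_upper) (use bu in \<open>auto intro!: bdd_aboveI2\<close>)
  have upper: "e \<le> u h" for h
    unfolding e_def by (rule cSUP_least) (use bu in auto)
  have "e \<in> cantor_stage N S j" if "m \<le> j" for j
  proof -
    have "e \<in> {b (j - m)..b (j - m) + 1 / real N ^ j}" using lower[of "j - m"] upper[of "j - m"] that by (simp add: u_def)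
    then show ?thesis unfolding cantor_stage_def using bp[of "j - m"] that by auto
  qed
  moreover have "cantor_stage N S (max m j) \<subseteq> cantor_stage N S j" for j
    by (rule lift_Suc_antimono_le[where f = "cantor_stage N S", OF cantor_stage_Suc_subset]) simp
  ultimately have "e \<in> cantor_stage N S j" for j by (meson max.cobounded1 subsetD)
  then show ?thesis
    using that[of e] lower[of 0] upper[of 1] strict_u[of 0] by (simp add: b0 u_def)
qed

text \<open>The line is cut into unit blocks. For the block at \<open>b\<close>, \<open>Q b\<close>
  lists the cells near \<open>Y\<close>, and \<open>W b\<close> collects, modulo 1, the thickened
  cells of \<open>X\<close> that points \<open>y + t y * e\<close> with \<open>y\<close> near the
  block can reach. The incidence bound holds in each block, and a cell of \<open>X\<close> is
  charged by at most \<open>L + 4\<close> blocks.\<close>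

lemma card_cells_le:
  fixes j :: nat
  defines "R \<equiv> N ^ j"
  defines "M \<equiv> 2 * R"
  assumes c0: "0 < c0" and T: "0 \<le> T" and t: "\<And>y. y \<in> Y \<Longrightarrow> t y \<le> T"
    and XY: "contains_dilates (\<Inter>j\<in>{1..}. cantor_stage N S j) X Y t"
    and fin: "finite (cells M X)"
  shows "finite (cells M (nbhd (1 / real R) Y))"
    and "real (card (cells M (nbhd (1 / real R) Y)))
      \<le> incidence_const p N T * (real (j + 1) powr p * max 1 (loss_base p c0 C) ^ j) * overlap_const T * real (card (cells M X))"
proof -
  have R: "1 \<le> R" using N by (simp add: R_def)
  have M: "2 \<le> M" using R by (simp add: M_def)
  let ?E = "\<Inter>j\<in>{1..}. cantor_stage N S j"
  let ?VX = "cells M X" and ?VY = "cells M (nbhd (1 / real R) Y)"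
  \<comment> \<open>In units of \<open>1 / M\<close>, \<open>D\<close> bounds the shift between the
    cell of \<open>y + t y * e\<close> and the grid point next to
    \<open>x + b + \<tau> q * a\<close>: \<open>2 * T\<close> because \<open>e - a < 1 / R\<close>,
    3 for \<open>y\<close>, and 1 each for \<open>x\<close> and the cell; the rounding error 1/2 is
    absorbed by integrality. \<open>L\<close> covers the displacement
    \<open>t y * e \<le> 3 * T\<close>, counted in blocks.\<close>
  define D where "D = \<lceil>2 * T\<rceil> + 5"
  define L where "L = \<lceil>3 * T\<rceil> + 4"
  have D: "2 * T + 5 \<le> of_int D" "0 \<le> D" and L: "3 * T + 4 \<le> of_int L" "0 \<le> L"
    unfolding D_def L_def using T by (linarith | simp)+
  define K where "K = incidence_const p N T * (real (j + 1) powr p * max 1 (loss_base p c0 C) ^ j)"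
  have K: "0 < K" unfolding K_def using incidence_const_pos[OF T] by (intro mult_pos_pos) auto
  define V where "V b = {v \<in> ?VX. int M * (b - 3) \<le> v \<and> v \<le> int M * (b + L)}" for b
  define Q where "Q b = {q. q < M \<and> int M * b + int q \<in> ?VY}" for b
  define W where "W b = (\<lambda>(v, d). nat ((v + d) mod int M)) ` (V b \<times> {-D..D})" for b
  have finV: "finite (V b)" for b using fin by (simp add: V_def)
  have cardW: "card (W b) \<le> nat (2 * D + 1) * card (V b)" for b
  proof -
    have "card (W b) \<le> card (V b \<times> {-D..D})" unfolding W_def using finV by (intro card_image_le) auto
    also have "\<dots> = nat (2 * D + 1) * card (V b)" by (simp add: card_cartesian_product)
    finally show ?thesis .
  qed
  have block: "real (card (Q b)) \<le> K * real (card (W b))" for b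
  proof -
    have "\<exists>y. y \<in> Y \<and> \<bar>real M * y - of_int (int M * b + int q)\<bar> < 3" if q: "q \<in> Q b" for q
    proof -
      from q obtain z where z: "z \<in> nbhd (1 / real R) Y" "of_int (int M * b + int q) \<le> real M * z" "real M * z < of_int (int M * b + int q) + 1"
        unfolding Q_def cells_def by blast
      from z(1) obtain y where y: "y \<in> Y" "\<bar>y - z\<bar> < 1 / real R" unfolding nbhd_def by (auto simp: dist_real_def)
      have "real M * \<bar>y - z\<bar> < 2" using y(2) R by (simp add: M_def field_simps)
      then have "\<bar>real M * y - real M * z\<bar> < 2" using M by (simp add: abs_mult flip: right_diff_distrib)
      then show ?thesis using y(1) z by (intro exI[of _ y] conjI) linarith+
    qed
    then obtain y where y: "\<And>q. q \<in> Q b \<Longrightarrow> y q \<in> Y \<and> \<bar>real M * y q - of_int (int M * b + int q)\<bar> < 3" by metis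
    define \<tau> where "\<tau> q = t (y q)" for q
    have \<tau>: "0 \<le> \<tau> q \<and> \<tau> q \<le> T" if "q \<in> Q b" for q
      using y[OF that] t XY unfolding \<tau>_def contains_dilates_def by (auto intro: less_imp_le)
    have "real (card (Q b)) \<le> incidence_const p N T * (real (j + 1) powr p * max 1 (loss_base p c0 C) ^ j) * real (card (W b))"
    proof (rule incidence_bound[OF c0 T _ _ \<tau>])
      show "Q b \<subseteq> {..<2 * N ^ j}" by (auto simp: Q_def M_def R_def)
      show "W b \<subseteq> {..<2 * N ^ j}"
        unfolding M_def[symmetric] R_def[symmetric] W_def using M by (auto simp: nat_less_iff)
      fix q a x
      assume q: "q \<in> Q b" and a: "a \<in> descendants j 0 1"
        and x: "x \<in> {real q / real (2 * N ^ j)..<(real q + 1) / real (2 * N ^ j)}"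
      have aj: "a \<in> cantor_points N S j" using descendants_in_points[OF root_in_points a] by simp
      have a12: "1 \<le> a" "a < 2" using descendants_range[OF root_in_points a] by auto
      obtain e where e: "e \<in> ?E" "a \<le> e" "e < a + 1 / real R"
        using cantor_set_meets_interval[OF aj] unfolding R_def by auto
      have Me: "\<bar>real M * e - real M * a\<bar> \<le> 2"
      proof -
        have "real M * (e - a) \<le> real M * (1 / real R)" using e by (intro mult_left_mono) auto
        then show ?thesis using R e by (simp add: M_def right_diff_distrib)
      qed
      have e3: "e \<le> 3" using e(3) a12 R by (smt (verit) le_divide_eq_1 of_nat_1 of_nat_le_iff divide_le_eq_1)
      have \<tau>q: "0 \<le> \<tau> q" "\<tau> q \<le> T" using \<tau>[OF q] by auto
      have \<xi>: "y q + \<tau> q * e \<in> X"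
      proof -
        have "y q + \<tau> q * e \<in> (\<Union>x\<in>Y. (\<lambda>e. x + t x * e) ` ?E)"
          unfolding \<tau>_def by (rule UN_I[of "y q"]) (use y[OF q] e(1) in blast)+
        then show ?thesis using XY unfolding contains_dilates_def by blast
      qed
      define v where "v = \<lfloor>real M * (y q + \<tau> q * e)\<rfloor>"
      have v: "v \<in> ?VX" unfolding v_def by (rule floor_in_cells[OF \<xi>])
      have xq: "real q \<le> real M * x" "real M * x < real q + 1"
        using x[folded R_def, folded M_def] M by (auto simp: divide_le_eq less_divide_eq mult.commute)
      define z where "z = \<lfloor>real M * (x + of_int b + \<tau> q * a) + 1 / 2\<rfloor>"
      have z: "\<bar>real M * (x + of_int b + \<tau> q * a) - of_int z\<bar> \<le> 1 / 2" unfolding z_def by linarith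
      have y3: "\<bar>real M * y q - (real M * of_int b + real q)\<bar> < 3" using y[OF q] by simp
      have te: "\<bar>real M * (\<tau> q * e) - real M * (\<tau> q * a)\<bar> \<le> 2 * T"
      proof -
        have "real M * (\<tau> q * e) - real M * (\<tau> q * a) = \<tau> q * (real M * e - real M * a)" by (simp add: algebra_simps)
        then have "\<bar>real M * (\<tau> q * e) - real M * (\<tau> q * a)\<bar> = \<tau> q * \<bar>real M * e - real M * a\<bar>"
          using \<tau>q by (simp add: abs_mult)
        also have "\<dots> \<le> T * 2" using \<tau>q Me T by (intro mult_mono) auto
        finally show ?thesis by simp
      qed
      have vv: "of_int v \<le> real M * y q + real M * (\<tau> q * e)" "real M * y q + real M * (\<tau> q * e) < of_int v + 1"
        unfolding v_def distrib_left[symmetric] by linarith+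
      have zz: "\<bar>real M * x + real M * of_int b + real M * (\<tau> q * a) - of_int z\<bar> \<le> 1 / 2"
        using z by (simp add: distrib_left)
      have "\<bar>of_int z - of_int v\<bar> \<le> 2 * T + 5 + (1 / 2 :: real)"
        using vv zz te xq y3 by linarith
      then have zv: "z - v \<in> {-D..D}" using D by auto
      have \<tau>e: "0 \<le> \<tau> q * e" "\<tau> q * e \<le> 3 * T"
      proof -
        show "0 \<le> \<tau> q * e" using \<tau>q e a12 by simp
        have "\<tau> q * e \<le> T * 3" using \<tau>q e3 e a12 T by (intro mult_mono) auto
        then show "\<tau> q * e \<le> 3 * T" by simp
      qed
      have vV: "v \<in> V b"
      proof -
        have M1: "1 \<le> real M" using M by simp
        have qM: "real q < real M" using q by (simp add: Q_def)
        have "0 \<le> real M * (\<tau> q * e)" using \<tau>e by simp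
        then have "real M * of_int b - 4 \<le> of_int v" using vv y3 by linarith
        moreover have "real M * 3 \<ge> 4" using M by linarith
        ultimately have "real M * (of_int b - 3) \<le> of_int v" by (simp add: algebra_simps)
        then have "real_of_int (int M * (b - 3)) \<le> real_of_int v" by simp
        then have 1: "int M * (b - 3) \<le> v" by (simp only: of_int_le_iff)
        have "real M * (\<tau> q * e) \<le> real M * (3 * T)" using \<tau>e by (intro mult_left_mono) auto
        then have "of_int v \<le> real M * of_int b + real M + 3 + real M * (3 * T)" using vv y3 qM by linarith
        also have "\<dots> \<le> real M * (of_int b + (3 * T + 4))" using M1 by (simp add: algebra_simps)
        also have "\<dots> \<le> real M * (of_int b + of_int L)" using L by (intro mult_left_mono) auto
        finally have "real_of_int v \<le> real_of_int (int M * (b + L))" by simp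
        then have 2: "v \<le> int M * (b + L)" by (simp only: of_int_le_iff)
        show ?thesis unfolding V_def using v 1 2 by simp
      qed
      \<comment> \<open>Reducing the index modulo \<open>M\<close> reduces the point modulo 1; the
        quotient, corrected by \<open>b\<close>, is the integer \<open>m\<close> of
        \<open>hit\<close>.\<close>
      define w where "w = nat (z mod int M)"
      have wW: "w \<in> W b"
        unfolding W_def w_def using vV zv by (intro image_eqI[of _ _ "(v, z - v)"]) auto
      have w: "int w = z mod int M" unfolding w_def using M by simp
      have "z = int M * (z div int M) + int w" unfolding w by simp
      then have "real_of_int z = real_of_int (int M * (z div int M) + int w)" by (simp only:)
      then have zw: "real_of_int z = real M * of_int (z div int M) + real w" by simp
      have "\<bar>real M * (x + \<tau> q * a - real w / real M - of_int (z div int M - b))\<bar> \<le> 1 / 2"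
        using zz zw M by (simp add: algebra_simps)
      moreover have "\<bar>u\<bar> \<le> 1 / (2 * real M)" if "\<bar>real M * u\<bar> \<le> 1 / 2" for u :: real
        using that M by (simp add: abs_mult field_simps)
      ultimately have "\<bar>x + \<tau> q * a - real w / real M - of_int (z div int M - b)\<bar> \<le> 1 / (2 * real M)"
        by blast
      moreover have "1 / (2 * real M) = 1 / (4 * real R)" by (simp add: M_def)
      ultimately show "\<exists>w\<in>W b. \<exists>m::int. \<bar>x + \<tau> q * a - real w / real (2 * N ^ j) - of_int m\<bar> \<le> 1 / (4 * real (N ^ j))"
        using wW unfolding M_def R_def by metis
    qed
    then show ?thesis by (simp add: K_def)
  qed
  define B where "B = (\<Union>v\<in>?VX. {v div int M - L..v div int M + 3})"
  have finB: "finite B" unfolding B_def using fin by auto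
  have V_index: "b \<in> {v div int M - L..v div int M + 3}" if "v \<in> V b" for v b
  proof -
    have "b - 3 \<le> v div int M"
      using zdiv_mono1[of "int M * (b - 3)" v "int M"] that M by (simp add: V_def)
    moreover have "v div int M \<le> b + L"
      using zdiv_mono1[of v "int M * (b + L)" "int M"] that M by (simp add: V_def)
    ultimately show ?thesis by simp
  qed
  have VY: "?VY \<subseteq> (\<Union>b\<in>B. (\<lambda>q. int M * b + int q) ` Q b)"
  proof
    fix u assume u: "u \<in> ?VY"
    define b where "b = u div int M"
    define q where "q = nat (u mod int M)"
    have uq: "u = int M * b + int q" using M by (simp add: b_def q_def)
    have "q < M" using M by (simp add: q_def nat_less_iff)
    then have q: "q \<in> Q b" using u unfolding Q_def by (simp flip: uq)
    have "finite (Q b)" by (rule finite_subset[of _ "{..<M}"]) (auto simp: Q_def)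
    then have "0 < real (card (Q b))" using q by (auto simp: card_gt_0_iff)
    \<comment> \<open>The incidence bound itself shows that a block with a cell near
      \<open>Y\<close> sees a cell of \<open>X\<close>, so only finitely many blocks matter.\<close>
    then have "card (W b) \<noteq> 0" using block[of b] by (intro notI) simp
    then have "V b \<noteq> {}" using cardW[of b] by (intro notI) simp
    then obtain v where v: "v \<in> V b" by blast
    then have "b \<in> B" unfolding B_def using V_index[OF v] by (auto simp: V_def)
    then show "u \<in> (\<Union>b\<in>B. (\<lambda>q. int M * b + int q) ` Q b)" using q uq by blast
  qed
  have finU: "finite (\<Union>b\<in>B. (\<lambda>q. int M * b + int q) ` Q b)"
    using finB by (intro finite_UN_I finite_imageI) (auto simp: Q_def)
  show "finite ?VY" by (rule finite_subset[OF VY finU])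
  have "card ?VY \<le> card (\<Union>b\<in>B. (\<lambda>q. int M * b + int q) ` Q b)" by (rule card_mono[OF finU VY])
  also have "\<dots> \<le> (\<Sum>b\<in>B. card ((\<lambda>q. int M * b + int q) ` Q b))" by (rule card_UN_le[OF finB])
  also have "\<dots> \<le> (\<Sum>b\<in>B. card (Q b))" by (intro sum_mono card_image_le) (auto simp: Q_def)
  finally have "real (card ?VY) \<le> (\<Sum>b\<in>B. real (card (Q b)))" by (simp flip: of_nat_sum)
  also have "\<dots> \<le> (\<Sum>b\<in>B. K * (of_int (2 * D + 1) * real (card (V b))))"
  proof (intro sum_mono)
    fix b
    have "real (card (W b)) \<le> real (nat (2 * D + 1) * card (V b))" using cardW[of b] by (simp only: of_nat_le_iff)
    also have "\<dots> = of_int (2 * D + 1) * real (card (V b))" using D by simp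
    finally show "real (card (Q b)) \<le> K * (of_int (2 * D + 1) * real (card (V b)))"
      using block[of b] K by (meson less_imp_le mult_left_mono order_trans)
  qed
  also have "\<dots> = K * of_int (2 * D + 1) * (\<Sum>b\<in>B. real (card (V b)))"
    by (simp add: sum_distrib_left mult.assoc)
  also have "(\<Sum>b\<in>B. real (card (V b))) \<le> of_int (L + 4) * real (card ?VX)"
  proof -
    have "(\<Sum>b\<in>B. real (card (V b))) = (\<Sum>b\<in>B. \<Sum>v\<in>?VX. if v \<in> V b then 1 else 0)"
    proof (rule sum.cong[OF refl])
      fix b
      have "{v \<in> ?VX. v \<in> V b} = V b" by (auto simp: V_def)
      then show "real (card (V b)) = (\<Sum>v\<in>?VX. if v \<in> V b then 1 else 0)"
        using fin by (simp add: sum.If_cases Int_def)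
    qed
    also have "\<dots> = (\<Sum>v\<in>?VX. \<Sum>b\<in>B. if v \<in> V b then 1 else 0)" by (rule sum.swap)
    also have "\<dots> \<le> (\<Sum>v\<in>?VX. of_int (L + 4))"
    proof (rule sum_mono)
      fix v
      have "(\<Sum>b\<in>B. if v \<in> V b then 1 else 0 :: real) = real (card {b \<in> B. v \<in> V b})"
        using finB by (simp add: sum.If_cases Int_def)
      also have "card {b \<in> B. v \<in> V b} \<le> card {v div int M - L..v div int M + 3}"
        using V_index by (intro card_mono) auto
      also have "card {v div int M - L..v div int M + 3} = nat (L + 4)" using L by simp
      finally show "(\<Sum>b\<in>B. if v \<in> V b then 1 else 0) \<le> real_of_int (L + 4)" using L by simp
    qed
    also have "\<dots> = of_int (L + 4) * real (card ?VX)" by simp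
    finally show ?thesis .
  qed
  finally have "real (card ?VY) \<le> K * of_int (2 * D + 1) * (of_int (L + 4) * real (card ?VX))"
    using K D by (simp add: mult_left_mono)
  then show "real (card ?VY)
      \<le> incidence_const p N T * (real (j + 1) powr p * max 1 (loss_base p c0 C) ^ j) * overlap_const T * real (card ?VX)"
    by (simp add: K_def overlap_const_def D_def L_def mult_ac add_ac)
qed

text \<open>If \<open>X\<close> meets infinitely many cells, the right-hand side is infinite;
  otherwise cell counts on the grid of spacing \<open>1 / (2 * N ^ j)\<close> bound one measure from
  above and the other from below.\<close>

lemma emeasure_nbhd_le:
  fixes j :: nat
  assumes c0: "0 < c0" and T: "0 \<le> T" and t: "\<And>y. y \<in> Y \<Longrightarrow> t y \<le> T"
    and XY: "contains_dilates (\<Inter>j\<in>{1..}. cantor_stage N S j) X Y t"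
  shows "emeasure lborel (nbhd (1 / real N ^ j) Y)
    \<le> ennreal (incidence_const p N T * overlap_const T * (real (j + 1) powr p * max 1 (loss_base p c0 C) ^ j))
       * emeasure lborel (nbhd (1 / real N ^ j) X)"
proof -
  let ?M = "2 * N ^ j"
  let ?K = "incidence_const p N T * overlap_const T * (real (j + 1) powr p * max 1 (loss_base p c0 C) ^ j)"
  have K: "0 < ?K" using incidence_const_pos[OF T] overlap_const_pos[OF T] by (intro mult_pos_pos) auto
  have M: "0 < ?M" using N by simp
  have r: "1 / real ?M \<le> 1 / real N ^ j" using N by (simp add: field_simps)
  show ?thesis
  proof (cases "finite (cells ?M X)")
    case False
    have "ennreal k * \<infinity> = \<infinity>" if "0 < k" for k using that by (simp add: ennreal_mult_top)
    then have "ennreal ?K * emeasure lborel (nbhd (1 / real N ^ j) X) = \<infinity>"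
      using K by (simp only: emeasure_nbhd_infinite_cells[OF M r False])
    then show ?thesis by simp
  next
    case True
    note C = card_cells_le[OF c0 T t XY True]
    let ?Y = "nbhd (1 / real (N ^ j)) Y"
    have "emeasure lborel ?Y \<le> ennreal (real (card (cells ?M ?Y)) / real ?M)"
      by (rule emeasure_le_cells[OF M C(1)])
    also have "\<dots> \<le> ennreal (?K * (real (card (cells ?M X)) / real ?M))"
      using divide_right_mono[OF C(2), of "real ?M"] by (intro ennreal_leI) (simp add: mult_ac)
    also have "\<dots> = ennreal ?K * ennreal (real (card (cells ?M X)) / real ?M)"
      using K by (intro ennreal_mult') auto
    also have "\<dots> \<le> ennreal ?K * emeasure lborel (nbhd (1 / real N ^ j) X)"
      by (intro mult_left_mono emeasure_nbhd_ge_cells[OF M r _ True]) auto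
    finally show ?thesis by simp
  qed
qed

end

subsection \<open>Minkowski dimension\<close>

lemma unbounded_nbhd:
  assumes "\<not> bounded X" "0 < r"
  shows "emeasure lborel (nbhd r X) = \<infinity>"
proof -
  define M where "M = nat \<lceil>1 / r\<rceil>"
  have "1 / r \<le> real M" unfolding M_def by (rule real_nat_ceiling_ge)
  moreover have "0 < 1 / r" using assms by simp
  ultimately have M0: "0 < real M" and Mr: "1 \<le> r * real M" using assms by (linarith, simp add: divide_le_eq mult.commute)
  have M: "0 < M" "1 / real M \<le> r" using M0 Mr by (simp_all add: divide_le_eq)
  have "infinite (cells M X)"
  proof
    assume fin: "finite (cells M X)"
    have "X \<subseteq> (\<Union>v\<in>cells M X. {of_int v / real M..(of_int v + 1) / real M})"
    proof
      fix x assume "x \<in> X"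
      moreover have "of_int \<lfloor>real M * x\<rfloor> \<le> real M * x" "real M * x \<le> of_int \<lfloor>real M * x\<rfloor> + 1" by linarith+
      ultimately show "x \<in> (\<Union>v\<in>cells M X. {of_int v / real M..(of_int v + 1) / real M})"
        using M by (intro UN_I[OF floor_in_cells]) (auto simp: divide_le_eq le_divide_eq mult.commute)
    qed
    moreover have "bounded (\<Union>v\<in>cells M X. {of_int v / real M..(of_int v + 1) / real M})"
      using fin by (intro bounded_UN) auto
    ultimately show False using assms(1) bounded_subset by blast
  qed
  then show ?thesis by (rule emeasure_nbhd_infinite_cells[OF M])
qed

lemma nbhd_mono: "r \<le> s \<Longrightarrow> nbhd r X \<subseteq> nbhd s X"
  unfolding nbhd_def by (auto intro: less_le_trans)

text \<open>A point within \<open>N * s\<close> of \<open>y\<close> comes within \<open>s\<close> of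
  \<open>y\<close> after subtracting some \<open>i * s\<close> with
  \<open>\<bar>i\<bar> \<le> N\<close>, so \<open>2 * N + 1\<close> translates cover.\<close>

lemma emeasure_nbhd_enlarge:
  assumes s: "0 < s" and r: "r \<le> real N * s"
  shows "emeasure lborel (nbhd r Y) \<le> ennreal (2 * real N + 1) * emeasure lborel (nbhd s Y)"
proof -
  let ?T = "\<lambda>i::int. (+) (of_int i * s) ` nbhd s Y"
  have open_T: "open (?T i)" for i by (intro open_translation open_nbhd)
  have "nbhd r Y \<subseteq> (\<Union>i\<in>{-int N..int N}. ?T i)"
  proof
    fix x assume "x \<in> nbhd r Y"
    then obtain y where y: "y \<in> Y" "\<bar>y - x\<bar> < r" unfolding nbhd_def by (auto simp: dist_real_def)
    define i where "i = \<lfloor>(x - y) / s\<rfloor>"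
    have i: "of_int i \<le> (x - y) / s" "(x - y) / s < of_int i + 1" unfolding i_def by linarith+
    then have i': "of_int i * s \<le> x - y" "x - y < of_int i * s + s"
      using s by (simp_all add: le_divide_eq divide_less_eq distrib_right)
    have "\<bar>x - y\<bar> / s < real N" using y r s by (simp add: divide_less_eq)
    then have "\<bar>(x - y) / s\<bar> < real N" using s by simp
    then have "of_int i < real N" using i by linarith
    then have "i \<in> {-int N..int N}"
    proof -
      have "- real N < of_int i + 1" using i \<open>\<bar>(x - y) / s\<bar> < real N\<close> by linarith
      then have "- int N < i + 1" by linarith
      moreover have "i < int N" using \<open>of_int i < real N\<close> by linarith
      ultimately show ?thesis by simp
    qed
    moreover have "x - of_int i * s \<in> nbhd s Y"
      unfolding nbhd_def by (rule UN_I[OF y(1)]) (use i' in \<open>simp add: dist_real_def abs_less_iff\<close>)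
    then have "x \<in> ?T i" by (intro image_eqI[of _ _ "x - of_int i * s"]) auto
    ultimately show "x \<in> (\<Union>i\<in>{-int N..int N}. ?T i)" by blast
  qed
  then have "emeasure lborel (nbhd r Y) \<le> emeasure lborel (\<Union>i\<in>{-int N..int N}. ?T i)"
    using open_T by (intro emeasure_mono sets.finite_UN) auto
  also have "\<dots> \<le> (\<Sum>i\<in>{-int N..int N}. emeasure lborel (?T i))"
    using open_T by (intro emeasure_subadditive_finite) auto
  also have "\<dots> = (\<Sum>i\<in>{-int N..int N}. emeasure lborel (nbhd s Y))"
  proof (rule sum.cong[OF refl])
    fix i :: int
    have "emeasure lborel (nbhd s Y) = emeasure (distr lborel borel ((+) (of_int i * s))) (?T i)"
      using open_T[of i] by (subst emeasure_distr) (auto simp: inj_vimage_image_eq)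
    then show "emeasure lborel (?T i) = emeasure lborel (nbhd s Y)" by (simp add: lborel_distr_plus)
  qed
  also have "\<dots> = ennreal (2 * real N + 1) * emeasure lborel (nbhd s Y)"
    by (simp add: ennreal_of_nat_eq_real_of_nat)
  finally show ?thesis .
qed

text \<open>For the least \<open>n\<close> with \<open>1 / N ^ n \<le> r\<close>, minimality gives
  \<open>r \<le> N * (1 / N ^ n)\<close>; exchanging the two radii costs only factors depending on
  \<open>N\<close> and \<open>\<delta>\<close>.\<close>

lemma emeasure_nbhd_all_scales:
  assumes N: "2 \<le> N" and \<delta>: "0 \<le> \<delta>" and c: "0 < c"
    and le: "\<And>j::nat. ennreal (c * real N powr (- (real j * \<delta>))) * emeasure lborel (nbhd (1 / real N ^ j) Y)
       \<le> emeasure lborel (nbhd (1 / real N ^ j) X)"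
  obtains c' where "0 < c'"
    "\<And>r. 0 < r \<Longrightarrow> r \<le> 1 \<Longrightarrow> ennreal (c' * r powr \<delta>) * emeasure lborel (nbhd r Y) \<le> emeasure lborel (nbhd r X)"
proof
  define c' where "c' = c * real N powr (- \<delta>) / (2 * real N + 1)"
  show "0 < c'" using c N by (simp add: c'_def)
  fix r :: real assume r: "0 < r" "r \<le> 1"
  have "\<exists>n. (1 / real N) ^ n < r" using r N by (intro real_arch_pow_inv) auto
  then have ex: "\<exists>n. 1 / real N ^ n \<le> r" by (auto simp: power_divide intro: less_imp_le)
  define n where "n = (LEAST n. 1 / real N ^ n \<le> r)"
  have n: "1 / real N ^ n \<le> r" unfolding n_def by (rule LeastI_ex[OF ex])
  let ?s = "1 / real N ^ n"
  have s: "0 < ?s" using N by simp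
  have rs: "r \<le> real N * ?s"
  proof (cases n)
    case 0
    then show ?thesis using r N by simp
  next
    case (Suc m)
    then have "\<not> 1 / real N ^ m \<le> r" unfolding n_def using not_less_Least lessI by metis
    then show ?thesis using Suc N by simp
  qed
  have "c' * r powr \<delta> * (2 * real N + 1) \<le> c * real N powr (- (real n * \<delta>))"
  proof -
    have "r powr \<delta> \<le> (real N * ?s) powr \<delta>" using rs r \<delta> by (intro powr_mono2) auto
    also have "\<dots> = real N powr \<delta> * ?s powr \<delta>" by (rule powr_mult)
    also have "?s powr \<delta> = real N powr (- (real n * \<delta>))"
      using N by (simp add: powr_minus_divide powr_divide powr_powr flip: powr_realpow)
    finally have "real N powr (- \<delta>) * r powr \<delta> \<le> real N powr (- \<delta>) * (real N powr \<delta> * real N powr (- (real n * \<delta>)))"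
      by (intro mult_left_mono) auto
    also have "\<dots> = real N powr (- (real n * \<delta>))" using N by (simp add: mult.assoc[symmetric] flip: powr_add)
    finally have "c * (real N powr (- \<delta>) * r powr \<delta>) \<le> c * real N powr (- (real n * \<delta>))"
      using c by (intro mult_left_mono) auto
    moreover have "c' * r powr \<delta> * (2 * real N + 1) = c * (real N powr (- \<delta>) * r powr \<delta>)"
      by (simp add: c'_def add_nonneg_eq_0_iff)
    ultimately show ?thesis by linarith
  qed
  have "ennreal (c' * r powr \<delta>) * emeasure lborel (nbhd r Y)
     \<le> ennreal (c' * r powr \<delta>) * (ennreal (2 * real N + 1) * emeasure lborel (nbhd ?s Y))"
    by (intro mult_left_mono emeasure_nbhd_enlarge s rs) auto
  also have "\<dots> = ennreal (c' * r powr \<delta> * (2 * real N + 1)) * emeasure lborel (nbhd ?s Y)"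
    using \<open>0 < c'\<close> by (simp add: ennreal_mult' ennreal_mult'' mult.assoc)
  also have "\<dots> \<le> ennreal (c * real N powr (- (real n * \<delta>))) * emeasure lborel (nbhd ?s Y)"
    using \<open>c' * r powr \<delta> * (2 * real N + 1) \<le> _\<close> by (intro mult_right_mono ennreal_leI) auto
  also have "\<dots> \<le> emeasure lborel (nbhd ?s X)" by (rule le)
  also have "\<dots> \<le> emeasure lborel (nbhd r X)"
    using open_nbhd by (intro emeasure_mono nbhd_mono n) auto
  finally show "ennreal (c' * r powr \<delta>) * emeasure lborel (nbhd r Y) \<le> emeasure lborel (nbhd r X)" .
qed

text \<open>Logarithms are divided by \<open>ln r < 0\<close>, which reverses the inequality.
  Measures 0 and infinity are settled by the conventions of
  \<open>minkowski_quotient\<close>.\<close>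

lemma minkowski_quotient_le:
  assumes c: "0 < c" and r: "0 < r" "r < 1"
    and le: "ennreal (c * r powr \<delta>) * emeasure lborel (nbhd r Y) \<le> emeasure lborel (nbhd r X)"
  shows "minkowski_quotient Y r \<le> minkowski_quotient X r + ereal (\<delta> + ln c / ln r)"
proof (cases "emeasure lborel (nbhd r X) = \<infinity> \<or> emeasure lborel (nbhd r Y) = 0")
  case True
  then show ?thesis by (auto simp: minkowski_quotient_def)
next
  case False
  let ?x = "measure lborel (nbhd r X)" and ?y = "measure lborel (nbhd r Y)"
  have cr: "0 < c * r powr \<delta>" using c r by simp
  have X: "emeasure lborel (nbhd r X) = ennreal ?x" using False by (intro emeasure_eq_ennreal_measure) auto
  have Yfin: "emeasure lborel (nbhd r Y) \<noteq> \<infinity>"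
  proof
    assume "emeasure lborel (nbhd r Y) = \<infinity>"
    moreover have "ennreal k * \<infinity> = \<infinity>" if "0 < k" for k using that by (simp add: ennreal_mult_top)
    ultimately have "ennreal (c * r powr \<delta>) * emeasure lborel (nbhd r Y) = \<infinity>"
      using cr by (simp only:)
    then show False using le X by (simp add: top.extremum_unique)
  qed
  then have Y: "emeasure lborel (nbhd r Y) = ennreal ?y" by (intro emeasure_eq_ennreal_measure) auto
  have y: "0 < ?y" using False Y by (metis ennreal_0 measure_nonneg less_eq_real_def)
  have "ennreal (c * r powr \<delta> * ?y) \<le> ennreal ?x" using le cr unfolding X Y by (simp add: ennreal_mult')
  then have xy: "c * r powr \<delta> * ?y \<le> ?x" by (subst (asm) ennreal_le_iff) auto
  have x: "0 < ?x" using xy cr y by (meson less_le_trans mult_pos_pos)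
  have "ln (c * r powr \<delta> * ?y) \<le> ln ?x" using xy cr y x by (subst ln_le_cancel_iff) auto
  then have "ln c + \<delta> * ln r + ln ?y \<le> ln ?x" using c r y by (simp add: ln_mult ln_powr)
  then have "ln ?x / ln r \<le> (ln c + \<delta> * ln r + ln ?y) / ln r"
    using r by (intro divide_right_mono_neg) auto
  also have "\<dots> = ln c / ln r + \<delta> + ln ?y / ln r" using r by (simp add: add_divide_distrib)
  finally have "1 - ln ?y / ln r \<le> 1 - ln ?x / ln r + (\<delta> + ln c / ln r)" by simp
  moreover have "?x \<noteq> 0" "emeasure lborel (nbhd r X) \<noteq> 0" "emeasure lborel (nbhd r Y) \<noteq> 0"
    using x y X Y False by auto
  ultimately show ?thesis using False Yfin by (simp add: minkowski_quotient_def)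
qed

text \<open>The error \<open>ln c / ln r\<close> tends to 0, so near 0 it is below any
  \<open>e > 0\<close>.\<close>

lemma minkowski_dim_le:
  assumes c: "0 < c"
    and le: "\<And>r. 0 < r \<Longrightarrow> r \<le> 1 \<Longrightarrow> ennreal (c * r powr \<delta>) * emeasure lborel (nbhd r Y) \<le> emeasure lborel (nbhd r X)"
  shows "upper_minkowski_dim Y \<le> upper_minkowski_dim X + ereal \<delta>"
    and "lower_minkowski_dim Y \<le> lower_minkowski_dim X + ereal \<delta>"
proof -
  let ?F = "at_right (0::real)"
  have lim: "((\<lambda>r. ln c / ln r) \<longlongrightarrow> 0) ?F"
    by (intro tendsto_divide_0[OF tendsto_const] filterlim_at_bot_imp_at_infinity ln_at_0)
  have ev: "eventually (\<lambda>r. minkowski_quotient Y r \<le> minkowski_quotient X r + ereal (\<delta> + e)) ?F" if e: "0 < e" for e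
  proof -
    have "eventually (\<lambda>r. ln c / ln r < e) ?F" using order_tendstoD(2)[OF lim e] .
    moreover have "eventually (\<lambda>r::real. 0 < r \<and> r < 1) ?F"
      using eventually_at_right_real[of 0 1] by (auto elim: eventually_mono)
    ultimately show ?thesis
    proof eventually_elim
      case (elim r)
      then have "minkowski_quotient Y r \<le> minkowski_quotient X r + ereal (\<delta> + ln c / ln r)"
        by (intro minkowski_quotient_le[OF c _ _ le]) auto
      also have "\<dots> \<le> minkowski_quotient X r + ereal (\<delta> + e)"
        using elim by (intro add_left_mono) auto
      finally show ?case .
    qed
  qed
  show "upper_minkowski_dim Y \<le> upper_minkowski_dim X + ereal \<delta>"
    unfolding upper_minkowski_dim_def
  proof (rule ereal_le_epsilon2)
    fix e :: real assume "0 < e"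
    have "Limsup ?F (minkowski_quotient Y) \<le> Limsup ?F (\<lambda>r. minkowski_quotient X r + ereal (\<delta> + e))"
      by (rule Limsup_mono[OF ev[OF \<open>0 < e\<close>]])
    also have "\<dots> = Limsup ?F (minkowski_quotient X) + ereal (\<delta> + e)"
      by (rule Limsup_add_ereal_right) auto
    finally show "Limsup ?F (minkowski_quotient Y) \<le> Limsup ?F (minkowski_quotient X) + ereal \<delta> + ereal e"
      by (simp add: add.assoc)
  qed
  show "lower_minkowski_dim Y \<le> lower_minkowski_dim X + ereal \<delta>"
    unfolding lower_minkowski_dim_def
  proof (rule ereal_le_epsilon2)
    fix e :: real assume "0 < e"
    have "Liminf ?F (minkowski_quotient Y) \<le> Liminf ?F (\<lambda>r. minkowski_quotient X r + ereal (\<delta> + e))"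
      by (rule Liminf_mono[OF ev[OF \<open>0 < e\<close>]])
    also have "\<dots> = Liminf ?F (minkowski_quotient X) + ereal (\<delta> + e)"
      by (rule Liminf_add_ereal_right) auto
    finally show "Liminf ?F (minkowski_quotient Y) \<le> Liminf ?F (minkowski_quotient X) + ereal \<delta> + ereal e"
      by (simp add: add.assoc)
  qed
qed

lemma unbounded_minkowski_dim:
  assumes "\<not> bounded X"
  shows "upper_minkowski_dim X = \<infinity>" "lower_minkowski_dim X = \<infinity>"
proof -
  have ev: "eventually (\<lambda>r. minkowski_quotient X r = \<infinity>) (at_right 0)"
    using eventually_at_right_less[of "0::real"]
    by eventually_elim (simp add: minkowski_quotient_def unbounded_nbhd[OF assms])
  show "upper_minkowski_dim X = \<infinity>"
    unfolding upper_minkowski_dim_def by (subst Limsup_eq[OF ev]) (simp add: Limsup_const)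
  show "lower_minkowski_dim X = \<infinity>"
    unfolding lower_minkowski_dim_def by (subst Liminf_eq[OF ev]) (simp add: Liminf_const)
qed

section \<open>Bounds on the dilation factors and the choice of \<open>N\<close>\<close>

lemma powr_eventually_ge:
  fixes a K :: real
  assumes "0 < a" "0 \<le> K"
  shows "\<exists>n0. \<forall>n\<ge>n0. K \<le> real n powr a"
proof (intro exI allI impI)
  fix n assume "nat \<lceil>K powr (1 / a)\<rceil> \<le> n"
  then have "K powr (1 / a) \<le> real n" by linarith
  then have "(K powr (1 / a)) powr a \<le> real n powr a" using assms by (intro powr_mono2) auto
  then show "K \<le> real n powr a" using assms by (simp add: powr_powr)
qed

context cantor_tree
begin

text \<open>One point below each of two first digits; the strict bound in
  \<open>cantor_set_meets_interval\<close> separates them even when the intervals are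
  adjacent.\<close>

lemma two_points_in_cantor_set:
  assumes "2 \<le> N0"
  obtains e e' where "e \<in> (\<Inter>j\<in>{1..}. cantor_stage N S j)" "e' \<in> (\<Inter>j\<in>{1..}. cantor_stage N S j)" "e < e'"
proof -
  have "\<exists>s s'. s \<in> S 0 1 \<and> s' \<in> S 0 1 \<and> s < s'"
  proof (rule ccontr)
    assume "\<nexists>s s'. s \<in> S 0 1 \<and> s' \<in> S 0 1 \<and> s < s'"
    then have "\<And>s s'. s \<in> S 0 1 \<Longrightarrow> s' \<in> S 0 1 \<Longrightarrow> s = s'" by (metis linorder_neqE_nat)
    then have "card (S 0 1) \<le> 1"
      by (metis card_le_Suc0_iff_eq[OF finite_S[OF root_in_points]] One_nat_def)
    then show False using card_S[OF root_in_points] assms by simp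
  qed
  then obtain s s' where s: "s \<in> S 0 1" "s' \<in> S 0 1" "s < s'" by blast
  obtain e where e: "e \<in> (\<Inter>j\<in>{1..}. cantor_stage N S j)" "e < 1 + real s / real N ^ Suc 0 + 1 / real N ^ Suc 0"
    using cantor_set_meets_interval[OF child_in_points[OF root_in_points s(1)]] by blast
  obtain e' where e': "e' \<in> (\<Inter>j\<in>{1..}. cantor_stage N S j)" "1 + real s' / real N ^ Suc 0 \<le> e'"
    using cantor_set_meets_interval[OF child_in_points[OF root_in_points s(2)]] by blast
  have "(real s + 1) / real N \<le> real s' / real N" using s(3) by (intro divide_right_mono) auto
  then have "e < e'" using e(2) e'(2) by (simp add: add_divide_distrib)
  then show ?thesis using that e e' by blast
qed

text \<open>\<open>X\<close> contains \<open>y + t y * e\<close> and \<open>y + t y * e'\<close>, so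
  \<open>t y * (e' - e)\<close> cannot exceed its diameter.\<close>

lemma dilation_factors_bounded:
  assumes "2 \<le> N0" and XY: "contains_dilates (\<Inter>j\<in>{1..}. cantor_stage N S j) X Y t" and X: "bounded X"
  obtains T where "\<And>y. y \<in> Y \<Longrightarrow> t y \<le> T"
proof -
  obtain e e' where e: "e \<in> (\<Inter>j\<in>{1..}. cantor_stage N S j)" "e' \<in> (\<Inter>j\<in>{1..}. cantor_stage N S j)" "e < e'"
    by (rule two_points_in_cantor_set[OF assms(1)])
  obtain B where B: "\<And>x. x \<in> X \<Longrightarrow> \<bar>x\<bar> \<le> B" using X unfolding bounded_real by blast
  have "t y \<le> 2 * B / (e' - e)" if y: "y \<in> Y" for y
  proof -
    have in_X: "y + t y * z \<in> X" if "z \<in> (\<Inter>j\<in>{1..}. cantor_stage N S j)" for z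
      using XY y that unfolding contains_dilates_def by blast
    have "t y * (e' - e) = (y + t y * e') - (y + t y * e)" by (simp add: algebra_simps)
    also have "\<dots> \<le> 2 * B" using B[OF in_X[OF e(1)]] B[OF in_X[OF e(2)]] by linarith
    finally show ?thesis using e by (simp add: le_divide_eq)
  qed
  then show ?thesis using that by blast
qed

end

lemma cantor_tree_of_Cantor:
  assumes "2 \<le> p" "0 < C" "2 \<le> N" "Lambda_p_Cantor p c0 c1 C N E \<mu>"
  obtains N0 S where "cantor_tree p c0 c1 C N N0 S" "E = (\<Inter>j\<in>{1..}. cantor_stage N S j)"
proof -
  from assms(4) obtain N0 \<Sigma> S where *: "0 < N0" "\<forall>T\<in>\<Sigma>. card T = N0 \<and> Lambda_p_set p c0 c1 C N T"
    "\<forall>k. \<forall>a\<in>cantor_points N S k. S k a \<in> \<Sigma>" "E = (\<Inter>j\<in>{1..}. cantor_stage N S j)"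
    unfolding Lambda_p_Cantor_def by blast
  have "cantor_tree p c0 c1 C N N0 S"
    by unfold_locales (use assms * in auto)
  then show ?thesis using that * by blast
qed

text \<open>Half of \<open>\<delta>\<close> pays for \<open>K ^ j\<close>, the other half for the
  polynomial factor, through \<open>j + 1 \<le> 2 ^ j\<close>.\<close>

lemma loss_le_powr:
  fixes j :: nat
  assumes p: "0 < p" and N: "K \<le> real N powr (\<delta> / 2)" "2 \<le> real N powr (\<delta> / (2 * p))" and K: "0 \<le> K"
  shows "real (j + 1) powr p * K ^ j \<le> real N powr (real j * \<delta>)"
proof -
  have N0: "0 < real N"
  proof (rule ccontr)
    assume "\<not> 0 < real N"
    then show False using N(2) by simp
  qed
  have "real (j + 1) \<le> 2 ^ j" using less_exp[of j] by (metis Suc_eq_plus1 Suc_leI of_nat_le_iff of_nat_numeral of_nat_power)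
  also have "\<dots> \<le> (real N powr (\<delta> / (2 * p))) ^ j" using N by (intro power_mono) auto
  also have "\<dots> = real N powr (real j * \<delta> / (2 * p))" using N0 by (simp add: powr_powr mult.commute flip: powr_realpow)
  finally have "real (j + 1) powr p \<le> (real N powr (real j * \<delta> / (2 * p))) powr p" using p by (intro powr_mono2) auto
  also have "\<dots> = real N powr (real j * \<delta> / 2)" using p by (simp add: powr_powr)
  finally have 1: "real (j + 1) powr p \<le> real N powr (real j * \<delta> / 2)" .
  have "K ^ j \<le> (real N powr (\<delta> / 2)) ^ j" using N K by (intro power_mono)
  also have "\<dots> = real N powr (real j * \<delta> / 2)" using N0 by (simp add: powr_powr mult.commute flip: powr_realpow)
  finally have "real (j + 1) powr p * K ^ j \<le> real N powr (real j * \<delta> / 2) * real N powr (real j * \<delta> / 2)"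
    using 1 K by (intro mult_mono) auto
  also have "\<dots> = real N powr (real j * \<delta>)" unfolding powr_add[symmetric] by (simp add: mult.commute)
  finally show ?thesis .
qed

text \<open>For factors bounded by \<open>T\<close>, one constant serves all Cantor sets and all
  \<open>X\<close> and \<open>Y\<close>. In the second part it may depend on them: an unbounded
  \<open>X\<close> has neighbourhoods of infinite measure, and a bounded \<open>X\<close> forces a
  bound \<open>T\<close> on the factors.\<close>

theorem corollary1:
  fixes p \<delta> c0 c1 C :: real
  assumes "2 \<le> p" and "0 < \<delta>" and "0 < c0" and "0 < c1" and "0 < C"
    and "\<forall>\<^sub>F N in sequentially. \<exists>S. Lambda_p_set p c0 c1 C N S"
  shows "\<exists>Nstar. \<forall>N\<ge>Nstar.
    (\<forall>T. \<exists>c>0. \<forall>E \<mu> X Y t.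
       Lambda_p_Cantor p c0 c1 C N E \<mu> \<and> contains_dilates E X Y t \<and> (\<forall>x\<in>Y. t x \<le> T) \<longrightarrow>
       (\<forall>j::nat. emeasure lborel (nbhd (1 / real N ^ j) X)
          \<ge> ennreal (c * real N powr (- (real j * \<delta> * p)))
              * emeasure lborel (nbhd (1 / real N ^ j) Y))) \<and>
    (\<forall>E \<mu> X Y t. 
       Lambda_p_Cantor p c0 c1 C N E \<mu> \<and> contains_dilates E X Y t \<longrightarrow>
       (\<exists>c>0. \<forall>j::nat. emeasure lborel (nbhd (1 / real N ^ j) X)
          \<ge> ennreal (c * real N powr (- (real j * \<delta> * p)))
              * emeasure lborel (nbhd (1 / real N ^ j) Y)) \<and>
       upper_minkowski_dim X \<ge> upper_minkowski_dim Y - ereal \<delta> \<and>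
       lower_minkowski_dim X \<ge> lower_minkowski_dim Y - ereal \<delta>)"
proof -
  let ?K = "max 1 (loss_base p c0 C)"
  have "0 \<le> ?K" by simp
  \<comment> \<open>\<open>n1\<close> and \<open>n2\<close> are the thresholds of
    \<open>loss_le_powr\<close>; \<open>n3\<close> ensures
    \<open>c0 * N powr (2 / p) \<ge> 2\<close>, hence at least two digits per set.\<close>
  then obtain n1 where n1: "\<And>n. n \<ge> n1 \<Longrightarrow> ?K \<le> real n powr (\<delta> / 2)"
    using powr_eventually_ge[OF half_gt_zero[OF assms(2)], of ?K] by blast
  obtain n2 where n2: "\<And>n. n \<ge> n2 \<Longrightarrow> 2 \<le> real n powr (\<delta> / (2 * p))"
    using powr_eventually_ge[of "\<delta> / (2 * p)" 2] assms(1,2) by auto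
  obtain n3 where n3: "\<And>n. n \<ge> n3 \<Longrightarrow> 2 / c0 \<le> real n powr (2 / p)"
    using powr_eventually_ge[of "2 / p" "2 / c0"] assms(1,3) by auto
  let ?n = "max 2 (max n1 (max n2 n3))"
  show ?thesis
  proof (intro exI[of _ ?n] allI impI)
    fix N assume "?n \<le> N"
    then have large: "2 \<le> N" "?K \<le> real N powr (\<delta> / 2)" "2 \<le> real N powr (\<delta> / (2 * p))" "2 / c0 \<le> real N powr (2 / p)"
      using n1 n2 n3 by auto
    let ?V = "\<lambda>j X. emeasure lborel (nbhd (1 / real N ^ j) X)"
    let ?H = "\<lambda>T E \<mu> X Y t. Lambda_p_Cantor p c0 c1 C N E \<mu> \<and> contains_dilates E X Y t \<and> (\<forall>x\<in>Y. t x \<le> T)"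
    \<comment> \<open>This loses only \<open>N powr (- j * \<delta>)\<close>, so that the Minkowski dimensions drop by at most \<open>\<delta>\<close>.\<close>
    have strong: "\<exists>c>0. \<forall>E \<mu> X Y t.
       ?H T E \<mu> X Y t \<longrightarrow>
       (\<forall>j::nat. ennreal (c * real N powr (- (real j * \<delta>))) * ?V j Y
          \<le> ?V j X)" for T
    proof -
      \<comment> \<open>A negative \<open>T\<close> is possible only for empty \<open>Y\<close>, but
        the estimates require a nonnegative bound.\<close>
      define T' where "T' = max 0 T"
      have T': "0 \<le> T'" "T \<le> T'" by (auto simp: T'_def)
      define \<kappa> where "\<kappa> = incidence_const p N T' * overlap_const T'"
      have \<kappa>: "0 < \<kappa>" unfolding \<kappa>_def using incidence_const_pos[OF T'(1)] overlap_const_pos[OF T'(1)] by simp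
      show ?thesis
      proof (intro exI[of _ "1 / \<kappa>"] conjI allI impI)
        fix E \<mu> X Y t and j :: nat
        assume H: "?H T E \<mu> X Y t"
        obtain N0 S where tree: "cantor_tree p c0 c1 C N N0 S" and E: "E = (\<Inter>j\<in>{1..}. cantor_stage N S j)"
          using cantor_tree_of_Cantor[OF assms(1,5) large(1)] H by blast
        interpret cantor_tree p c0 c1 C N N0 S by (rule tree)
        have "?V j Y \<le> ennreal (incidence_const p N T' * overlap_const T' * (real (j + 1) powr p * ?K ^ j)) * ?V j X"
        proof (rule emeasure_nbhd_le[OF assms(3) T'(1)])
          show "contains_dilates (\<Inter>j\<in>{1..}. cantor_stage N S j) X Y t" using H E by simp
          show "t y \<le> T'" if "y \<in> Y" for y using H T'(2) that by (meson order_trans)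
        qed
        also have "\<dots> \<le> ennreal (\<kappa> * real N powr (real j * \<delta>)) * ?V j X"
          unfolding \<kappa>_def[symmetric] using \<kappa> large assms(1)
          by (intro mult_right_mono ennreal_leI mult_left_mono loss_le_powr) auto
        finally have "ennreal (1 / \<kappa> * real N powr (- (real j * \<delta>))) * ?V j Y
          \<le> ennreal (1 / \<kappa> * real N powr (- (real j * \<delta>))) * (ennreal (\<kappa> * real N powr (real j * \<delta>)) * ?V j X)"
          by (rule mult_left_mono) simp
        also have "\<dots> = ennreal (1 / \<kappa> * real N powr (- (real j * \<delta>)) * (\<kappa> * real N powr (real j * \<delta>))) * ?V j X"
          unfolding mult.assoc[symmetric, of "ennreal _" "ennreal _"]
          by (rule arg_cong[where f = "\<lambda>z. z * ?V j X"], rule ennreal_mult[symmetric]) (use \<kappa> in simp_all)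
        also have "1 / \<kappa> * real N powr (- (real j * \<delta>)) * (\<kappa> * real N powr (real j * \<delta>)) = 1"
        proof -
          have "real N powr (- (real j * \<delta>)) * real N powr (real j * \<delta>) = 1"
            using large(1) by (simp flip: powr_add)
          then show ?thesis using \<kappa> by (simp add: field_simps)
        qed
        finally show "ennreal (1 / \<kappa> * real N powr (- (real j * \<delta>))) * ?V j Y \<le> ?V j X" by simp
      qed (use \<kappa> in simp)
    qed
    have weaken: "ennreal (c * real N powr (- (real j * \<delta> * p))) * A \<le> B"
      if "0 < c" "ennreal (c * real N powr (- (real j * \<delta>))) * A \<le> B" for c A B and j :: nat
    proof -
      have "real j * \<delta> * 1 \<le> real j * \<delta> * p" using assms(1,2) by (intro mult_left_mono) auto
      then have "real N powr (- (real j * \<delta> * p)) \<le> real N powr (- (real j * \<delta>))" using large(1) by (intro powr_mono) auto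
      then have "ennreal (c * real N powr (- (real j * \<delta> * p))) * A \<le> ennreal (c * real N powr (- (real j * \<delta>))) * A"
        using that(1) by (intro mult_right_mono ennreal_leI mult_left_mono) auto
      then show ?thesis using that(2) by (rule order_trans)
    qed
    have uniform: "\<exists>c>0. \<forall>E \<mu> X Y t.
       ?H T E \<mu> X Y t \<longrightarrow>
       (\<forall>j::nat. ?V j X
          \<ge> ennreal (c * real N powr (- (real j * \<delta> * p))) * ?V j Y)" for T
    proof -
      obtain c where c: "0 < c" "\<forall>E \<mu> X Y t.
       ?H T E \<mu> X Y t \<longrightarrow>
       (\<forall>j::nat. ennreal (c * real N powr (- (real j * \<delta>))) * ?V j Y
          \<le> ?V j X)"
        using strong[of T] by (elim exE conjE)
      show ?thesis
      proof (intro exI[of _ c] conjI allI impI c(1))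
        fix E \<mu> X Y t and j :: nat
        assume H: "?H T E \<mu> X Y t"
        show "ennreal (c * real N powr (- (real j * \<delta> * p))) * ?V j Y
          \<le> ?V j X"
          using c(2)[THEN spec, THEN spec, THEN spec, THEN spec, THEN spec, THEN mp, OF H] by (intro weaken c(1)) (rule spec)
      qed
    qed
    have individual: "(\<exists>c>0. \<forall>j::nat. ?V j X
          \<ge> ennreal (c * real N powr (- (real j * \<delta> * p))) * ?V j Y) \<and>
       upper_minkowski_dim X \<ge> upper_minkowski_dim Y - ereal \<delta> \<and>
       lower_minkowski_dim X \<ge> lower_minkowski_dim Y - ereal \<delta>"
      if H: "Lambda_p_Cantor p c0 c1 C N E \<mu>" "contains_dilates E X Y t" for E \<mu> X Y t
    proof (cases "bounded X")
      case False
      have "?V j X = \<infinity>" for j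
        by (rule unbounded_nbhd[OF False]) (use large in simp)
      then show ?thesis using unbounded_minkowski_dim[OF False] by (auto intro!: exI[of _ 1])
    next
      case True
      obtain N0 S where tree: "cantor_tree p c0 c1 C N N0 S" and E: "E = (\<Inter>j\<in>{1..}. cantor_stage N S j)"
        by (rule cantor_tree_of_Cantor[OF assms(1,5) large(1) H(1)])
      interpret cantor_tree p c0 c1 C N N0 S by (rule tree)
      have "2 \<le> c0 * real N powr (2 / p)" using large(4) assms(3) by (simp add: divide_le_eq mult.commute)
      also have "\<dots> \<le> real N0"
        using S[OF root_in_points] card_S[OF root_in_points] unfolding Lambda_p_set_def by simp
      finally have "2 \<le> N0" by linarith
      then obtain T where T: "\<And>y. y \<in> Y \<Longrightarrow> t y \<le> T"
        using dilation_factors_bounded[OF _ H(2)[unfolded E] True] by blast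
      obtain c where c: "0 < c" and c2: "\<forall>E \<mu> X Y t.
       ?H T E \<mu> X Y t \<longrightarrow>
       (\<forall>j::nat. ennreal (c * real N powr (- (real j * \<delta>))) * ?V j Y
          \<le> ?V j X)"
        using strong[of T] by (elim exE conjE)
      have "?H T E \<mu> X Y t"
        using H T by simp
      note le = c2[THEN spec, THEN spec, THEN spec, THEN spec, THEN spec, THEN mp, OF this, THEN spec]
      obtain c' where c': "0 < c'"
        "\<And>r. 0 < r \<Longrightarrow> r \<le> 1 \<Longrightarrow> ennreal (c' * r powr \<delta>) * emeasure lborel (nbhd r Y) \<le> emeasure lborel (nbhd r X)"
        by (rule emeasure_nbhd_all_scales[OF large(1) less_imp_le[OF assms(2)] c le], rule that)
      have "upper_minkowski_dim Y - ereal \<delta> \<le> upper_minkowski_dim X"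
        "lower_minkowski_dim Y - ereal \<delta> \<le> lower_minkowski_dim X"
        using minkowski_dim_le[OF c'] by (simp_all add: ereal_minus_le)
      then show ?thesis by (intro conjI exI[of _ c] allI c weaken[OF c le])
    qed
    show "(\<forall>T. \<exists>c>0. \<forall>E \<mu> X Y t.
       ?H T E \<mu> X Y t \<longrightarrow>
       (\<forall>j::nat. ?V j X
          \<ge> ennreal (c * real N powr (- (real j * \<delta> * p)))
              * ?V j Y)) \<and>
    (\<forall>E \<mu> X Y t.
       Lambda_p_Cantor p c0 c1 C N E \<mu> \<and> contains_dilates E X Y t \<longrightarrow>
       (\<exists>c>0. \<forall>j::nat. ?V j X
          \<ge> ennreal (c * real N powr (- (real j * \<delta> * p)))
              * ?V j Y) \<and>
       upper_minkowski_dim X \<ge> upper_minkowski_dim Y - ereal \<delta> \<and>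
       lower_minkowski_dim X \<ge> lower_minkowski_dim Y - ereal \<delta>)"
    proof (intro conjI allI impI uniform; elim conjE)
      fix E \<mu> X Y t
      assume "Lambda_p_Cantor p c0 c1 C N E \<mu>" "contains_dilates E X Y t"
      note * = individual[OF this]
      show "\<exists>c>0. \<forall>j::nat. ?V j X
          \<ge> ennreal (c * real N powr (- (real j * \<delta> * p))) * ?V j Y"
        using * by (rule conjunct1)
      show "upper_minkowski_dim Y - ereal \<delta> \<le> upper_minkowski_dim X" using * by blast
      show "lower_minkowski_dim Y - ereal \<delta> \<le> lower_minkowski_dim X" using * by blast
    qed
  qed
qed

end
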